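(* Let $\alpha>0$ and let $X=\{X(t),t\ge 0\}$ (written also $X_t=X(t)$), with laws $(\mathbb{P}_x)_{x>0}$ and expectations $\mathbb{E}_x$, be an increasing positive self-similar Markov process with self-similarity index $1/\alpha$, and let $\phi$ be the Laplace exponent of the subordinator $\xi$ associated to $X$ via Lamperti's transformation. Let $\beta\in[0,1]$. The following conditions are equivalent: (i) $\phi$ is regularly varying at $0$ with index $\beta$. (ii) The law of $\phi\left(\frac{1}{\log(t)}\right)\int_0^tX_s^{-\alpha}\,ds$ under $\mathbb{P}_1$ converges in distribution, as $t\to\infty$, to the random variable $\alpha^{-\beta}W$, where $W$ follows a Mittag-Leffler law of parameter $\beta$. (iii) For every $n=0,1,2,\dots$, $$\mathbb{E}_1\left(\left(\phi\left(\tfrac{1}{\log(t)}\right)\int_0^tX_s^{-\alpha}\,ds\right)^n\right)\xrightarrow[t\to\infty]{}\frac{\alpha^{-\beta n}\,n!}{\Gamma(1+n\beta)}.$$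
   Context: An increasing positive self-similar Markov process with index $1/\alpha$ is a $(0,\infty)$-valued strong Markov process $X$ with càdlàg nondecreasing paths such that, $\mathbb{P}_x$ denoting its law started from $x>0$, for every $c>0$ and $x>0$ the process $\{cX(tc^{-\alpha}),t\ge0\}$ under $\mathbb{P}_x$ has the same law as $\{X(t),t\ge 0\}$ under $\mathbb{P}_{cx}$. A subordinator is a càdlàg real-valued process with stationary independent increments and nondecreasing paths (no killing), started at $0$. Its Laplace exponent is $\phi(\lambda)=-\log \mathbf{E}(e^{-\lambda\xi_1})=d\lambda+\int_{(0,\infty)}(1-e^{-\lambda x})\Pi(dx)$, $\lambda\ge 0$, where $d\ge 0$ and $\int (1\wedge x)\Pi(dx)<\infty$. Lamperti's transformation: the subordinator associated to $X$ is $\xi_t=\log\big(X(\gamma_t)/X(0)\big)$, where $\gamma$ is the inverse of $t\mapsto\int_0^tX(s)^{-\alpha}ds$. Conversely, given a subordinator $\xi$ with law $\mathbf{P}$, $\mathbb{P}_x$ is the law of $\{x\exp(\xi_{\tau(tx^{-\alpha})}),t\ge0\}$, where $\tau$ is the inverse of $t\mapsto C_t=\int_0^t e^{\alpha\xi_s}ds$. $\phi$ is regularly varying at $0$ with index $\beta$ if $\lim_{\lambda\to0+}\phi(c\lambda)/\phi(\lambda)=c^\beta$ for every $c>0$. The Mittag-Leffler law of parameter $\beta\in[0,1]$ is the law on $[0,\infty)$ determined by its moments $n!/\Gamma(1+n\beta)$, $n\ge0$ (exponential of parameter $1$ for $\beta=0$; Dirac mass at $1$ for $\beta=1$). *)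

theory Defs
  imports "HOL-Probability.Probability"
begin

section \<open>Increasing positive self-similar Markov processes\<close>

definition cadlag :: "(real \<Rightarrow> real) \<Rightarrow> bool" where
  "cadlag f \<longleftrightarrow> (\<forall>t\<ge>0. continuous (at_right t) f) \<and> (\<forall>t>0. \<exists>l. (f \<longlongrightarrow> l) (at_left t))"

abbreviation path_space :: "(real \<Rightarrow> real) measure" where
  "path_space \<equiv> Pi\<^sub>M {0..} (\<lambda>_. borel)"

definition path :: "(real \<Rightarrow> 'a \<Rightarrow> real) \<Rightarrow> 'a \<Rightarrow> real \<Rightarrow> real" where
  "path X \<omega> = (\<lambda>t\<in>{0..}. X t \<omega>)"

definition law :: "'a measure \<Rightarrow> (real \<Rightarrow> 'a \<Rightarrow> real) \<Rightarrow> (real \<Rightarrow> real) measure" where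
  "law Q X = distr Q path_space (path X)"

text \<open>The time index is \<^typ>\<open>ennreal\<close>, so that stopping times are allowed to be infinite.\<close>

definition natural_filtration :: "'a set \<Rightarrow> (real \<Rightarrow> 'a \<Rightarrow> real) \<Rightarrow> ennreal \<Rightarrow> 'a measure" where
  "natural_filtration \<Omega> X t =
     sigma \<Omega> {X s -` B \<inter> \<Omega> | s B. 0 \<le> s \<and> ennreal s \<le> t \<and> B \<in> sets borel}"

lemma filtration_natural: "filtration \<Omega> (natural_filtration \<Omega> X)"
proof
  show "space (natural_filtration \<Omega> X i) = \<Omega>" for i
    unfolding natural_filtration_def by (rule space_measure_of) auto
  show "sets (natural_filtration \<Omega> X i) \<subseteq> sets (natural_filtration \<Omega> X j)" if "i \<le> j" for i j
    unfolding natural_filtration_def using that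
    by (subst (1 2) sets_measure_of; auto intro!: sigma_sets_subseteq intro: order_trans)
qed

text \<open>
  A family \<open>P x\<close>, \<open>x > 0\<close>, of probability measures on the common measurable space \<open>M\<close>, under which
  the process \<open>X\<close> starts from \<open>x\<close>. The strong Markov property is
  \<open>P x (A \<inter> {T < \<infinity>} \<inter> {X (T + \<cdot>) \<in> B}) = E x (P (X T) (X \<in> B); A \<inter> {T < \<infinity>})\<close> for \<open>A\<close> in the
  \<open>\<sigma>\<close>-algebra of the stopping time \<open>T\<close> of the natural filtration.
\<close>

locale increasing_pssMp =
  fixes M :: "'a measure"
    and P :: "real \<Rightarrow> 'a measure"
    and X :: "real \<Rightarrow> 'a \<Rightarrow> real"
    and \<alpha> :: real
  assumes \<alpha>_pos: "0 < \<alpha>"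
    and prob_space_P: "\<And>x. 0 < x \<Longrightarrow> prob_space (P x)"
    and sets_P: "\<And>x. 0 < x \<Longrightarrow> sets (P x) = sets M"
    and measurable_X: "\<And>t. 0 \<le> t \<Longrightarrow> X t \<in> borel_measurable M"
    and X_pos: "\<And>t \<omega>. \<omega> \<in> space M \<Longrightarrow> 0 \<le> t \<Longrightarrow> 0 < X t \<omega>"
    and X_mono: "\<And>\<omega>. \<omega> \<in> space M \<Longrightarrow> mono_on {0..} (\<lambda>t. X t \<omega>)"
    and X_cadlag: "\<And>\<omega>. \<omega> \<in> space M \<Longrightarrow> cadlag (\<lambda>t. X t \<omega>)"
    and start: "\<And>x. 0 < x \<Longrightarrow> (AE \<omega> in P x. X 0 \<omega> = x)"
    and kernel: "\<And>B. B \<in> sets path_space \<Longrightarrow>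
          (\<lambda>x. emeasure (law (P x) X) B) \<in> borel_measurable (restrict_space borel {0<..})"
    and strong_markov: "\<And>x T A B.
          0 < x \<Longrightarrow>
          stopping_time (natural_filtration (space M) X) T \<Longrightarrow>
          A \<in> sets (filtration.pre_sigma (space M) (natural_filtration (space M) X) T) \<Longrightarrow>
          B \<in> sets path_space \<Longrightarrow>
          emeasure (P x)
            {\<omega> \<in> A. T \<omega> < \<infinity> \<and> path (\<lambda>t. X (enn2real (T \<omega>) + t)) \<omega> \<in> B} =
          (\<integral>\<^sup>+ \<omega> \<in> {\<omega> \<in> A. T \<omega> < \<infinity>}. emeasure (law (P (X (enn2real (T \<omega>)) \<omega>)) X) B \<partial>P x)"
    and self_similar: "\<And>c x. 0 < c \<Longrightarrow> 0 < x \<Longrightarrow>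
          law (P x) (\<lambda>t \<omega>. c * X (t * c powr (-\<alpha>)) \<omega>) = law (P (c * x)) X"

section \<open>Lamperti's transformation\<close>

definition clock :: "real \<Rightarrow> (real \<Rightarrow> 'a \<Rightarrow> real) \<Rightarrow> real \<Rightarrow> 'a \<Rightarrow> real" where
  "clock \<alpha> X t \<omega> = (LINT s:{0..t}|lborel. X s \<omega> powr (-\<alpha>))"

text \<open>On the paths considered here the clock is continuous and strictly increasing from \<open>0\<close>.\<close>

definition inverse_clock :: "real \<Rightarrow> (real \<Rightarrow> 'a \<Rightarrow> real) \<Rightarrow> real \<Rightarrow> 'a \<Rightarrow> real" where
  "inverse_clock \<alpha> X t \<omega> = Inf {s. 0 \<le> s \<and> t < clock \<alpha> X s \<omega>}"

definition lamperti :: "real \<Rightarrow> (real \<Rightarrow> 'a \<Rightarrow> real) \<Rightarrow> real \<Rightarrow> 'a \<Rightarrow> real" where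
  "lamperti \<alpha> X t \<omega> = ln (X (inverse_clock \<alpha> X t \<omega>) \<omega> / X 0 \<omega>)"

definition laplace_exponent :: "'a measure \<Rightarrow> (real \<Rightarrow> 'a \<Rightarrow> real) \<Rightarrow> real \<Rightarrow> real" where
  "laplace_exponent Q \<xi> l = - ln (\<integral>\<omega>. exp (- l * \<xi> 1 \<omega>) \<partial>Q)"

section \<open>Regular variation, Mittag-Leffler laws, convergence in distribution\<close>

definition regularly_varying_at_0 :: "(real \<Rightarrow> real) \<Rightarrow> real \<Rightarrow> bool" where
  "regularly_varying_at_0 f \<beta> \<longleftrightarrow>
     (\<forall>c>0. ((\<lambda>l. f (c * l) / f l) \<longlongrightarrow> c powr \<beta>) (at_right 0))"

definition mittag_leffler_law :: "real \<Rightarrow> real measure \<Rightarrow> bool" where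
  "mittag_leffler_law \<beta> \<mu> \<longleftrightarrow>
     prob_space \<mu> \<and> sets \<mu> = sets borel \<and> (AE w in \<mu>. 0 \<le> w) \<and>
     (\<forall>n. has_bochner_integral \<mu> (\<lambda>w. w ^ n) (fact n / Gamma (1 + real n * \<beta>)))"

text \<open>The analogue of \<^const>\<open>weak_conv_m\<close> along an arbitrary filter.\<close>

definition converges_in_distribution ::
    "('t \<Rightarrow> real measure) \<Rightarrow> real measure \<Rightarrow> 't filter \<Rightarrow> bool" where
  "converges_in_distribution \<mu> \<nu> F \<longleftrightarrow>
     (\<forall>x. isCont (cdf \<nu>) x \<longrightarrow> ((\<lambda>t. cdf (\<mu> t) x) \<longlongrightarrow> cdf \<nu> x) F)"

end

theory Submission
  imports Defs
begin

text \<open>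
  Let \<open>\<xi>\<close> be the subordinator of \<open>X\<close> and \<open>A t\<close> the integral of \<open>X powr (-\<alpha>)\<close> over \<open>[0, t]\<close>. At the \<open>k\<close>-th
  inverse clock time \<open>X\<close> equals \<open>exp (\<xi> k)\<close>, so for every \<open>x\<close> monotonicity of the path gives
  \<open>min k (t * exp (-\<alpha> x)) \<le> A t\<close> if \<open>\<xi> k \<le> x\<close> and \<open>A t \<le> k + t * exp (-\<alpha> x)\<close> if \<open>\<xi> k > x\<close>. Thus \<open>A t\<close> is
  comparable to the number \<open>N x\<close> of the \<open>k\<close> with \<open>\<xi> k \<le> x\<close> at \<open>x = ln t / \<alpha>\<close>. Evaluated at an independent
  exponential time, \<open>N\<close> is geometric, so the Laplace transforms of its rising moments are powers of
  \<open>1 / (1 - exp (-\<phi>))\<close>. Regular variation of \<open>\<phi>\<close> gives the asymptotics of the moments by Karamata's Tauberian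
  argument. Conversely, if all moments behave as in the statement, the moments of \<open>\<phi> (1 / x) / \<phi> (1 / (u x))\<close> in an
  exponentially distributed \<open>u\<close> converge to those of \<open>u powr \<beta>\<close>, and monotonicity in \<open>u\<close> turns this
  into pointwise convergence. The moments are dominated by those of an exponential law,
  hence they determine the limit law; uniform integrability links them to convergence in distribution.
\<close>

section \<open>Convergence of moments\<close>

text \<open>The walk is sampled at the stopping times at which the clock reaches an integer: scaling
  by the current value turns the path after such a time into a fresh copy, and this is where the
  product structure of the walk comes from. The two sides of the comparison of \<open>A t\<close>
  with \<open>N\<close> cannot be used at the same level. The upper bound costs
  \<open>t * exp (-\<alpha> x)\<close>, which is \<open>1\<close> at
  \<open>x = ln t / \<alpha>\<close>. The lower bound is capped by that same quantity, so it is
  applied at \<open>(1 - e) * ln t / \<alpha>\<close>, where the cap is the power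
  \<open>t powr e\<close>. The inequality \<open>c * \<phi> l \<le> \<phi> (c * l)\<close> for
  \<open>c\<close> between \<open>0\<close> and \<open>1\<close> controls the normalisation under
  this dilation, and \<open>e\<close> tends to \<open>0\<close> last. In the converse nothing is
  known about \<phi> beforehand. What is available is the exact exponential average of the rising
  moments; dividing out their assumed asymptotics leaves the moments of a ratio of values of \<phi>.
  If the walk vanishes, \<phi> is \<open>0\<close> and \<open>N\<close> is infinite. This case is
  separated: there all three conditions fail.\<close>

lemma continuous_integral_tendsto_of_power_integrals:
  fixes \<mu> :: "'t \<Rightarrow> 'b measure" and \<nu> :: "'c measure"
    and V :: "'t \<Rightarrow> 'b \<Rightarrow> real" and V' :: "'c \<Rightarrow> real" and g :: "real \<Rightarrow> real"
  assumes fin: "\<And>t. finite_measure (\<mu> t)" "finite_measure \<nu>"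
    and meas [measurable]: "\<And>t. V t \<in> borel_measurable (\<mu> t)" "V' \<in> borel_measurable \<nu>"
    and unit: "\<And>t. AE x in \<mu> t. V t x \<in> {0..1}" "AE x in \<nu>. V' x \<in> {0..1}"
    and conv: "\<And>k. ((\<lambda>t. \<integral>x. V t x ^ k \<partial>\<mu> t) \<longlongrightarrow> (\<integral>x. V' x ^ k \<partial>\<nu>)) F"
    and g: "continuous_on UNIV g"
  shows "((\<lambda>t. \<integral>x. g (V t x) \<partial>\<mu> t) \<longlongrightarrow> (\<integral>x. g (V' x) \<partial>\<nu>)) F"
proof (rule tendstoI)
  fix e :: real assume e: "0 < e"
  \<comment> \<open>\<open>d * K = e / 3\<close>: replacing \<open>g\<close> by \<open>p\<close>
    costs at most \<open>e / 3\<close> on either side, as \<open>K\<close> exceeds the limit mass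
    and, by convergence of the zeroth powers, eventually every mass.\<close>
  define K where "K = measure \<nu> (space \<nu>) + 1"
  have K: "K > 0" unfolding K_def by (simp add: add_nonneg_pos)
  define d where "d = e / (3 * K)"
  have d: "d > 0" using e K by (simp add: d_def)
  obtain p where p: "real_polynomial_function p" "\<And>x. x \<in> {0..1} \<Longrightarrow> \<bar>g x - p x\<bar> < d"
    using Stone_Weierstrass_real_polynomial_function[OF compact_Icc continuous_on_subset[OF g] d]
    by (metis subset_UNIV)
  then obtain a n where pa: "p = (\<lambda>x. \<Sum>i\<le>n. a i * x ^ i)"
    unfolding real_polynomial_function_iff_sum by blast
  have [measurable]: "g \<in> borel_measurable borel" using g by (rule borel_measurable_continuous_onI)
  have p_cont: "continuous_on UNIV p" unfolding pa by (intro continuous_intros)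
  have [measurable]: "p \<in> borel_measurable borel" using p_cont by (rule borel_measurable_continuous_onI)
  have bounded: "\<exists>B. \<forall>x\<in>{0..1}. \<bar>h x\<bar> \<le> B" if "continuous_on UNIV h" for h :: "real \<Rightarrow> real"
  proof -
    have "compact (h ` {0..1})" by (intro compact_continuous_image continuous_on_subset[OF that]) auto
    then show ?thesis by (auto dest!: compact_imp_bounded simp: bounded_iff)
  qed
  have int: "integrable N (\<lambda>x. h (U x))"
    if "finite_measure N" "U \<in> borel_measurable N" "AE x in N. U x \<in> {0..1}"
      and h: "continuous_on UNIV h"
    for N :: "'x measure" and U and h :: "real \<Rightarrow> real"
  proof -
    interpret finite_measure N by fact
    have [measurable]: "h \<in> borel_measurable borel" using h by (rule borel_measurable_continuous_onI)
    note that(2)[measurable]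
    obtain B where B: "\<And>x. x \<in> {0..1} \<Longrightarrow> \<bar>h x\<bar> \<le> B" using bounded[OF h] by blast
    show ?thesis
      by (rule integrable_const_bound[where B=B], use that(3) in eventually_elim) (use B in auto)
  qed
  have approx: "\<bar>(\<integral>x. g (U x) \<partial>N) - (\<integral>x. p (U x) \<partial>N)\<bar> \<le> d * measure N (space N)"
    if N: "finite_measure N" "U \<in> borel_measurable N" "AE x in N. U x \<in> {0..1}"
    for N :: "'x measure" and U
  proof -
    interpret finite_measure N by fact
    note ig = int[OF N g] and ip = int[OF N p_cont]
    have "\<bar>(\<integral>x. g (U x) \<partial>N) - (\<integral>x. p (U x) \<partial>N)\<bar> = \<bar>\<integral>x. g (U x) - p (U x) \<partial>N\<bar>"
      using ig ip by simp
    also have "\<dots> \<le> (\<integral>x. \<bar>g (U x) - p (U x)\<bar> \<partial>N)"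
      by (rule integral_abs_bound)
    also have "\<dots> \<le> (\<integral>x. d \<partial>N)"
    proof (rule integral_mono_AE)
      show "AE x in N. \<bar>g (U x) - p (U x)\<bar> \<le> d"
        using N(3) by eventually_elim (rule less_imp_le[OF p(2)])
    qed (use ig ip in auto)
    finally show ?thesis by (simp add: mult.commute)
  qed
  have pw: "integrable N (\<lambda>x. U x ^ k)"
    if "finite_measure N" "U \<in> borel_measurable N" "AE x in N. U x \<in> {0..1}"
    for N :: "'x measure" and U :: "_ \<Rightarrow> real" and k
    by (rule int[OF that]) (intro continuous_intros)
  have psum: "(\<integral>x. p (U x) \<partial>N) = (\<Sum>i\<le>n. a i * (\<integral>x. U x ^ i \<partial>N))"
    if N: "finite_measure N" "U \<in> borel_measurable N" "AE x in N. U x \<in> {0..1}"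
    for N :: "'x measure" and U
    unfolding pa using pw[OF N] by simp
  have "((\<lambda>t. \<integral>x. p (V t x) \<partial>\<mu> t) \<longlongrightarrow> (\<integral>x. p (V' x) \<partial>\<nu>)) F"
    unfolding psum[OF fin(1) meas(1) unit(1)] psum[OF fin(2) meas(2) unit(2)]
    by (intro tendsto_intros conv)
  then have ev1: "eventually (\<lambda>t. dist (\<integral>x. p (V t x) \<partial>\<mu> t) (\<integral>x. p (V' x) \<partial>\<nu>) < e / 3) F"
    by (rule tendstoD) (use e in simp)
  have "((\<lambda>t. measure (\<mu> t) (space (\<mu> t))) \<longlongrightarrow> measure \<nu> (space \<nu>)) F"
    using conv[of 0] by simp
  then have ev2: "eventually (\<lambda>t. measure (\<mu> t) (space (\<mu> t)) < K) F"
    by (rule order_tendstoD) (simp add: K_def)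
  show "eventually (\<lambda>t. dist (\<integral>x. g (V t x) \<partial>\<mu> t) (\<integral>x. g (V' x) \<partial>\<nu>) < e) F"
    using ev1 ev2
  proof eventually_elim
    case (elim t)
    have 1: "\<bar>(\<integral>x. g (V t x) \<partial>\<mu> t) - (\<integral>x. p (V t x) \<partial>\<mu> t)\<bar> \<le> d * measure (\<mu> t) (space (\<mu> t))"
      by (rule approx[OF fin(1) meas(1) unit(1)])
    have 2: "\<bar>(\<integral>x. g (V' x) \<partial>\<nu>) - (\<integral>x. p (V' x) \<partial>\<nu>)\<bar> \<le> d * measure \<nu> (space \<nu>)"
      by (rule approx[OF fin(2) meas(2) unit(2)])
    have dK: "d * K = e / 3" using K by (simp add: d_def)
    have "d * measure (\<mu> t) (space (\<mu> t)) \<le> e / 3" "d * measure \<nu> (space \<nu>) \<le> e / 3"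
      using elim(2) d unfolding dK[symmetric] by (auto simp: K_def intro!: mult_left_mono)
    with 1 2 elim(1) show ?case unfolding dist_real_def by linarith
  qed
qed

text \<open>The binomial series of exponent \<open>- (m + 1)\<close>; upper negation turns its
  generalized coefficients into ordinary ones. It governs both the Taylor remainders of tilted
  moments and the number of renewals before an exponential time.\<close>

lemma negative_binomial_sums:
  fixes q :: real
  assumes q: "\<bar>q\<bar> < 1"
  shows "(\<lambda>k. real ((k + m) choose m) * q ^ k) sums (1 / (1 - q) ^ Suc m)"
proof -
  have "((- real (Suc m)) gchoose k) * (- q) ^ k = real ((k + m) choose m) * q ^ k" for k
  proof -
    have "(- real (Suc m)) gchoose k = (- 1) ^ k * ((real (Suc m) + real k - 1) gchoose k)"
      by (rule gbinomial_minus)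
    also have "real (Suc m) + real k - 1 = real (m + k)"
      by simp
    also have "real (m + k) gchoose k = real ((m + k) choose k)"
      by (simp only: binomial_gbinomial)
    also have "(m + k) choose k = (k + m) choose m"
      using binomial_symmetric[of k "m + k"] by (simp add: add.commute)
    finally have "(- real (Suc m)) gchoose k = (- 1) ^ k * real ((k + m) choose m)" .
    moreover have "(- q) ^ k = (- 1) ^ k * q ^ k" by (rule power_minus)
    moreover have "(- 1) ^ k * (- 1) ^ k = (1 :: real)" by (simp flip: power_mult_distrib)
    ultimately show ?thesis by (metis (no_types) mult.assoc mult.left_commute mult_1)
  qed
  moreover have "(1 + - q) powr (- real (Suc m)) = 1 / (1 - q) ^ Suc m"
    using q by (simp add: powr_minus_divide powr_realpow del: of_nat_Suc power_Suc)
  ultimately show ?thesis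
    using gen_binomial_real[of "- q" "- real (Suc m)"] q by simp
qed

text \<open>Lagrange's remainder is evaluated at a negative point, where \<open>exp\<close> is at
  most \<open>1\<close>, so no exponential factor enters the error.\<close>

lemma exp_neg_Taylor:
  fixes x :: real
  assumes x: "0 \<le> x"
  shows "\<bar>exp (- x) - (\<Sum>k<n. (- x) ^ k / fact k)\<bar> \<le> x ^ n / fact n"
proof (cases n)
  case 0
  then show ?thesis using x by simp
next
  case (Suc m)
  show ?thesis
  proof (cases "x = 0")
    case True
    then show ?thesis by (simp add: Suc sum.lessThan_Suc_shift del: sum.lessThan_Suc)
  next
    case False
    then obtain t where t: "t < 0"
        "exp (- x) = (\<Sum>m<n. exp 0 / fact m * (- x) ^ m) + exp t / fact n * (- x) ^ n"
      using Maclaurin_minus[of "- x" n "\<lambda>_. exp" exp] x Suc by auto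
    have "\<bar>exp (- x) - (\<Sum>k<n. (- x) ^ k / fact k)\<bar> = exp t / fact n * x ^ n"
      using t(2) x by (simp add: abs_mult power_abs)
    also have "\<dots> \<le> 1 / fact n * x ^ n"
      using t(1) x by (intro mult_right_mono divide_right_mono) auto
    finally show ?thesis by simp
  qed
qed

text \<open>The weight \<open>u ^ m * exp (- (s * u))\<close> is common to all terms and at most
  \<open>u ^ m\<close>; the remainder is therefore controlled by an untilted power, uniformly in
  \<open>s\<close>.\<close>

lemma tilted_exp_Taylor:
  fixes u :: real
  assumes u: "0 \<le> u" and h: "0 \<le> h" and s: "0 \<le> s"
  shows "\<bar>u ^ m * exp (- ((s + h) * u)) - (\<Sum>k<n. (- h) ^ k / fact k * (u ^ (m + k) * exp (- (s * u))))\<bar>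
    \<le> h ^ n / fact n * u ^ (m + n)"
proof -
  have "exp (- ((s + h) * u)) = exp (- (s * u)) * exp (- (h * u))"
    by (subst exp_add[symmetric]) (simp add: algebra_simps)
  moreover have "(\<Sum>k<n. (- h) ^ k / fact k * (u ^ (m + k) * exp (- (s * u))))
      = u ^ m * exp (- (s * u)) * (\<Sum>k<n. (- (h * u)) ^ k / fact k)"
    unfolding sum_distrib_left
  proof (rule sum.cong[OF refl])
    fix k
    have "(- (h * u)) ^ k = (- h) ^ k * u ^ k"
      using power_mult_distrib[of "- h" u k] by simp
    then show "(- h) ^ k / fact k * (u ^ (m + k) * exp (- (s * u)))
      = u ^ m * exp (- (s * u)) * ((- (h * u)) ^ k / fact k)"
      by (simp add: power_add)
  qed
  ultimately have "u ^ m * exp (- ((s + h) * u)) - (\<Sum>k<n. (- h) ^ k / fact k * (u ^ (m + k) * exp (- (s * u))))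
      = (u ^ m * exp (- (s * u))) * (exp (- (h * u)) - (\<Sum>k<n. (- (h * u)) ^ k / fact k))"
    by (simp only: right_diff_distrib mult.assoc)
  also have "\<bar>\<dots>\<bar> = \<bar>u ^ m * exp (- (s * u))\<bar> * \<bar>exp (- (h * u)) - (\<Sum>k<n. (- (h * u)) ^ k / fact k)\<bar>"
    by (rule abs_mult)
  also have "\<dots> \<le> (u ^ m * 1) * ((h * u) ^ n / fact n)"
  proof (rule mult_mono)
    show "\<bar>exp (- (h * u)) - (\<Sum>k<n. (- (h * u)) ^ k / fact k)\<bar> \<le> (h * u) ^ n / fact n"
      by (rule exp_neg_Taylor) (use u h in simp)
    have "u ^ m * exp (- (s * u)) \<le> u ^ m * 1" using u s by (intro mult_left_mono) auto
    then show "\<bar>u ^ m * exp (- (s * u))\<bar> \<le> u ^ m * 1" using u by simp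
  qed (use u in auto)
  finally show ?thesis by (simp add: power_mult_distrib power_add mult_ac)
qed

lemma tilted_moment_Taylor:
  fixes U :: "'a \<Rightarrow> real"
  assumes [measurable]: "U \<in> borel_measurable N" and U: "AE x in N. 0 \<le> U x"
    and iU: "\<And>k. k \<le> m + n \<Longrightarrow> integrable N (\<lambda>x. U x ^ k)" and s: "0 \<le> s" and h: "0 \<le> h"
  shows "\<bar>(\<integral>x. U x ^ m * exp (- ((s + h) * U x)) \<partial>N)
      - (\<Sum>k<n. (- h) ^ k / fact k * (\<integral>x. U x ^ (m + k) * exp (- (s * U x)) \<partial>N))\<bar>
    \<le> h ^ n / fact n * (\<integral>x. U x ^ (m + n) \<partial>N)"
proof -
    have ie: "integrable N (\<lambda>x. U x ^ k * exp (- (r * U x)))" if "k \<le> m + n" "0 \<le> r" for k r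
      by (rule Bochner_Integration.integrable_bound[OF iU[OF that(1)]])
         (use U that(2) in \<open>auto elim!: eventually_mono simp: abs_mult intro!: mult_left_le\<close>)
    have isum: "integrable N (\<lambda>x. \<Sum>k<n. (- h) ^ k / fact k * (U x ^ (m + k) * exp (- (s * U x))))"
      by (intro Bochner_Integration.integrable_sum integrable_mult_right ie) (use s in auto)
    have i1: "integrable N (\<lambda>x. U x ^ m * exp (- ((s + h) * U x)))"
      by (intro ie) (use s h in auto)
    have sub: "(\<integral>x. U x ^ m * exp (- ((s + h) * U x))
              - (\<Sum>k<n. (- h) ^ k / fact k * (U x ^ (m + k) * exp (- (s * U x)))) \<partial>N)
        = (\<integral>x. U x ^ m * exp (- ((s + h) * U x)) \<partial>N) - (\<Sum>k<n. (- h) ^ k / fact k * (\<integral>x. U x ^ (m + k) * exp (- (s * U x)) \<partial>N))"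
      using isum i1 ie s
      by (subst Bochner_Integration.integral_diff) (auto simp: Bochner_Integration.integral_sum)
    have "\<bar>(\<integral>x. U x ^ m * exp (- ((s + h) * U x)) \<partial>N) - (\<Sum>k<n. (- h) ^ k / fact k * (\<integral>x. U x ^ (m + k) * exp (- (s * U x)) \<partial>N))\<bar> \<le> (\<integral>x. \<bar>U x ^ m * exp (- ((s + h) * U x))
              - (\<Sum>k<n. (- h) ^ k / fact k * (U x ^ (m + k) * exp (- (s * U x))))\<bar> \<partial>N)"
      unfolding sub[symmetric] by (rule integral_abs_bound)
    also have "\<dots> \<le> (\<integral>x. h ^ n / fact n * U x ^ (m + n) \<partial>N)"
    proof (rule integral_mono_AE)
      show "AE x in N. \<bar>U x ^ m * exp (- ((s + h) * U x))
              - (\<Sum>k<n. (- h) ^ k / fact k * (U x ^ (m + k) * exp (- (s * U x))))\<bar>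
            \<le> h ^ n / fact n * U x ^ (m + n)"
        using U
      proof eventually_elim
        case (elim x)
        then show ?case by (rule tilted_exp_Taylor[OF _ h s])
      qed
    qed (use i1 isum iU in auto)
    finally show ?thesis by simp
qed

text \<open>Taylor expansion bounds the error by the next moment, so that one step of length \<open>h < 1 / \<rho>\<close>
  is possible from every point at which all exponentially tilted moments converge; the steps add up
  to the whole arithmetic progression \<open>0, h, 2 h, \<dots>\<close>.\<close>

lemma tilted_moments_tendsto:
  fixes \<mu> :: "'t \<Rightarrow> 'b measure" and \<nu> :: "'c measure"
    and Y :: "'t \<Rightarrow> 'b \<Rightarrow> real" and Y' :: "'c \<Rightarrow> real"
  assumes meas [measurable]: "\<And>t. Y t \<in> borel_measurable (\<mu> t)" "Y' \<in> borel_measurable \<nu>"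
    and nonneg: "\<And>t. AE x in \<mu> t. 0 \<le> Y t x" "AE x in \<nu>. 0 \<le> Y' x"
    and int: "\<And>k. eventually (\<lambda>t. integrable (\<mu> t) (\<lambda>x. Y t x ^ k)) F" "\<And>k. integrable \<nu> (\<lambda>x. Y' x ^ k)"
    and conv: "\<And>k. ((\<lambda>t. \<integral>x. Y t x ^ k \<partial>\<mu> t) \<longlongrightarrow> (\<integral>x. Y' x ^ k \<partial>\<nu>)) F"
    and bound: "\<And>k. (\<integral>x. Y' x ^ k \<partial>\<nu>) \<le> C * \<rho> ^ k * fact k"
    and h: "0 \<le> h" "0 \<le> \<rho>" "h * \<rho> < 1"
  shows "((\<lambda>t. \<integral>x. Y t x ^ m * exp (- (real j * h * Y t x)) \<partial>\<mu> t) \<longlongrightarrow>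
            (\<integral>x. Y' x ^ m * exp (- (real j * h * Y' x)) \<partial>\<nu>)) F"
proof -
  define I where "I t m s = (\<integral>x. Y t x ^ m * exp (- (s * Y t x)) \<partial>\<mu> t)" for t m s
  define I' where "I' m s = (\<integral>x. Y' x ^ m * exp (- (s * Y' x)) \<partial>\<nu>)" for m s
  \<comment> \<open>Up to a constant this is the general term of the negative binomial series at
    \<open>h * \<rho> < 1\<close>: the factorial allowed in the moment bound is what the
    \<open>fact n\<close> of the Taylor remainder cancels.\<close>
  have rem0: "(\<lambda>n. h ^ n / fact n * (C * \<rho> ^ (m + n) * fact (m + n))) \<longlonglongrightarrow> 0" for m
  proof -
    have "summable (\<lambda>n. of_nat ((m + n) choose m) * (h * \<rho>) ^ n)"
      using negative_binomial_sums[of "h * \<rho>" m] h by (auto simp: sums_iff add.commute)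
    then have "(\<lambda>n. (C * \<rho> ^ m * fact m) * (of_nat ((m + n) choose m) * (h * \<rho>) ^ n)) \<longlonglongrightarrow> (C * \<rho> ^ m * fact m) * 0"
      by (intro tendsto_mult tendsto_const summable_LIMSEQ_zero)
    moreover have "h ^ n / fact n * (C * \<rho> ^ (m + n) * fact (m + n)) =
        (C * \<rho> ^ m * fact m) * (of_nat ((m + n) choose m) * (h * \<rho>) ^ n)" for n
    proof -
      have "real ((m + n) choose m) = fact (m + n) / (fact m * fact n)"
        by (simp add: binomial_fact)
      then show ?thesis by (simp add: power_add power_mult_distrib)
    qed
    ultimately show ?thesis by simp
  qed
  have "((\<lambda>t. I t m (real j * h)) \<longlongrightarrow> I' m (real j * h)) F"
  \<comment> \<open>\<open>m\<close> stays arbitrary, since one step expands the tilted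
    \<open>m\<close>-th moment into tilted moments of orders \<open>m + k\<close>.\<close>
  proof (induction j arbitrary: m)
    case 0
    then show ?case using conv[of m] by (simp add: I_def I'_def)
  next
    case (Suc j)
    define s where "s = real j * h"
    have s: "0 \<le> s" using h by (simp add: s_def)
    have s': "real (Suc j) * h = s + h" by (simp add: s_def algebra_simps)
    show ?case unfolding s'
    proof (rule tendstoI)
      fix e :: real assume e: "0 < e"
      obtain n where n: "h ^ n / fact n * (C * \<rho> ^ (m + n) * fact (m + n)) < e / 4"
        using order_tendstoD(2)[OF rem0, of "e / 4" m] e by (auto simp: eventually_sequentially)
      have n': "h ^ n / fact n * (\<integral>x. Y' x ^ (m + n) \<partial>\<nu>) < e / 4"
        by (rule le_less_trans[OF _ n]) (use h bound[of "m + n"] in \<open>auto intro!: mult_left_mono divide_right_mono\<close>)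
      have "((\<lambda>t. \<Sum>k<n. (- h) ^ k / fact k * I t (m + k) s) \<longlongrightarrow>
          (\<Sum>k<n. (- h) ^ k / fact k * I' (m + k) s)) F"
        unfolding s_def by (intro tendsto_intros Suc.IH)
      then have 1: "eventually (\<lambda>t. dist (\<Sum>k<n. (- h) ^ k / fact k * I t (m + k) s)
          (\<Sum>k<n. (- h) ^ k / fact k * I' (m + k) s) < e / 4) F"
        by (rule tendstoD) (use e in simp)
      have "((\<lambda>t. h ^ n / fact n * (\<integral>x. Y t x ^ (m + n) \<partial>\<mu> t)) \<longlongrightarrow>
          h ^ n / fact n * (\<integral>x. Y' x ^ (m + n) \<partial>\<nu>)) F"
        by (intro tendsto_intros conv)
      then have 2: "eventually (\<lambda>t. h ^ n / fact n * (\<integral>x. Y t x ^ (m + n) \<partial>\<mu> t) < e / 4) F"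
        by (rule order_tendstoD) (rule n')
      have 3: "eventually (\<lambda>t. \<forall>k\<in>{..m + n}. integrable (\<mu> t) (\<lambda>x. Y t x ^ k)) F"
        by (intro eventually_ball_finite ballI int) auto
      show "eventually (\<lambda>t. dist (I t m (s + h)) (I' m (s + h)) < e) F"
        using 1 2 3
      proof eventually_elim
        case (elim t)
        have a: "\<bar>I t m (s + h) - (\<Sum>k<n. (- h) ^ k / fact k * I t (m + k) s)\<bar>
            \<le> h ^ n / fact n * (\<integral>x. Y t x ^ (m + n) \<partial>\<mu> t)"
          unfolding I_def by (rule tilted_moment_Taylor[OF meas(1) nonneg(1)]) (use elim s h in auto)
        have b: "\<bar>I' m (s + h) - (\<Sum>k<n. (- h) ^ k / fact k * I' (m + k) s)\<bar>
            \<le> h ^ n / fact n * (\<integral>x. Y' x ^ (m + n) \<partial>\<nu>)"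
          unfolding I'_def by (rule tilted_moment_Taylor[OF meas(2) nonneg(2)]) (use int s h in auto)
        have tri: "\<bar>w - z\<bar> < e" if "\<bar>w - w'\<bar> \<le> r" "\<bar>z - z'\<bar> \<le> r'" "r < e / 4" "r' < e / 4" "\<bar>w' - z'\<bar> < e / 4"
          for w w' z z' r r' :: real using that e by linarith
        show ?case unfolding dist_real_def
          by (rule tri[OF a b elim(2) n' elim(1)[unfolded dist_real_def]])
      qed
    qed
  qed
  then show ?thesis unfolding I_def I'_def .
qed

text \<open>Under the change of variable \<open>y \<mapsto> exp (- (h * y))\<close> everything lives
  in the unit interval, and \<open>k\<close>-th powers are tilts by \<open>k * h\<close>, which are
  the parameters reached by the arithmetic progression above.\<close>

lemma continuous_integral_tendsto_of_moments:
  fixes \<mu> :: "'t \<Rightarrow> 'b measure" and \<nu> :: "'c measure"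
    and Y :: "'t \<Rightarrow> 'b \<Rightarrow> real" and Y' :: "'c \<Rightarrow> real"
    and g :: "real \<Rightarrow> real"
  assumes fin: "\<And>t. finite_measure (\<mu> t)" "finite_measure \<nu>"
    and meas [measurable]: "\<And>t. Y t \<in> borel_measurable (\<mu> t)" "Y' \<in> borel_measurable \<nu>"
    and nonneg: "\<And>t. AE x in \<mu> t. 0 \<le> Y t x" "AE x in \<nu>. 0 \<le> Y' x"
    and int: "\<And>k. eventually (\<lambda>t. integrable (\<mu> t) (\<lambda>x. Y t x ^ k)) F" "\<And>k. integrable \<nu> (\<lambda>x. Y' x ^ k)"
    and conv: "\<And>k. ((\<lambda>t. \<integral>x. Y t x ^ k \<partial>\<mu> t) \<longlongrightarrow> (\<integral>x. Y' x ^ k \<partial>\<nu>)) F"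
    and bound: "\<And>k. (\<integral>x. Y' x ^ k \<partial>\<nu>) \<le> C * \<rho> ^ k * fact k"
    and h: "0 \<le> h" "0 \<le> \<rho>" "h * \<rho> < 1"
    and g: "continuous_on UNIV g"
  shows "((\<lambda>t. \<integral>x. g (exp (- (h * Y t x))) \<partial>\<mu> t) \<longlongrightarrow> (\<integral>x. g (exp (- (h * Y' x))) \<partial>\<nu>)) F"
proof (rule continuous_integral_tendsto_of_power_integrals[where \<mu> = \<mu> and \<nu> = \<nu> and F = F and g = g
      and V = "\<lambda>t x. exp (- (h * Y t x))" and V' = "\<lambda>x. exp (- (h * Y' x))"])
  show "((\<lambda>t. \<integral>x. exp (- (h * Y t x)) ^ k \<partial>\<mu> t) \<longlongrightarrow> (\<integral>x. exp (- (h * Y' x)) ^ k \<partial>\<nu>)) F" for k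
    using tilted_moments_tendsto[OF meas nonneg int conv bound h, of 0 k]
    by (simp add: exp_of_nat_mult[symmetric] mult_ac)
  show "AE x in \<mu> t. exp (- (h * Y t x)) \<in> {0..1}" for t
    using nonneg(1) by eventually_elim (use h in simp)
  show "AE x in \<nu>. exp (- (h * Y' x)) \<in> {0..1}"
    using nonneg(2) by eventually_elim (use h in simp)
qed (use fin g in auto)

section \<open>Monotone functions integrated against an exponential law\<close>

abbreviation exp_law :: "real measure" where
  "exp_law \<equiv> density lborel (exponential_density 1)"

interpretation exp_law: prob_space exp_law
  by (rule prob_space_exponential_density) simp

lemma AE_exp_law_nonneg: "AE u in exp_law. 0 \<le> u"
  by (subst AE_density) (auto simp: exponential_density_def)

lemma AE_exp_law_pos: "AE u in exp_law. 0 < u"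
  by (subst AE_density) (use AE_lborel_singleton[of "0::real"] in \<open>auto simp: exponential_density_def elim!: eventually_mono\<close>)

lemma exp_law_interval_pos:
  assumes "0 \<le> a" "a < b"
  shows "0 < measure exp_law {a<..<b}"
proof -
  have "ennreal (exp (- b) * (b - a)) = (\<integral>\<^sup>+u. ennreal (exp (- b)) * indicator {a<..<b} u \<partial>lborel)"
    using assms by (simp add: nn_integral_cmult_indicator ennreal_mult)
  also have "\<dots> \<le> (\<integral>\<^sup>+u. ennreal (exponential_density 1 u) * indicator {a<..<b} u \<partial>lborel)"
    using assms by (intro nn_integral_mono) (auto simp: exponential_density_def split: split_indicator intro!: ennreal_leI)
  also have "\<dots> = emeasure exp_law {a<..<b}"
    by (subst emeasure_density) auto
  finally have "ennreal (exp (- b) * (b - a)) \<le> ennreal (measure exp_law {a<..<b})"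
    by (simp add: exp_law.emeasure_eq_measure)
  then have "exp (- b) * (b - a) \<le> measure exp_law {a<..<b}"
    by (simp add: ennreal_le_iff)
  moreover have "0 < exp (- b) * (b - a)" using assms by simp
  ultimately show ?thesis by simp
qed

text \<open>The tent over the interval from \<open>a\<close> to \<open>b\<close> is written in the
  variable \<open>exp (- u)\<close>, so that polynomials in \<open>exp (- u)\<close>, hence Laplace
  transforms, approximate it. Its positive integral serves as a divisor below.\<close>

lemma tent_integral_pos:
  assumes "0 \<le> a" "a < b"
  shows "integrable exp_law (\<lambda>u. max 0 (min (exp (- u) - exp (- b)) (exp (- a) - exp (- u))))"
    and "0 < (\<integral>u. max 0 (min (exp (- u) - exp (- b)) (exp (- a) - exp (- u))) \<partial>exp_law)"
proof -
  let ?T = "\<lambda>u::real. max 0 (min (exp (- u) - exp (- b)) (exp (- a) - exp (- u)))"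
  show i: "integrable exp_law ?T"
  proof (rule exp_law.integrable_const_bound[where B="exp (- a)"])
    have "norm (?T u) \<le> exp (- a)" for u
      using exp_gt_zero[of "- u"] exp_gt_zero[of "- a"] by (auto simp: max_def min_def simp del: exp_gt_zero)
    then show "AE u in exp_law. norm (?T u) \<le> exp (- a)" by simp
  qed simp
  have "(\<integral>u. ?T u \<partial>exp_law) \<noteq> 0"
  proof
    assume "(\<integral>u. ?T u \<partial>exp_law) = 0"
    then have "AE u in exp_law. ?T u = 0"
      using i by (subst (asm) integral_nonneg_eq_0_iff_AE) auto
    then have "AE u in exp_law. u \<notin> {a<..<b}"
    proof eventually_elim
      case (elim u)
      show ?case
      proof
        assume "u \<in> {a<..<b}"
        then have "exp (- b) < exp (- u)" "exp (- u) < exp (- a)" by auto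
        then show False using elim by linarith
      qed
    qed
    then have "measure exp_law {a<..<b} = 0"
      by (subst (asm) AE_iff_measurable[where N="{a<..<b}"]) (auto simp: exp_law.emeasure_eq_measure)
    then show False using exp_law_interval_pos[OF assms] by simp
  qed
  moreover have "0 \<le> (\<integral>u. ?T u \<partial>exp_law)" by (intro integral_nonneg_AE) auto
  ultimately show "0 < (\<integral>u. ?T u \<partial>exp_law)" by linarith
qed

text \<open>Each \<open>m t\<close> is read as a density, so that the transforms become power
  integrals of \<open>exp (- u)\<close>. A tent to the right of \<open>u0\<close> averages values
  that are at least \<open>m t u0\<close>, a tent to the left values that are at most
  \<open>m t u0\<close>; continuity of the limit at \<open>u0\<close> closes the gap.\<close>

lemma mono_tendsto_of_Laplace_transforms:
  fixes m :: "'t \<Rightarrow> real \<Rightarrow> real"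
  assumes int: "\<And>t. integrable exp_law (m t)" "integrable exp_law m'"
    and mono: "\<And>t. mono_on {0..} (m t)" "mono_on {0..} m'"
    and nonneg: "\<And>t u. 0 \<le> u \<Longrightarrow> 0 \<le> m t u" "\<And>u. 0 \<le> u \<Longrightarrow> 0 \<le> m' u"
    and conv: "\<And>k::nat. ((\<lambda>t. \<integral>u. exp (- (real k * u)) * m t u \<partial>exp_law) \<longlongrightarrow>
        (\<integral>u. exp (- (real k * u)) * m' u \<partial>exp_law)) F"
    and u0: "0 < u0" "isCont m' u0"
  shows "((\<lambda>t. m t u0) \<longlongrightarrow> m' u0) F"
proof -
  define T where "T a b = (\<lambda>u::real. max 0 (min (exp (- u) - exp (- b)) (exp (- a) - exp (- u))))" for a b :: real
  define c where "c a b = (\<integral>u. T a b u \<partial>exp_law)" for a b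
  have T0: "0 \<le> T a b u" for a b u by (simp add: T_def)
  have Tz: "T a b u = 0" if "u \<notin> {a<..<b}" for a b u
  proof -
    have "exp (- u) \<le> exp (- b) \<or> exp (- a) \<le> exp (- u)" using that by auto
    then show ?thesis unfolding T_def by linarith
  qed
  have [measurable]: "T a b \<in> borel_measurable borel" for a b by (simp add: T_def)
  have [measurable]: "m t \<in> borel_measurable borel" "m' \<in> borel_measurable borel" for t
    using int[THEN borel_measurable_integrable] by auto
  have Tint: "integrable exp_law (\<lambda>u. T a b u * f u)" if "integrable exp_law f" "0 \<le> a" "a < b" for a b f
  proof (rule Bochner_Integration.integrable_bound[OF that(1)])
    show "(\<lambda>u. T a b u * f u) \<in> borel_measurable exp_law"
      using borel_measurable_integrable[OF that(1)] by simp
    show "AE u in exp_law. norm (T a b u * f u) \<le> norm (f u)"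
      using AE_exp_law_nonneg
    proof eventually_elim
      case (elim u)
      have "exp (- a) - exp (- u) \<le> 1" using that(2) by (smt (verit) exp_ge_zero exp_le_one_iff)
      then have "T a b u \<le> 1" by (auto simp: T_def)
      then show ?case using T0[of a b u] by (simp add: abs_mult mult_left_le_one_le)
    qed
  qed
  have up: "(\<integral>u. T a b u * f u \<partial>exp_law) \<le> c a b * f b"
    and lo: "c a b * f a \<le> (\<integral>u. T a b u * f u \<partial>exp_law)"
    if f: "integrable exp_law f" "mono_on {0..} f" and ab: "0 \<le> a" "a < b" for a b f
  proof -
    note i1 = tent_integral_pos(1)[OF ab, folded T_def]
    note i2 = Tint[OF f(1) ab]
    have "(\<integral>u. T a b u * f u \<partial>exp_law) \<le> (\<integral>u. T a b u * f b \<partial>exp_law)"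
    proof (rule integral_mono)
      show "T a b u * f u \<le> T a b u * f b" for u
        using Tz[of u a b] T0[of a b u] mono_onD[OF f(2), of u b] ab
        by (cases "u \<in> {a<..<b}") (auto intro!: mult_left_mono)
    qed (use i1 i2 in auto)
    then show "(\<integral>u. T a b u * f u \<partial>exp_law) \<le> c a b * f b" using i1 by (simp add: c_def)
    have "(\<integral>u. T a b u * f a \<partial>exp_law) \<le> (\<integral>u. T a b u * f u \<partial>exp_law)"
    proof (rule integral_mono)
      show "T a b u * f a \<le> T a b u * f u" for u
        using Tz[of u a b] T0[of a b u] mono_onD[OF f(2), of a u] ab
        by (cases "u \<in> {a<..<b}") (auto intro!: mult_left_mono)
    qed (use i1 i2 in auto)
    then show "c a b * f a \<le> (\<integral>u. T a b u * f u \<partial>exp_law)" using i1 by (simp add: c_def)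
  qed
  have dens: "(\<integral>u. h u * f u \<partial>exp_law) = (\<integral>u. h u \<partial>density exp_law (\<lambda>u. ennreal (f u)))"
    if [measurable]: "f \<in> borel_measurable borel" "h \<in> borel_measurable borel" and f: "\<And>u. 0 \<le> u \<Longrightarrow> 0 \<le> f u"
    for f h :: "real \<Rightarrow> real"
  proof -
    have "AE u in exp_law. 0 \<le> f u" using AE_exp_law_nonneg by eventually_elim (rule f)
    then show ?thesis
      by (subst integral_density[of h exp_law f]) (simp_all add: mult.commute)
  qed
  have fin: "finite_measure (density exp_law (\<lambda>u. ennreal (f u)))"
    if "integrable exp_law f" "\<And>u. 0 \<le> u \<Longrightarrow> 0 \<le> f u" for f :: "real \<Rightarrow> real"
  proof
    have [measurable]: "f \<in> borel_measurable borel" using borel_measurable_integrable[OF that(1)] by simp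
    have "emeasure (density exp_law (\<lambda>u. ennreal (f u))) UNIV = (\<integral>\<^sup>+u. ennreal (f u) \<partial>exp_law)"
      by (subst emeasure_density[of _ exp_law]) simp_all
    also have "\<dots> = ennreal (\<integral>u. f u \<partial>exp_law)"
    proof (rule nn_integral_eq_integral[OF that(1)])
      show "AE u in exp_law. 0 \<le> f u" using AE_exp_law_nonneg by eventually_elim (rule that(2))
    qed
    finally show "emeasure (density exp_law (\<lambda>u. ennreal (f u))) (space (density exp_law (\<lambda>u. ennreal (f u)))) \<noteq> \<infinity>"
      by simp
  qed
  have AE01: "AE u in density exp_law (\<lambda>u. ennreal (f u)). exp (- u) \<in> {0..1}"
    if "f \<in> borel_measurable borel" for f :: "real \<Rightarrow> real"
  proof (subst AE_density)
    show "AE u in exp_law. 0 < ennreal (f u) \<longrightarrow> exp (- u) \<in> {0..1}"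
      using AE_exp_law_nonneg by eventually_elim simp
  qed (use that in simp)
  have Tconv: "((\<lambda>t. \<integral>u. T a b u * m t u \<partial>exp_law) \<longlongrightarrow> (\<integral>u. T a b u * m' u \<partial>exp_law)) F" for a b
  proof -
    define g :: "real \<Rightarrow> real" where "g = (\<lambda>v. max 0 (min (v - exp (- b)) (exp (- a) - v)))"
    have T: "T a b = (\<lambda>u. g (exp (- u)))" by (simp add: T_def g_def)
    have [measurable]: "g \<in> borel_measurable borel" by (simp add: g_def)
    show ?thesis
      unfolding T
      apply (subst dens[of "m _"], simp, simp, rule nonneg, assumption)
      apply (subst dens[of "m'"], simp, simp, rule nonneg, assumption)
      apply (rule continuous_integral_tendsto_of_power_integrals[where V = "\<lambda>t u. exp (- u)" and V' = "\<lambda>u. exp (- u)" and g = g])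
      subgoal using int nonneg by (intro fin) auto
      subgoal using int nonneg by (intro fin) auto
      subgoal by simp
      subgoal by simp
      subgoal by (rule AE01) simp
      subgoal by (rule AE01) simp
      subgoal for k
      proof -
        have "(\<integral>u. exp (- (real k * u)) * m t u \<partial>exp_law)
            = (\<integral>u. exp (- (real k * u)) \<partial>density exp_law (\<lambda>u. ennreal (m t u)))" for t
          by (rule dens) (use nonneg in auto)
        moreover have "(\<integral>u. exp (- (real k * u)) * m' u \<partial>exp_law)
            = (\<integral>u. exp (- (real k * u)) \<partial>density exp_law (\<lambda>u. ennreal (m' u)))"
          by (rule dens) (use nonneg in auto)
        ultimately show ?thesis using conv[of k] by (simp flip: exp_of_nat_mult)
      qed
      subgoal unfolding g_def by (intro continuous_intros)
      done
  qed
  show ?thesis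
  proof (rule order_tendstoI)
    fix y assume y: "m' u0 < y"
    have "eventually (\<lambda>u. m' u < y) (at_right u0)"
      using u0(2) y by (intro order_tendstoD(2)[where y = "m' u0"]) (auto simp: isCont_def filterlim_at_split)
    then obtain b where b: "u0 < b" "m' b < y"
      by (metis eventually_at_right_field dense)
    have c: "0 < c u0 b" using tent_integral_pos(2)[of u0 b] u0 b by (simp add: c_def T_def)
    have "(\<integral>u. T u0 b u * m' u \<partial>exp_law) \<le> c u0 b * m' b"
      by (rule up) (use int mono u0 b in auto)
    also have "\<dots> < c u0 b * y" using c b by simp
    finally have "eventually (\<lambda>t. (\<integral>u. T u0 b u * m t u \<partial>exp_law) < c u0 b * y) F"
      by (rule order_tendstoD(2)[OF Tconv])
    then show "eventually (\<lambda>t. m t u0 < y) F"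
    proof eventually_elim
      case (elim t)
      have "c u0 b * m t u0 \<le> (\<integral>u. T u0 b u * m t u \<partial>exp_law)"
        by (rule lo) (use int mono u0 b in auto)
      with elim have "c u0 b * m t u0 < c u0 b * y" by simp
      with c show ?case by simp
    qed
  next
    fix y assume y: "y < m' u0"
    have "eventually (\<lambda>u. y < m' u) (at_left u0)"
      using u0(2) y by (intro order_tendstoD(1)[where y = "m' u0"]) (auto simp: isCont_def filterlim_at_split)
    then obtain a' where a': "a' < u0" "\<And>u. a' < u \<Longrightarrow> u < u0 \<Longrightarrow> y < m' u"
      by (auto simp: eventually_at_left_field)
    obtain a where "max a' 0 < a" "a < u0" using dense[of "max a' 0" u0] a' u0 by auto
    with a' have a: "0 \<le> a" "a < u0" "y < m' a" by auto
    have c: "0 < c a u0" using tent_integral_pos(2)[of a u0] a by (simp add: c_def T_def)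
    have "c a u0 * y < c a u0 * m' a" using c a by simp
    also have "\<dots> \<le> (\<integral>u. T a u0 u * m' u \<partial>exp_law)"
      by (rule lo) (use int mono a in auto)
    finally have "eventually (\<lambda>t. c a u0 * y < (\<integral>u. T a u0 u * m t u \<partial>exp_law)) F"
      by (rule order_tendstoD(1)[OF Tconv])
    then show "eventually (\<lambda>t. y < m t u0) F"
    proof eventually_elim
      case (elim t)
      have "(\<integral>u. T a u0 u * m t u \<partial>exp_law) \<le> c a u0 * m t u0"
        by (rule up) (use int mono a in auto)
      with elim have "c a u0 * y < c a u0 * m t u0" by simp
      with c show ?case by simp
    qed
  qed
qed

text \<open>A continuous substitute for the indicator of a half-line, written through
  \<open>exp (- (h * y))\<close> because convergence of moments yields limits for continuous
  functions of that quantity. The exponential reverses the order, hence \<open>1 - cts_step\<close>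
  with \<open>b\<close> before \<open>a\<close>.\<close>

definition soft_step :: "real \<Rightarrow> real \<Rightarrow> real \<Rightarrow> real \<Rightarrow> real" where
  "soft_step h a b y = 1 - cts_step (exp (- (h * b))) (exp (- (h * a))) (exp (- (h * y)))"

context
  fixes h a b :: real
  assumes h: "0 < h" and ab: "a < b"
begin

lemma soft_step_exp_less: "exp (- (h * b)) < exp (- (h * a))"
  using h ab by simp

lemma soft_step_eq_1: "y \<le> a \<Longrightarrow> soft_step h a b y = 1"
  using h ab soft_step_exp_less by (auto simp: soft_step_def cts_step_def mult_le_cancel_left)

lemma soft_step_eq_0: "b \<le> y \<Longrightarrow> soft_step h a b y = 0"
  using h ab soft_step_exp_less by (auto simp: soft_step_def cts_step_def mult_le_cancel_left)

lemma soft_step_bounds: "0 \<le> soft_step h a b y" "soft_step h a b y \<le> 1"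
  using soft_step_exp_less by (auto simp: soft_step_def cts_step_def divide_simps)

lemma continuous_on_cts_step: "continuous_on UNIV (cts_step (exp (- (h * b))) (exp (- (h * a))))"
  by (intro uniformly_continuous_imp_continuous cts_step_uniformly_continuous soft_step_exp_less)

lemma borel_measurable_soft_step [measurable]: "soft_step h a b \<in> borel_measurable borel"
  unfolding soft_step_def using borel_measurable_continuous_onI[OF continuous_on_cts_step] by measurable

lemma soft_step_integral_tendsto_of_moments:
  fixes Y :: "'t \<Rightarrow> 'b \<Rightarrow> real" and Y' :: "'c \<Rightarrow> real"
  assumes "\<And>t. finite_measure (\<mu> t)" "finite_measure \<nu>"
    and "\<And>t. Y t \<in> borel_measurable (\<mu> t)" "Y' \<in> borel_measurable \<nu>"
    and "\<And>t. AE x in \<mu> t. 0 \<le> Y t x" "AE x in \<nu>. 0 \<le> Y' x"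
    and "\<And>k. eventually (\<lambda>t. integrable (\<mu> t) (\<lambda>x. Y t x ^ k)) F" "\<And>k. integrable \<nu> (\<lambda>x. Y' x ^ k)"
    and "\<And>k. ((\<lambda>t. \<integral>x. Y t x ^ k \<partial>\<mu> t) \<longlongrightarrow> (\<integral>x. Y' x ^ k \<partial>\<nu>)) F"
    and "\<And>k. (\<integral>x. Y' x ^ k \<partial>\<nu>) \<le> C * \<rho> ^ k * fact k" "0 \<le> \<rho>" "h * \<rho> < 1"
  shows "((\<lambda>t. \<integral>x. soft_step h a b (Y t x) \<partial>\<mu> t) \<longlongrightarrow> (\<integral>x. soft_step h a b (Y' x) \<partial>\<nu>)) F"
  unfolding soft_step_def
  by (rule continuous_integral_tendsto_of_moments[where h = h and C = C and \<rho> = \<rho>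
        and g = "\<lambda>v. 1 - cts_step (exp (- (h * b))) (exp (- (h * a))) v"])
     (use assms h in \<open>auto intro!: continuous_intros continuous_on_cts_step\<close>)

end

text \<open>A nondecreasing function is recovered from its law under \<open>exp_law\<close>: its
  value at \<open>u0\<close> is compared with a level through the mass of the half-line of arguments
  mapped below that level. Soft steps measure this mass, and their integrals converge because the
  moments do.\<close>

lemma mono_tendsto_of_moments:
  fixes f :: "'t \<Rightarrow> real \<Rightarrow> real"
  assumes meas [measurable]: "\<And>t. f t \<in> borel_measurable borel" "f' \<in> borel_measurable borel"
    and mono: "\<And>t. mono_on {0<..} (f t)" "mono_on {0<..} f'"
    and nonneg: "\<And>t u. 0 < u \<Longrightarrow> 0 \<le> f t u" "\<And>u. 0 < u \<Longrightarrow> 0 \<le> f' u"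
    and int: "\<And>k. eventually (\<lambda>t. integrable exp_law (\<lambda>u. f t u ^ k)) F" "\<And>k. integrable exp_law (\<lambda>u. f' u ^ k)"
    and conv: "\<And>k. ((\<lambda>t. \<integral>u. f t u ^ k \<partial>exp_law) \<longlongrightarrow> (\<integral>u. f' u ^ k \<partial>exp_law)) F"
    and bound: "\<And>k. (\<integral>u. f' u ^ k \<partial>exp_law) \<le> C * \<rho> ^ k * fact k" and "0 \<le> \<rho>"
    and u0: "0 < u0" "isCont f' u0"
  shows "((\<lambda>t. f t u0) \<longlongrightarrow> f' u0) F"
proof -
  define h where "h = 1 / (\<rho> + 1)"
  have h: "0 < h" "h * \<rho> < 1" using \<open>0 \<le> \<rho>\<close> by (auto simp: h_def)
  define G where "G = soft_step h"
  note G1 = soft_step_eq_1[OF h(1), folded G_def]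
    and G0 = soft_step_eq_0[OF h(1), folded G_def]
    and G01 = soft_step_bounds[OF h(1), folded G_def]
    and [measurable] = borel_measurable_soft_step[OF h(1), folded G_def]
  have Gint: "integrable exp_law (\<lambda>u. G a b (r u))" if [measurable]: "r \<in> borel_measurable borel" and "a < b" for a b r
    by (rule exp_law.integrable_const_bound[where B=1]) (use G01 that(2) in auto)
  have Gconv: "((\<lambda>t. \<integral>u. G a b (f t u) \<partial>exp_law) \<longlongrightarrow> (\<integral>u. G a b (f' u) \<partial>exp_law)) F" if "a < b" for a b
    unfolding G_def
  proof (rule soft_step_integral_tendsto_of_moments[OF h(1) that, where C = C and \<rho> = \<rho>])
    show "AE x in exp_law. 0 \<le> f t x" for t using AE_exp_law_pos by eventually_elim (rule nonneg)
    show "AE x in exp_law. 0 \<le> f' x" using AE_exp_law_pos by eventually_elim (rule nonneg)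
  qed (use int conv bound h \<open>0 \<le> \<rho>\<close> exp_law.finite_measure_axioms in auto)
  have upper: "(\<integral>u. G a b (r u) \<partial>exp_law) \<le> measure exp_law {..v}"
    if [measurable]: "r \<in> borel_measurable borel" and "a < b" "\<And>u. v < u \<Longrightarrow> 0 < u \<Longrightarrow> b \<le> r u" for r a b v
  proof -
    have "(\<integral>u. G a b (r u) \<partial>exp_law) \<le> (\<integral>u. indicator {..v} u \<partial>exp_law)"
    proof (rule integral_mono_AE)
      show "AE u in exp_law. G a b (r u) \<le> indicator {..v} u"
        using AE_exp_law_pos
      proof eventually_elim
        case (elim u)
        then show ?case
          using G01[OF that(2), of "r u"] G0[OF that(2), of "r u"] that(3)[of u] by (cases "u \<le> v") auto
      qed
    qed (use Gint[OF that(1,2)] in \<open>auto intro!: integrable_real_indicator simp: exp_law.emeasure_eq_measure\<close>)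
    then show ?thesis by simp
  qed
  have lower: "measure exp_law {..v} \<le> (\<integral>u. G a b (r u) \<partial>exp_law)"
    if [measurable]: "r \<in> borel_measurable borel" and "a < b" "\<And>u. u \<le> v \<Longrightarrow> 0 < u \<Longrightarrow> r u \<le> a" for r a b v
  proof -
    have "(\<integral>u. indicator {..v} u \<partial>exp_law) \<le> (\<integral>u. G a b (r u) \<partial>exp_law)"
    proof (rule integral_mono_AE)
      show "AE u in exp_law. indicator {..v} u \<le> G a b (r u)"
        using AE_exp_law_pos
      proof eventually_elim
        case (elim u)
        then show ?case
          using G01[OF that(2), of "r u"] G1[OF that(2), of "r u"] that(3)[of u] by (cases "u \<le> v") auto
      qed
    qed (use Gint[OF that(1,2)] in \<open>auto intro!: integrable_real_indicator simp: exp_law.emeasure_eq_measure\<close>)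
    then show ?thesis by simp
  qed
  \<comment> \<open>The exponential law charges every interval, so moving the argument past
    \<open>u0\<close> changes the mass strictly; this is the slack that survives the limit.\<close>
  have strict: "measure exp_law {..v} < measure exp_law {..w}" if "0 \<le> v" "v < w" for v w
  proof -
    have "measure exp_law {..v} + measure exp_law {v<..<w} = measure exp_law ({..v} \<union> {v<..<w})"
      by (subst exp_law.finite_measure_Union) auto
    also have "\<dots> \<le> measure exp_law {..w}"
      using that by (intro exp_law.finite_measure_mono) auto
    finally show ?thesis using exp_law_interval_pos[OF that] by simp
  qed
  show ?thesis
  proof (rule order_tendstoI)
    fix y assume y: "f' u0 < y"
    then obtain z where z: "f' u0 < z" "z < y" using dense by blast
    have "eventually (\<lambda>u. f' u < z) (at_right u0)"
      using u0(2) z by (intro order_tendstoD(2)[where y = "f' u0"]) (auto simp: isCont_def filterlim_at_split)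
    then obtain w where w: "u0 < w" "f' w < z"
      by (metis eventually_at_right_field dense)
    have "measure exp_law {..u0} < measure exp_law {..w}" by (rule strict) (use u0 w in auto)
    also have "\<dots> \<le> (\<integral>u. G z y (f' u) \<partial>exp_law)"
    proof (rule lower[OF _ z(2)])
      show "f' u \<le> z" if "u \<le> w" "0 < u" for u
        using mono_onD[OF mono(2), of u w] that w by simp
    qed simp
    finally have "eventually (\<lambda>t. measure exp_law {..u0} < (\<integral>u. G z y (f t u) \<partial>exp_law)) F"
      by (rule order_tendstoD(1)[OF Gconv[OF z(2)]])
    then show "eventually (\<lambda>t. f t u0 < y) F"
    proof eventually_elim
      case (elim t)
      show ?case
      proof (rule ccontr)
        assume "\<not> f t u0 < y"
        then have "(\<integral>u. G z y (f t u) \<partial>exp_law) \<le> measure exp_law {..u0}"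
        proof (intro upper[OF _ z(2)])
          show "y \<le> f t u" if "u0 < u" "0 < u" for u
            using mono_onD[OF mono(1), of u0 u t] that u0 \<open>\<not> f t u0 < y\<close> by simp
        qed simp
        then show False using elim by simp
      qed
    qed
  next
    fix y assume y: "y < f' u0"
    then obtain z where z: "y < z" "z < f' u0" using dense by blast
    have "eventually (\<lambda>u. z < f' u) (at_left u0)"
      using u0(2) z by (intro order_tendstoD(1)[where y = "f' u0"]) (auto simp: isCont_def filterlim_at_split)
    then obtain w' where w': "w' < u0" "\<And>u. w' < u \<Longrightarrow> u < u0 \<Longrightarrow> z < f' u"
      by (auto simp: eventually_at_left_field)
    obtain w where "max w' 0 < w" "w < u0" using dense[of "max w' 0" u0] w' u0 by auto
    with w' have w: "0 < w" "w < u0" "z < f' w" by auto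
    have "(\<integral>u. G y z (f' u) \<partial>exp_law) \<le> measure exp_law {..w}"
    proof (rule upper[OF _ z(1)])
      show "z \<le> f' u" if "w < u" "0 < u" for u
        using mono_onD[OF mono(2), of w u] that w by simp
    qed simp
    also have "\<dots> < measure exp_law {..u0}" by (rule strict) (use w in auto)
    finally have "eventually (\<lambda>t. (\<integral>u. G y z (f t u) \<partial>exp_law) < measure exp_law {..u0}) F"
      by (rule order_tendstoD(2)[OF Gconv[OF z(1)]])
    then show "eventually (\<lambda>t. y < f t u0) F"
    proof eventually_elim
      case (elim t)
      show ?case
      proof (rule ccontr)
        assume "\<not> y < f t u0"
        then have "measure exp_law {..u0} \<le> (\<integral>u. G y z (f t u) \<partial>exp_law)"
        proof (intro lower[OF _ z(1)])
          show "f t u \<le> y" if "u \<le> u0" "0 < u" for u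
            using mono_onD[OF mono(1), of u u0 t] that u0 \<open>\<not> y < f t u0\<close> by simp
        qed simp
        then show False using elim by simp
      qed
    qed
  qed
qed

section \<open>Moments and convergence in distribution\<close>

lemma moments_tendsto_of_weak_conv:
  fixes \<mu> :: "nat \<Rightarrow> real measure"
  assumes \<mu>: "\<And>k. real_distribution (\<mu> k)" and \<nu>: "real_distribution \<nu>"
    and conv: "weak_conv_m \<mu> \<nu>"
    and nonneg: "\<And>k. AE x in \<mu> k. 0 \<le> x"
    and int: "\<And>k n. integrable (\<mu> k) (\<lambda>x. x ^ n)"
    and bound: "\<And>n. \<exists>B. eventually (\<lambda>k. (\<integral>x. x ^ n \<partial>\<mu> k) \<le> B) sequentially"
  shows "AE x in \<nu>. 0 \<le> x" and "integrable \<nu> (\<lambda>x. x ^ n)"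
    and "(\<lambda>k. \<integral>x. x ^ n \<partial>\<mu> k) \<longlonglongrightarrow> (\<integral>x. x ^ n \<partial>\<nu>)"
proof -
  interpret \<mu>: real_distribution "\<mu> k" for k by (rule \<mu>)
  interpret \<nu>: real_distribution \<nu> by (rule \<nu>)
  have cconv: "(\<lambda>k. \<integral>x. f x \<partial>\<mu> k) \<longlonglongrightarrow> (\<integral>x. f x \<partial>\<nu>)"
    if "continuous_on UNIV f" "\<And>x. \<bar>f x\<bar> \<le> B" for f :: "real \<Rightarrow> real" and B
    by (rule weak_conv_imp_integral_bdd_continuous_conv[OF \<mu> \<nu> conv])
       (use that in \<open>auto simp: continuous_on_eq_continuous_at\<close>)
  show \<nu>nn: "AE x in \<nu>. 0 \<le> x"
  proof -
    \<comment> \<open>Bounded, continuous and positive exactly on the negative half-line: its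
      integrals vanish along the sequence, hence also in the limit.\<close>
    define f :: "real \<Rightarrow> real" where "f = (\<lambda>x. min 1 (max 0 (- x)))"
    have [measurable]: "f \<in> borel_measurable borel" unfolding f_def by measurable
    have "(\<integral>x. f x \<partial>\<mu> k) = 0" for k
    proof -
      have "(\<integral>x. f x \<partial>\<mu> k) = (\<integral>x. 0 \<partial>\<mu> k)"
      proof (rule integral_cong_AE)
        show "AE x in \<mu> k. f x = 0" using nonneg[of k] by eventually_elim (simp add: f_def)
      qed auto
      then show ?thesis by simp
    qed
    moreover have "(\<lambda>k. \<integral>x. f x \<partial>\<mu> k) \<longlonglongrightarrow> (\<integral>x. f x \<partial>\<nu>)"
      unfolding f_def by (rule cconv[of _ 1]) (auto intro!: continuous_intros)
    ultimately have "(\<integral>x. f x \<partial>\<nu>) = 0" by (simp add: LIMSEQ_const_iff)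
    moreover have "integrable \<nu> f"
      by (rule \<nu>.integrable_const_bound[where B=1]) (auto simp: f_def)
    moreover have "AE x in \<nu>. 0 \<le> f x" by (simp add: f_def)
    ultimately have "AE x in \<nu>. f x = 0"
      by (subst (asm) integral_nonneg_eq_0_iff_AE) auto
    then show ?thesis by eventually_elim (auto simp: f_def min_def max_def split: if_splits)
  qed
  define g :: "nat \<Rightarrow> real \<Rightarrow> real \<Rightarrow> real" where "g n K = (\<lambda>x. min (max 0 x) K ^ n)" for n K
  have g_meas [measurable]: "g n K \<in> borel_measurable borel" for n K unfolding g_def by measurable
  have g_bd: "\<bar>g n K x\<bar> \<le> K ^ n" if "0 \<le> K" for n K x
    using that by (auto simp: g_def power_abs intro!: power_mono)
  have g_cont: "continuous_on UNIV (g n K)" for n K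
    unfolding g_def by (intro continuous_intros)
  have gconv: "(\<lambda>k. \<integral>x. g n K x \<partial>\<mu> k) \<longlonglongrightarrow> (\<integral>x. g n K x \<partial>\<nu>)" if "0 \<le> K" for n K
    by (rule cconv[OF g_cont]) (rule g_bd[OF that])
  have g_le: "g n K x \<le> x ^ n" if "0 \<le> x" "0 \<le> K" for n K x
    using that by (auto simp: g_def intro!: power_mono)
  \<comment> \<open>The truncation acts only where \<open>K < x\<close>, and there
    \<open>x ^ n\<close> is at most \<open>x ^ n * (x / K) ^ n\<close>. Bounded moments of order
    \<open>2 * n\<close> thus make the \<open>n\<close>-th powers uniformly integrable.\<close>
  have g_rem: "x ^ n - g n K x \<le> x ^ (2 * n) / K ^ n" if "0 \<le> x" "0 < K" for n K x
  proof (cases "x \<le> K")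
    case True
    then show ?thesis using that by (simp add: g_def)
  next
    case False
    have "x ^ n * K ^ n \<le> x ^ n * x ^ n"
      using False that by (intro mult_left_mono power_mono) auto
    then have "x ^ n \<le> x ^ (2 * n) / K ^ n"
      using that by (simp add: pos_le_divide_eq mult_2 power_add)
    moreover have "0 \<le> g n K x" using that by (simp add: g_def)
    ultimately show ?thesis by linarith
  qed
  have gint: "integrable N (g n K)" if "prob_space N" "sets N = sets borel" "0 \<le> K" for N n K
  proof -
    interpret prob_space N by fact
    show ?thesis
      by (rule integrable_const_bound[where B="K ^ n"])
         (use g_bd[OF that(3)] that(2) in \<open>auto cong: measurable_cong_sets\<close>)
  qed
  note g\<mu> = gint[OF \<mu>.prob_space_axioms \<mu>.events_eq_borel]
    and g\<nu> = gint[OF \<nu>.prob_space_axioms \<nu>.events_eq_borel]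
  obtain B where B: "\<And>n. eventually (\<lambda>k. (\<integral>x. x ^ n \<partial>\<mu> k) \<le> B n) sequentially"
    using bound by metis
  \<comment> \<open>Truncated moments pass to the limit law at every level \<open>K\<close>; Fatou's
    lemma then removes the truncation.\<close>
  have \<nu>_nn: "(\<integral>\<^sup>+x. ennreal (x ^ n) \<partial>\<nu>) \<le> ennreal (B n)" for n
  proof -
    have le: "(\<integral>x. g n K x \<partial>\<nu>) \<le> B n" if "0 \<le> K" for K
    proof (rule tendsto_upperbound[OF gconv[OF that]])
      show "eventually (\<lambda>k. (\<integral>x. g n K x \<partial>\<mu> k) \<le> B n) sequentially"
        using B[of n]
      proof eventually_elim
        case (elim k)
        have "(\<integral>x. g n K x \<partial>\<mu> k) \<le> (\<integral>x. x ^ n \<partial>\<mu> k)"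
        proof (rule integral_mono_AE[OF g\<mu>[OF that] int])
          show "AE x in \<mu> k. g n K x \<le> x ^ n"
            using nonneg[of k] by eventually_elim (rule g_le[OF _ that])
        qed
        with elim show ?case by linarith
      qed
    qed simp
    have "(\<integral>\<^sup>+x. ennreal (x ^ n) \<partial>\<nu>) \<le> (\<integral>\<^sup>+x. liminf (\<lambda>K. ennreal (g n (real K) x)) \<partial>\<nu>)"
    proof (rule nn_integral_mono_AE)
      show "AE x in \<nu>. ennreal (x ^ n) \<le> liminf (\<lambda>K. ennreal (g n (real K) x))"
        using \<nu>nn
      proof eventually_elim
        case (elim x)
        have "eventually (\<lambda>K. ennreal (x ^ n) \<le> ennreal (g n (real K) x)) sequentially"
          using eventually_ge_at_top[of "nat \<lceil>x\<rceil>"]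
        proof eventually_elim
          case (elim K)
          then have "x \<le> real K" by linarith
          then show ?case using \<open>0 \<le> x\<close> by (simp add: g_def)
        qed
        then show ?case by (rule Liminf_bounded)
      qed
    qed
    also have "\<dots> \<le> liminf (\<lambda>K. \<integral>\<^sup>+x. ennreal (g n (real K) x) \<partial>\<nu>)"
      by (rule nn_integral_liminf) measurable
    also have "\<dots> \<le> liminf (\<lambda>K. ennreal (B n))"
    proof (rule Liminf_mono, rule always_eventually, rule allI)
      fix K :: nat
      have "(\<integral>\<^sup>+x. ennreal (g n (real K) x) \<partial>\<nu>) = ennreal (\<integral>x. g n (real K) x \<partial>\<nu>)"
        by (rule nn_integral_eq_integral[OF g\<nu>]) (auto simp: g_def)
      also have "\<dots> \<le> ennreal (B n)" by (rule ennreal_leI[OF le]) simp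
      finally show "(\<integral>\<^sup>+x. ennreal (g n (real K) x) \<partial>\<nu>) \<le> ennreal (B n)" .
    qed
    also have "\<dots> = ennreal (B n)" by (rule Liminf_const) simp
    finally show ?thesis .
  qed
  show \<nu>int: "integrable \<nu> (\<lambda>x. x ^ n)" for n
  proof (rule integrableI_nonneg)
    show "AE x in \<nu>. 0 \<le> x ^ n" using \<nu>nn by eventually_elim simp
    show "(\<integral>\<^sup>+x. ennreal (x ^ n) \<partial>\<nu>) < \<infinity>"
      by (rule le_less_trans[OF \<nu>_nn]) simp
  qed measurable
  have rem: "\<bar>(\<integral>x. x ^ n \<partial>N) - (\<integral>x. g n K x \<partial>N)\<bar> \<le> (\<integral>x. x ^ (2 * n) \<partial>N) / K ^ n"
    if N: "AE x in N. 0 \<le> x" "\<And>n. integrable N (\<lambda>x. x ^ n)" "integrable N (g n K)" and K: "0 < K" for N K n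
  proof -
    have "(\<integral>x. x ^ n \<partial>N) - (\<integral>x. g n K x \<partial>N) = (\<integral>x. x ^ n - g n K x \<partial>N)"
      using N by simp
    also have "\<dots> \<le> (\<integral>x. x ^ (2 * n) / K ^ n \<partial>N)"
    proof (rule integral_mono_AE)
      show "AE x in N. x ^ n - g n K x \<le> x ^ (2 * n) / K ^ n"
        using N(1) by eventually_elim (rule g_rem[OF _ K])
    qed (use N in auto)
    finally have "(\<integral>x. x ^ n \<partial>N) - (\<integral>x. g n K x \<partial>N) \<le> (\<integral>x. x ^ (2 * n) \<partial>N) / K ^ n" by simp
    moreover have "(\<integral>x. g n K x \<partial>N) \<le> (\<integral>x. x ^ n \<partial>N)"
    proof (rule integral_mono_AE)
      show "AE x in N. g n K x \<le> x ^ n"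
        using N(1) by eventually_elim (rule g_le, use K in auto)
    qed (use N in auto)
    ultimately show ?thesis by linarith
  qed
  show "(\<lambda>k. \<integral>x. x ^ n \<partial>\<mu> k) \<longlonglongrightarrow> (\<integral>x. x ^ n \<partial>\<nu>)"
  proof (cases "n = 0")
    case True
    then show ?thesis using \<mu>.prob_space \<nu>.prob_space by simp
  next
    case False
    show ?thesis
    proof (rule tendstoI)
      fix e :: real assume e: "0 < e"
      define D where "D = max (B (2 * n)) (\<integral>x. x ^ (2 * n) \<partial>\<nu>)"
      \<comment> \<open>As \<open>n \<ge> 1\<close> and \<open>K \<ge> 1\<close>, also
        \<open>K ^ n \<ge> 4 * D / e\<close>, so each truncation error is at most
        \<open>e / 4\<close>. For \<open>n = 0\<close> powers of \<open>K\<close> do not grow,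
        whence the separate case.\<close>
      define K where "K = max 1 (4 * D / e)"
      have K: "1 \<le> K" by (simp add: K_def)
      have DK: "D / K ^ n \<le> e / 4"
      proof -
        have "4 * D / e \<le> K" by (simp add: K_def)
        also have "K \<le> K ^ n" using K False by (simp add: self_le_power)
        finally show ?thesis using e K by (simp add: field_simps)
      qed
      have "eventually (\<lambda>k. dist (\<integral>x. g n K x \<partial>\<mu> k) (\<integral>x. g n K x \<partial>\<nu>) < e / 4) sequentially"
        by (rule tendstoD[OF gconv]) (use K e in auto)
      then show "eventually (\<lambda>k. dist (\<integral>x. x ^ n \<partial>\<mu> k) (\<integral>x. x ^ n \<partial>\<nu>) < e) sequentially"
        using B[of "2 * n"]
      proof eventually_elim
        case (elim k)
        have 1: "\<bar>(\<integral>x. x ^ n \<partial>\<mu> k) - (\<integral>x. g n K x \<partial>\<mu> k)\<bar> \<le> (\<integral>x. x ^ (2 * n) \<partial>\<mu> k) / K ^ n"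
          by (rule rem) (use nonneg int K in \<open>auto intro: g\<mu>\<close>)
        have "(\<integral>x. x ^ (2 * n) \<partial>\<mu> k) / K ^ n \<le> D / K ^ n"
          using elim K by (intro divide_right_mono) (auto simp: D_def)
        note 1 = order_trans[OF 1 order_trans[OF this DK]]
        have 2: "\<bar>(\<integral>x. x ^ n \<partial>\<nu>) - (\<integral>x. g n K x \<partial>\<nu>)\<bar> \<le> (\<integral>x. x ^ (2 * n) \<partial>\<nu>) / K ^ n"
          by (rule rem) (use \<nu>nn \<nu>int K in \<open>auto intro: g\<nu>\<close>)
        have "(\<integral>x. x ^ (2 * n) \<partial>\<nu>) / K ^ n \<le> D / K ^ n"
          using K by (intro divide_right_mono) (auto simp: D_def)
        note 2 = order_trans[OF 2 order_trans[OF this DK]]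
        show ?case using 1 2 elim(1) e unfolding dist_real_def by linarith
      qed
    qed
  qed
qed

text \<open>A limit at infinity is tested along arbitrary sequences, on which
  \<open>converges_in_distribution\<close> becomes weak convergence.\<close>

lemma moments_tendsto_of_converges_in_distribution:
  fixes Y :: "real \<Rightarrow> 'a \<Rightarrow> real"
  assumes "prob_space \<Omega>" and \<nu>: "real_distribution \<nu>"
    and meas [measurable]: "\<And>t. Y t \<in> borel_measurable \<Omega>"
    and nonneg: "\<And>t. AE x in \<Omega>. 0 \<le> Y t x"
    and int: "\<And>t n. integrable \<Omega> (\<lambda>x. Y t x ^ n)"
    and bound: "\<And>n. \<exists>B. eventually (\<lambda>t. (\<integral>x. Y t x ^ n \<partial>\<Omega>) \<le> B) at_top"
    and conv: "converges_in_distribution (\<lambda>t. distr \<Omega> borel (Y t)) \<nu> at_top"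
  shows "((\<lambda>t. \<integral>x. Y t x ^ n \<partial>\<Omega>) \<longlongrightarrow> (\<integral>x. x ^ n \<partial>\<nu>)) at_top"
proof (rule tendsto_at_topI_sequentially)
  interpret prob_space \<Omega> by fact
  fix X :: "nat \<Rightarrow> real" assume X: "filterlim X at_top sequentially"
  have eq: "(\<integral>x. x ^ n \<partial>distr \<Omega> borel (Y (X k))) = (\<integral>x. Y (X k) x ^ n \<partial>\<Omega>)" for k n
    by (subst integral_distr) auto
  have "(\<lambda>k. \<integral>x. x ^ n \<partial>distr \<Omega> borel (Y (X k))) \<longlonglongrightarrow> (\<integral>x. x ^ n \<partial>\<nu>)"
  proof (rule moments_tendsto_of_weak_conv)
    show "real_distribution (distr \<Omega> borel (Y (X k)))" for k by (rule real_distribution_distr) simp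
    show "weak_conv_m (\<lambda>k. distr \<Omega> borel (Y (X k))) \<nu>"
      using conv filterlim_compose[OF _ X]
      by (auto simp: weak_conv_m_def weak_conv_def converges_in_distribution_def)
    show "AE x in distr \<Omega> borel (Y (X k)). 0 \<le> x" for k
      using nonneg[of "X k"] by (subst AE_distr_iff) auto
    show "integrable (distr \<Omega> borel (Y (X k))) (\<lambda>x. x ^ n)" for k n
      using int by (subst integrable_distr_eq) auto
    show "\<exists>B. eventually (\<lambda>k. (\<integral>x. x ^ n \<partial>distr \<Omega> borel (Y (X k))) \<le> B) sequentially" for n
      unfolding eq using bound[of n] eventually_compose_filterlim[OF _ X] by blast
  qed (rule \<nu>)
  then show "(\<lambda>k. \<integral>x. Y (X k) x ^ n \<partial>\<Omega>) \<longlonglongrightarrow> (\<integral>x. x ^ n \<partial>\<nu>)"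
    by (simp only: eq)
qed

text \<open>The method of moments. Bounded first moments give tightness, and a single subsequence
  suffices, because it only serves to produce a law with the moments \<open>c n\<close>. Convergence
  of the whole family to this law then comes from the moments through soft steps; the bound on
  \<open>c n\<close> is what makes them sufficient.\<close>

lemma converges_in_distribution_of_moments:
  fixes Y :: "real \<Rightarrow> 'a \<Rightarrow> real"
  assumes "prob_space \<Omega>"
    and meas [measurable]: "\<And>t. Y t \<in> borel_measurable \<Omega>"
    and nonneg: "\<And>t. AE x in \<Omega>. 0 \<le> Y t x"
    and int: "\<And>t n. integrable \<Omega> (\<lambda>x. Y t x ^ n)"
    and conv: "\<And>n. ((\<lambda>t. \<integral>x. Y t x ^ n \<partial>\<Omega>) \<longlongrightarrow> c n) at_top"
    and bound: "\<And>n. c n \<le> C * \<rho> ^ n * fact n" and \<rho>: "0 \<le> \<rho>"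
  obtains \<nu> where "real_distribution \<nu>" "AE x in \<nu>. 0 \<le> x"
    "\<And>n. integrable \<nu> (\<lambda>x. x ^ n)" "\<And>n. (\<integral>x. x ^ n \<partial>\<nu>) = c n"
    "converges_in_distribution (\<lambda>t. distr \<Omega> borel (Y t)) \<nu> at_top"
proof -
  interpret prob_space \<Omega> by fact
  define D where "D t = distr \<Omega> borel (Y t)" for t
  have D: "real_distribution (D t)" for t unfolding D_def by (rule real_distribution_distr) simp
  interpret D: real_distribution "D t" for t by (rule D)
  have Dnn: "AE x in D t. 0 \<le> x" for t
    using nonneg[of t] unfolding D_def by (subst AE_distr_iff) auto
  have Dint: "integrable (D t) (\<lambda>x. x ^ n)" for t n
    using int unfolding D_def by (subst integrable_distr_eq) auto
  have Deq: "(\<integral>x. x ^ n \<partial>D t) = (\<integral>x. Y t x ^ n \<partial>\<Omega>)" for t n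
    unfolding D_def by (subst integral_distr) auto
  define \<mu> where "\<mu> k = D (real k)" for k :: nat
  have \<mu>conv: "(\<lambda>k. \<integral>x. x ^ n \<partial>\<mu> k) \<longlonglongrightarrow> c n" for n
    unfolding \<mu>_def Deq by (rule filterlim_compose[OF conv filterlim_real_sequentially])
  have "Bseq (\<lambda>k. \<integral>x. x ^ 1 \<partial>\<mu> k)"
    using \<mu>conv[of 1] by (intro convergent_imp_Bseq) (auto simp: convergent_def)
  then obtain B where B: "0 < B" "\<And>k. (\<integral>x. x \<partial>\<mu> k) \<le> B"
    by (auto simp: Bseq_def abs_le_iff)
  have "tight \<mu>"
    unfolding tight_def
  proof (intro conjI allI impI)
    show "real_distribution (\<mu> k)" for k unfolding \<mu>_def by (rule D)
    fix e :: real assume e: "0 < e"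
    \<comment> \<open>Markov's inequality leaves mass at most \<open>B / b < e\<close> beyond
      \<open>b\<close>. The laws live on the nonnegative half-line, so any negative left end will
      do.\<close>
    define b where "b = B / e + 1"
    have b: "0 < b" using B e by (simp add: b_def add_nonneg_pos)
    have "1 - e < measure (\<mu> k) {-1<..b}" for k
    proof -
      interpret \<mu>: real_distribution "\<mu> k" unfolding \<mu>_def by (rule D)
      have i: "integrable (\<mu> k) (\<lambda>x. x)" using Dint[of "real k" 1] by (simp add: \<mu>_def)
      have nn: "AE x in \<mu> k. 0 \<le> x" unfolding \<mu>_def by (rule Dnn)
      have "measure (\<mu> k) {x \<in> space (\<mu> k). b \<le> x} \<le> (\<integral>x. x \<partial>\<mu> k) / b"
        by (rule integral_Markov_inequality_measure[OF i]) (use nn b in auto)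
      also have "\<dots> \<le> B / b" using B b by (intro divide_right_mono) auto
      also have "\<dots> < e"
      proof -
        have "B < e * b" using e by (simp add: b_def field_simps)
        then show ?thesis using b by (simp add: divide_less_eq)
      qed
      finally have "measure (\<mu> k) {x. b \<le> x} < e" by simp
      moreover have "1 \<le> measure (\<mu> k) {-1<..b} + measure (\<mu> k) {x. b \<le> x}"
      proof -
        have "1 = measure (\<mu> k) {x. 0 \<le> x}"
          using \<mu>.prob_eq_1[of "{x. 0 \<le> x}"] nn by simp
        also have "\<dots> \<le> measure (\<mu> k) ({-1<..b} \<union> {x. b \<le> x})"
          by (intro \<mu>.finite_measure_mono) auto
        also have "\<dots> \<le> measure (\<mu> k) {-1<..b} + measure (\<mu> k) {x. b \<le> x}"
          by (intro measure_Un_le) auto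
        finally show ?thesis .
      qed
      ultimately show ?thesis by linarith
    qed
    moreover have "-1 < b" using b by linarith
    ultimately show "\<exists>a b. a < b \<and> (\<forall>k. 1 - e < measure (\<mu> k) {a<..b})" by blast
  qed
  then obtain r \<nu> where r: "strict_mono (r :: nat \<Rightarrow> nat)" and \<nu>: "real_distribution \<nu>"
    and weak: "weak_conv_m (\<mu> \<circ> id \<circ> r) \<nu>"
    using tight_imp_convergent_subsubsequence[of \<mu> id] by (auto simp: strict_mono_def)
  interpret \<nu>: real_distribution \<nu> by (rule \<nu>)
  have rconv: "(\<lambda>k. \<integral>x. x ^ n \<partial>(\<mu> \<circ> id \<circ> r) k) \<longlonglongrightarrow> c n" for n
    using LIMSEQ_subseq_LIMSEQ[OF \<mu>conv r] by (simp add: o_def)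
  have bd: "\<exists>B. eventually (\<lambda>k. (\<integral>x. x ^ n \<partial>(\<mu> \<circ> id \<circ> r) k) \<le> B) sequentially" for n
    using order_tendstoD(2)[OF rconv, of n "c n + 1"] by (auto elim!: eventually_mono intro!: exI[of _ "c n + 1"])
  have sub: "real_distribution ((\<mu> \<circ> id \<circ> r) k)" "AE x in (\<mu> \<circ> id \<circ> r) k. 0 \<le> x"
      "integrable ((\<mu> \<circ> id \<circ> r) k) (\<lambda>x. x ^ n)" for k n
    unfolding \<mu>_def o_def id_def by (rule D Dnn Dint)+
  have props: "AE x in \<nu>. 0 \<le> x" "integrable \<nu> (\<lambda>x. x ^ n)"
      "(\<lambda>k. \<integral>x. x ^ n \<partial>(\<mu> \<circ> id \<circ> r) k) \<longlonglongrightarrow> (\<integral>x. x ^ n \<partial>\<nu>)" for n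
    using moments_tendsto_of_weak_conv[OF sub(1) \<nu> weak sub(2,3) bd] by blast+
  have \<nu>c: "(\<integral>x. x ^ n \<partial>\<nu>) = c n" for n
    by (rule LIMSEQ_unique[OF props(3) rconv])
  define h where "h = 1 / (\<rho> + 1)"
  have h: "0 < h" "h * \<rho> < 1" using \<rho> by (auto simp: h_def)
  have step: "((\<lambda>t. \<integral>x. soft_step h a b x \<partial>D t) \<longlongrightarrow> (\<integral>x. soft_step h a b x \<partial>\<nu>)) at_top" if "a < b" for a b
    by (rule soft_step_integral_tendsto_of_moments[OF h(1) that, where C = C and \<rho> = \<rho>])
       (use props(1,2) \<nu>c conv bound h \<rho> Dnn Dint D.finite_measure_axioms \<nu>.finite_measure_axioms
         in \<open>auto simp: Deq\<close>)
  \<comment> \<open>A soft step lies between the indicators of \<open>{..a}\<close> and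
    \<open>{..b}\<close>, which sandwiches distribution functions at neighbouring points; continuity
    at \<open>x\<close> makes the shift harmless.\<close>
  have sq: "cdf N a \<le> (\<integral>x. soft_step h a b x \<partial>N)" "(\<integral>x. soft_step h a b x \<partial>N) \<le> cdf N b"
    if "real_distribution N" "a < b" for N a b
  proof -
    interpret N: real_distribution N by fact
    note [measurable] = borel_measurable_soft_step[OF h(1) that(2)]
    note st = soft_step_bounds[OF h(1) that(2)] soft_step_eq_0[OF h(1) that(2)] soft_step_eq_1[OF h(1) that(2)]
    have i: "integrable N (soft_step h a b)"
      by (rule N.integrable_const_bound[where B=1]) (use st in auto)
    have j: "integrable N (indicator {..v} :: real \<Rightarrow> real)" for v
      by (intro integrable_real_indicator) (auto simp: N.emeasure_eq_measure)
    have "(\<integral>x. indicator {..a} x \<partial>N) \<le> (\<integral>x. soft_step h a b x \<partial>N)"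
      by (rule integral_mono[OF j i]) (use st in \<open>auto split: split_indicator\<close>)
    then show "cdf N a \<le> (\<integral>x. soft_step h a b x \<partial>N)" by (simp add: cdf_def)
    have "(\<integral>x. soft_step h a b x \<partial>N) \<le> (\<integral>x. indicator {..b} x \<partial>N)"
      by (rule integral_mono[OF i j]) (use st in \<open>auto split: split_indicator\<close>)
    then show "(\<integral>x. soft_step h a b x \<partial>N) \<le> cdf N b" by (simp add: cdf_def)
  qed
  have "((\<lambda>t. cdf (D t) x) \<longlongrightarrow> cdf \<nu> x) at_top" if x: "isCont (cdf \<nu>) x" for x
  proof (rule order_tendstoI)
    fix y assume y: "cdf \<nu> x < y"
    have "eventually (\<lambda>u. cdf \<nu> u < y) (at_right x)"
      using x y by (intro order_tendstoD(2)[where y = "cdf \<nu> x"]) (auto simp: isCont_def filterlim_at_split)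
    then obtain b where b: "x < b" "cdf \<nu> b < y"
      by (metis eventually_at_right_field dense)
    have "eventually (\<lambda>t. (\<integral>u. soft_step h x b u \<partial>D t) < y) at_top"
      by (rule order_tendstoD(2)[OF step[OF b(1)]]) (use sq(2)[OF \<nu> b(1)] b(2) in linarith)
    then show "eventually (\<lambda>t. cdf (D t) x < y) at_top"
      by eventually_elim (use sq(1)[OF D b(1)] in \<open>auto intro: le_less_trans\<close>)
  next
    fix y assume y: "y < cdf \<nu> x"
    have "eventually (\<lambda>u. y < cdf \<nu> u) (at_left x)"
      using x y by (intro order_tendstoD(1)[where y = "cdf \<nu> x"]) (auto simp: isCont_def filterlim_at_split)
    then obtain a where a: "a < x" "y < cdf \<nu> a"
      by (metis eventually_at_left_field dense)
    have "eventually (\<lambda>t. y < (\<integral>u. soft_step h a x u \<partial>D t)) at_top"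
      by (rule order_tendstoD(1)[OF step[OF a(1)]]) (use sq(1)[OF \<nu> a(1)] a(2) in linarith)
    then show "eventually (\<lambda>t. y < cdf (D t) x) at_top"
      by eventually_elim (use sq(2)[OF D a(1)] in \<open>auto intro: less_le_trans\<close>)
  qed
  then have "converges_in_distribution (\<lambda>t. distr \<Omega> borel (Y t)) \<nu> at_top"
    by (simp add: converges_in_distribution_def D_def)
  with \<nu> props \<nu>c that show thesis by blast
qed

section \<open>Integrals against the exponential law\<close>

text \<open>The weight merges with the exponential density into the rate \<open>1 + k\<close>, and
  rescaling by it gives Euler's integral. These are the transforms of the power functions that
  appear as limits.\<close>

lemma has_bochner_integral_exp_law_powr:
  assumes k: "0 \<le> k" and a: "0 \<le> a"
  shows "has_bochner_integral exp_law (\<lambda>u. exp (- (k * u)) * u powr a) (Gamma (1 + a) / (1 + k) powr (1 + a))"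
proof (rule has_bochner_integral_nn_integral)
  define c where "c = 1 + k"
  have c: "0 < c" using k by (simp add: c_def)
  have "ennreal (Gamma (1 + a)) = (\<integral>\<^sup>+t. ennreal (indicator {0..} t * t powr a / exp t) \<partial>lborel)"
    using Gamma_conv_nn_integral_real[of "1 + a"] a by simp
  also have "\<dots> = ennreal \<bar>c\<bar> * (\<integral>\<^sup>+u. ennreal (indicator {0..} (0 + c * u) * (0 + c * u) powr a / exp (0 + c * u)) \<partial>lborel)"
    by (rule nn_integral_real_affine) (use c in auto)
  also have "(\<integral>\<^sup>+u. ennreal (indicator {0..} (0 + c * u) * (0 + c * u) powr a / exp (0 + c * u)) \<partial>lborel)
      = (\<integral>\<^sup>+u. ennreal (c powr a) * (ennreal (exponential_density 1 u) * ennreal (exp (- (k * u)) * u powr a)) \<partial>lborel)"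
  proof (rule nn_integral_cong)
    fix u :: real
    show "ennreal (indicator {0..} (0 + c * u) * (0 + c * u) powr a / exp (0 + c * u))
        = ennreal (c powr a) * (ennreal (exponential_density 1 u) * ennreal (exp (- (k * u)) * u powr a))"
    proof (cases "u < 0")
      case True
      then have "c * u < 0" using c by (simp add: mult_pos_neg)
      with True show ?thesis by (simp add: exponential_density_def)
    next
      case False
      then have u: "0 \<le> u" "0 \<le> c * u" using c by auto
      have "exp (- (c * u)) = exp (- u) * exp (- (k * u))"
        by (simp add: c_def ring_distribs flip: exp_add)
      then show ?thesis
        using u c by (simp add: exponential_density_def powr_mult exp_minus[symmetric] divide_inverse mult_ac flip: ennreal_mult)
    qed
  qed
  also have "\<dots> = ennreal (c powr a) * (\<integral>\<^sup>+u. ennreal (exp (- (k * u)) * u powr a) \<partial>exp_law)"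
    by (subst nn_integral_cmult) (auto simp: nn_integral_density)
  finally have eq: "ennreal (Gamma (1 + a)) = ennreal (c * c powr a) * (\<integral>\<^sup>+u. ennreal (exp (- (k * u)) * u powr a) \<partial>exp_law)"
    using c by (simp add: ennreal_mult mult.assoc)
  have "c * c powr a = c powr (1 + a)" using c by (simp add: powr_add)
  then have pos: "0 < c powr (1 + a)" "ennreal (Gamma (1 + a)) = ennreal (c powr (1 + a)) * (\<integral>\<^sup>+u. ennreal (exp (- (k * u)) * u powr a) \<partial>exp_law)"
    using eq c by auto
  have "ennreal (1 / c powr (1 + a)) * ennreal (Gamma (1 + a))
      = (ennreal (1 / c powr (1 + a)) * ennreal (c powr (1 + a))) * (\<integral>\<^sup>+u. ennreal (exp (- (k * u)) * u powr a) \<partial>exp_law)"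
    unfolding pos(2) by (simp only: mult.assoc)
  also have "ennreal (1 / c powr (1 + a)) * ennreal (c powr (1 + a)) = 1"
    using pos(1) by (simp flip: ennreal_mult)
  finally show "(\<integral>\<^sup>+u. ennreal (exp (- (k * u)) * u powr a) \<partial>exp_law) = ennreal (Gamma (1 + a) / (1 + k) powr (1 + a))"
    using pos(1) a by (simp add: c_def Gamma_real_nonneg flip: ennreal_mult)
  show "0 \<le> Gamma (1 + a) / (1 + k) powr (1 + a)"
    using a by (simp add: Gamma_real_nonneg)
qed auto

lemma
  fixes a :: real
  assumes "0 \<le> a"
  shows integrable_exp_law_powr: "integrable exp_law (\<lambda>u. u powr a)"
    and integral_exp_law_powr: "(\<integral>u. u powr a \<partial>exp_law) = Gamma (1 + a)"
  using has_bochner_integral_exp_law_powr[of 0 a] assms by (auto simp: has_bochner_integral_iff)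

lemma
  shows integrable_exp_law_power: "integrable exp_law (\<lambda>u. u ^ n)"
    and integral_exp_law_power: "(\<integral>u. u ^ n \<partial>exp_law) = fact n"
proof -
  have AE: "AE u in exp_law. u powr real n = u ^ n"
    using AE_exp_law_pos by eventually_elim (rule powr_realpow)
  have "integrable exp_law (\<lambda>u. u ^ n) \<longleftrightarrow> integrable exp_law (\<lambda>u. u powr real n)"
    by (rule integrable_cong_AE) (use AE in \<open>auto elim: eventually_mono\<close>)
  then show "integrable exp_law (\<lambda>u. u ^ n)" using integrable_exp_law_powr[of "real n"] by simp
  have "(\<integral>u. u ^ n \<partial>exp_law) = (\<integral>u. u powr real n \<partial>exp_law)"
    by (rule integral_cong_AE) (use AE in \<open>auto elim: eventually_mono\<close>)
  then show "(\<integral>u. u ^ n \<partial>exp_law) = fact n"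
    by (simp add: integral_exp_law_powr Gamma_fact)
qed

text \<open>Already the part of Euler's integral from \<open>1\<close> to \<open>2\<close> is at
  least \<open>exp (- 2)\<close>. This lets the candidate limit moments be dominated by a geometric
  sequence times factorials.\<close>

lemma inverse_Gamma_le:
  fixes a :: real
  assumes a: "0 \<le> a"
  shows "1 / Gamma (1 + a) \<le> exp 2"
proof -
  have "ennreal (exp (- 2)) = (\<integral>\<^sup>+u. ennreal (exp (- 2)) * indicator {1<..<2::real} u \<partial>lborel)"
    by (simp add: nn_integral_cmult_indicator)
  also have "\<dots> \<le> (\<integral>\<^sup>+u. ennreal (exponential_density 1 u) * ennreal (u powr a) \<partial>lborel)"
  proof (intro nn_integral_mono)
    fix u :: real
    have "ennreal (exp (- 2)) * 1 \<le> ennreal (exponential_density 1 u) * ennreal (u powr a)" if u: "1 < u" "u < 2"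
      using u a by (intro mult_mono) (auto simp: exponential_density_def ge_one_powr_ge_zero intro!: ennreal_leI)
    then show "ennreal (exp (- 2)) * indicator {1<..<2} u \<le> ennreal (exponential_density 1 u) * ennreal (u powr a)"
      by (auto split: split_indicator)
  qed
  also have "\<dots> = (\<integral>\<^sup>+u. ennreal (u powr a) \<partial>exp_law)" by (simp add: nn_integral_density)
  also have "\<dots> = ennreal (Gamma (1 + a))"
    using nn_integral_eq_integral[OF integrable_exp_law_powr[OF a]] integral_exp_law_powr[OF a] by simp
  finally have "exp (- 2) \<le> Gamma (1 + a)"
    using a by (simp add: ennreal_le_iff Gamma_real_nonneg)
  then have "1 / Gamma (1 + a) \<le> 1 / exp (- 2)" using a by (intro divide_left_mono) auto
  then show ?thesis by (simp add: exp_minus divide_inverse)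
qed

text \<open>In the converse direction the limit ratio has Gamma values as its moments under
  \<open>exp_law\<close>, and they must not outgrow factorials. Bounding
  \<open>u powr (n * \<beta>)\<close> by \<open>1\<close> below \<open>1\<close> and by
  \<open>u ^ n\<close> above suffices.\<close>

lemma Gamma_le_fact:
  assumes "0 \<le> \<beta>" "\<beta> \<le> 1"
  shows "Gamma (1 + real n * \<beta>) \<le> 2 * fact n"
proof -
  have "Gamma (1 + real n * \<beta>) = (\<integral>u. u powr (real n * \<beta>) \<partial>exp_law)"
    using assms by (simp add: integral_exp_law_powr)
  also have "\<dots> \<le> (\<integral>u. 1 + u ^ n \<partial>exp_law)"
  proof (rule integral_mono_AE)
    show "AE u in exp_law. u powr (real n * \<beta>) \<le> 1 + u ^ n"
      using AE_exp_law_pos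
    proof eventually_elim
      case (elim u)
      show ?case
      proof (cases "u \<le> 1")
        case True
        then have "u powr (real n * \<beta>) \<le> 1" using elim assms by (simp add: powr_le1)
        then show ?thesis using elim by (smt (verit) zero_le_power)
      next
        case False
        then have "u powr (real n * \<beta>) \<le> u powr real n"
          using assms by (intro powr_mono) (auto simp: mult_left_le)
        then show ?thesis using elim by (simp add: powr_realpow)
      qed
    qed
  qed (use assms in \<open>auto intro!: integrable_exp_law_powr integrable_exp_law_power Bochner_Integration.integrable_add\<close>)
  also have "\<dots> = 1 + fact n"
    using integrable_exp_law_power integral_exp_law_power exp_law.prob_space
    by (subst Bochner_Integration.integral_add) auto
  also have "\<dots> \<le> 2 * fact n" using fact_ge_1[of n, where 'a = real] by simp
  finally show ?thesis .
qed

section \<open>Clocks of random walks\<close>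

text \<open>\<open>(N + m) choose (m + 1)\<close> is, up to the factor \<open>(m + 1)!\<close>, a rising factorial; its increments are the
  coefficients of a negative binomial series, which makes its expectation explicit when \<open>N\<close> is the
  number of renewals before an independent exponential time.\<close>

definition rising :: "nat \<Rightarrow> nat \<Rightarrow> real" where
  "rising m N = fact (Suc m) * real ((N + m) choose Suc m)"

definition rising_diff :: "nat \<Rightarrow> nat \<Rightarrow> real" where
  "rising_diff m k = fact (Suc m) * real ((k + m) choose m)"

lemma rising_diff_nonneg [simp]: "0 \<le> rising_diff m k"
  by (simp add: rising_diff_def)

lemma sum_rising_diff: "(\<Sum>k<N. rising_diff m k) = rising m N"
  by (induction N) (auto simp: rising_def rising_diff_def binomial_eq_0 ring_distribs simp del: fact_Suc)

lemma rising_Suc: "rising (Suc m) N = real (N + m + 1) * rising m N"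
proof -
  have "Suc (Suc m) * (Suc (N + m) choose Suc (Suc m)) = Suc (N + m) * ((N + m) choose Suc m)"
    by (rule Suc_times_binomial)
  then have "real (Suc (Suc m)) * real (Suc (N + m) choose Suc (Suc m)) = real (Suc (N + m)) * real ((N + m) choose Suc m)"
    by (simp only: flip: of_nat_mult)
  then show ?thesis
    by (simp add: rising_def fact_Suc[of "Suc m"] mult_ac del: of_nat_Suc binomial_Suc_Suc)
qed

lemma rising_nonneg [simp]: "0 \<le> rising m N"
  by (simp add: rising_def)

lemma power_le_rising: "real N ^ Suc m \<le> rising m N"
proof (induction m)
  case 0
  then show ?case by (simp add: rising_def)
next
  case (Suc m)
  have "real N * real N ^ Suc m \<le> real (N + m + 1) * rising m N"
    by (intro mult_mono Suc.IH) auto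
  then show ?case by (simp add: rising_Suc)
qed

lemma rising_le_power: "rising m N \<le> real (N + m) ^ Suc m"
proof (induction m)
  case 0
  then show ?case by (simp add: rising_def)
next
  case (Suc m)
  have "rising m N \<le> real (N + Suc m) ^ Suc m"
    by (rule order_trans[OF Suc.IH power_mono]) auto
  then have "real (N + m + 1) * rising m N \<le> real (N + Suc m) * real (N + Suc m) ^ Suc m"
    by (intro mult_mono) auto
  then show ?case by (simp add: rising_Suc)
qed

text \<open>A mean value estimate with error proportional to \<open>d\<close>, expressed through
  \<open>1 + a ^ n\<close> so that its expectation involves no moment beyond order
  \<open>n\<close>.\<close>

lemma power_add_le:
  fixes a d :: real
  assumes "0 \<le> a" "0 \<le> d" "d \<le> 1"
  shows "(a + d) ^ n \<le> a ^ n + d * (real n * 2 ^ n) * (1 + a ^ n)"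
proof (cases n)
  case 0
  then show ?thesis by simp
next
  case (Suc m)
  have "(a + d) ^ n - a ^ n = d * (\<Sum>i<n. (a + d) ^ i * a ^ (n - 1 - i))"
    using power_diff_sumr2[of "a + d" n a] by (simp add: mult_ac)
  also have "\<dots> \<le> d * (\<Sum>i<n. (a + 1) ^ n)"
  proof (intro mult_left_mono sum_mono)
    fix i assume i: "i \<in> {..<n}"
    have "(a + d) ^ i * a ^ (n - 1 - i) \<le> (a + 1) ^ i * (a + 1) ^ (n - 1 - i)"
      using assms by (intro mult_mono power_mono) auto
    also have "\<dots> = (a + 1) ^ (n - 1)" using i by (simp flip: power_add)
    also have "\<dots> \<le> (a + 1) ^ n" using assms by (intro power_increasing) auto
    finally show "(a + d) ^ i * a ^ (n - 1 - i) \<le> (a + 1) ^ n" .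
  qed (use assms in auto)
  also have "\<dots> \<le> d * (real n * (2 ^ n * (1 + a ^ n)))"
  proof -
    have "(a + 1) ^ n \<le> 2 ^ n * (1 + a ^ n)"
    proof (cases "a \<le> 1")
      case True
      then have "(a + 1) ^ n \<le> 2 ^ n" using assms by (intro power_mono) auto
      also have "\<dots> \<le> 2 ^ n * (1 + a ^ n)" using assms by simp
      finally show ?thesis .
    next
      case False
      then have "(a + 1) ^ n \<le> (2 * a) ^ n" by (intro power_mono) auto
      also have "\<dots> \<le> 2 ^ n * (1 + a ^ n)" by (simp add: power_mult_distrib)
      finally show ?thesis .
    qed
    then show ?thesis using assms by (auto intro!: mult_left_mono)
  qed
  finally show ?thesis by (simp add: mult_ac)
qed

text \<open>\<open>\<xi> k\<close> stands for the subordinator at the integer time \<open>k\<close> and \<open>A t\<close> for the clock at time \<open>t\<close>.\<close>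

locale lamperti_clock = prob_space \<Omega> for \<Omega> :: "'a measure" +
  fixes \<xi> :: "nat \<Rightarrow> 'a \<Rightarrow> real" and A :: "real \<Rightarrow> 'a \<Rightarrow> real" and \<alpha> :: real
  assumes \<alpha>: "0 < \<alpha>"
    and \<xi>_meas [measurable]: "\<And>k. \<xi> k \<in> borel_measurable \<Omega>"
    and A_meas [measurable]: "\<And>t. A t \<in> borel_measurable \<Omega>"
    and \<xi>_nonneg: "\<And>k. AE \<omega> in \<Omega>. 0 \<le> \<xi> k \<omega>"
    and \<xi>_mono: "AE \<omega> in \<Omega>. mono (\<lambda>k. \<xi> k \<omega>)"
    and \<xi>_Laplace: "\<And>l k. 0 \<le> l \<Longrightarrow> expectation (\<lambda>\<omega>. exp (- (l * \<xi> k \<omega>))) = expectation (\<lambda>\<omega>. exp (- (l * \<xi> 1 \<omega>))) ^ k"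
    and A_nonneg: "\<And>t. AE \<omega> in \<Omega>. 0 \<le> A t \<omega>"
    and A_le: "\<And>t. AE \<omega> in \<Omega>. A t \<omega> \<le> max 0 t"
    and A_lower: "\<And>t x. 0 \<le> t \<Longrightarrow> AE \<omega> in \<Omega>. \<forall>k. \<xi> k \<omega> \<le> x \<longrightarrow> min (real k) (t * exp (- (\<alpha> * x))) \<le> A t \<omega>"
    and A_upper: "\<And>t x. 0 \<le> t \<Longrightarrow> AE \<omega> in \<Omega>. \<forall>k. x < \<xi> k \<omega> \<longrightarrow> A t \<omega> \<le> real k + t * exp (- (\<alpha> * x))"
begin

text \<open>Clamping at \<open>0\<close> keeps the integrand bounded and makes \<open>q\<close>
  antitone on the whole line, hence \<phi> monotone and Borel measurable.\<close>

definition q :: "real \<Rightarrow> real" where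
  "q l = expectation (\<lambda>\<omega>. exp (- (max 0 l * \<xi> 1 \<omega>)))"

definition \<phi> :: "real \<Rightarrow> real" where
  "\<phi> l = - ln (q l)"

lemma exp_bound: "0 \<le> l \<Longrightarrow> AE \<omega> in \<Omega>. exp (- (l * \<xi> k \<omega>)) \<le> 1"
  using \<xi>_nonneg[of k] by (auto elim!: eventually_mono)

lemma exp_integrable: "0 \<le> l \<Longrightarrow> integrable \<Omega> (\<lambda>\<omega>. exp (- (l * \<xi> k \<omega>)))"
  by (rule integrable_const_bound[where B=1]) (use exp_bound[of l k] in auto)

lemma q_pos: "0 < q l"
proof -
  have "0 \<le> q l" unfolding q_def by (intro integral_nonneg_AE) auto
  moreover have "q l \<noteq> 0"
  proof
    assume "q l = 0"
    then have "AE \<omega> in \<Omega>. exp (- (max 0 l * \<xi> 1 \<omega>)) = 0"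
      unfolding q_def by (subst (asm) integral_nonneg_eq_0_iff_AE) (auto intro!: exp_integrable[of "max 0 l", simplified])
    then show False by simp
  qed
  ultimately show ?thesis by simp
qed

lemma q_le_1: "q l \<le> 1"
proof -
  have "q l \<le> expectation (\<lambda>\<omega>. 1)"
    unfolding q_def by (rule integral_mono_AE) (use exp_integrable[of "max 0 l" 1] exp_bound[of "max 0 l" 1] in auto)
  then show ?thesis by (simp add: prob_space)
qed

lemma q_antimono: "l \<le> l' \<Longrightarrow> q l' \<le> q l"
  unfolding q_def
proof (rule integral_mono_AE)
  assume "l \<le> l'"
  show "AE \<omega> in \<Omega>. exp (- (max 0 l' * \<xi> 1 \<omega>)) \<le> exp (- (max 0 l * \<xi> 1 \<omega>))"
    using \<xi>_nonneg[of 1] by eventually_elim (use \<open>l \<le> l'\<close> in \<open>auto intro!: mult_right_mono\<close>)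
qed (auto intro!: exp_integrable)

lemma \<phi>_nonneg: "0 \<le> \<phi> l"
  using q_pos[of l] q_le_1[of l] by (simp add: \<phi>_def)

lemma \<phi>_mono: "l \<le> l' \<Longrightarrow> \<phi> l \<le> \<phi> l'"
  using q_pos[of l] q_pos[of l'] q_antimono[of l l'] by (simp add: \<phi>_def)

lemma \<phi>_measurable [measurable]: "\<phi> \<in> borel_measurable borel"
  by (rule borel_measurable_mono) (auto simp: mono_def \<phi>_mono)

text \<open>Jensen's inequality for \<open>u \<mapsto> u powr c\<close>, in the form of Young's inequality.\<close>

lemma \<phi>_scale: 
  assumes c: "0 \<le> c" "c \<le> 1" and l: "0 \<le> l"
  shows "c * \<phi> l \<le> \<phi> (c * l)"
proof -
  have le: "(exp (- (l * x)) / q l) powr c \<le> 1 + c * (exp (- (l * x)) / q l - 1)" for x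
  proof -
    have "(exp (- (l * x)) / q l) powr c * 1 powr (1 - c) \<le> c * (exp (- (l * x)) / q l) + (1 - c) * 1"
      by (rule Youngs_inequality_0) (use c q_pos[of l] in auto)
    then show ?thesis by (simp add: algebra_simps)
  qed
  have "expectation (\<lambda>\<omega>. exp (- (c * l * \<xi> 1 \<omega>))) \<le> expectation (\<lambda>\<omega>. q l powr c * (1 + c * (exp (- (l * \<xi> 1 \<omega>)) / q l - 1)))"
  proof (rule integral_mono)
    show "exp (- (c * l * \<xi> 1 \<omega>)) \<le> q l powr c * (1 + c * (exp (- (l * \<xi> 1 \<omega>)) / q l - 1))" for \<omega>
    proof -
      have "exp (- (c * l * \<xi> 1 \<omega>)) = exp (- (l * \<xi> 1 \<omega>)) powr c"
        by (simp add: exp_powr_real mult_ac)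
      also have "\<dots> = q l powr c * (exp (- (l * \<xi> 1 \<omega>)) / q l) powr c"
        using q_pos[of l] by (simp flip: powr_mult)
      also have "\<dots> \<le> q l powr c * (1 + c * (exp (- (l * \<xi> 1 \<omega>)) / q l - 1))"
        by (intro mult_left_mono le) auto
      finally show ?thesis .
    qed
  qed (use exp_integrable[of l 1] exp_integrable[of "c * l" 1] l c in \<open>auto simp: mult.assoc\<close>)
  also have "\<dots> = q l powr c * (1 + c * (expectation (\<lambda>\<omega>. exp (- (l * \<xi> 1 \<omega>))) / q l - 1))"
    using exp_integrable[of l 1] l by (simp add: prob_space)
  also have "expectation (\<lambda>\<omega>. exp (- (l * \<xi> 1 \<omega>))) = q l" using l by (simp add: q_def)
  finally have "q (c * l) \<le> q l powr c"
    using q_pos[of l] l c by (simp add: q_def max_def)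
  then have "ln (q (c * l)) \<le> ln (q l powr c)"
    using q_pos[of l] q_pos[of "c * l"] by (subst ln_le_cancel_iff) auto
  then show ?thesis using q_pos[of l] by (simp add: \<phi>_def ln_powr)
qed

text \<open>At \<open>x = ln t\<close> this is the normalisation in the statement; behaviour of
  \<phi> at \<open>0\<close> becomes behaviour at infinity.\<close>

definition \<psi> :: "real \<Rightarrow> real" where
  "\<psi> x = \<phi> (1 / x)"

lemma \<psi>_nonneg: "0 \<le> \<psi> x" by (simp add: \<psi>_def \<phi>_nonneg)

lemma \<psi>_antimono: "0 < x \<Longrightarrow> x \<le> y \<Longrightarrow> \<psi> y \<le> \<psi> x"
  unfolding \<psi>_def by (intro \<phi>_mono) (simp add: frac_le)

lemma \<psi>_scale:
  assumes "0 < x" "x \<le> y"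
  shows "x / y * \<psi> x \<le> \<psi> y"
  using \<phi>_scale[of "x / y" "1 / x"] assms by (simp add: \<psi>_def)

lemma \<psi>_tendsto_0: "(\<psi> \<longlongrightarrow> 0) at_top"
proof -
  have "((\<lambda>x. expectation (\<lambda>\<omega>. exp (- (max 0 (1 / x) * \<xi> 1 \<omega>)))) \<longlongrightarrow> expectation (\<lambda>\<omega>. 1)) at_top"
  proof (rule integral_dominated_convergence_at_top[where w = "\<lambda>_. 1"])
    show "AE \<omega> in \<Omega>. ((\<lambda>x. exp (- (max 0 (1 / x) * \<xi> 1 \<omega>))) \<longlongrightarrow> 1) at_top"
    proof (rule AE_I2)
      fix \<omega>
      have "((\<lambda>x. exp (- (max 0 (1 / x) * \<xi> 1 \<omega>))) \<longlongrightarrow> exp (- (max 0 0 * \<xi> 1 \<omega>))) at_top"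
        by (intro tendsto_intros tendsto_divide_0[OF tendsto_const] filterlim_at_top_imp_at_infinity filterlim_ident)
      then show "((\<lambda>x. exp (- (max 0 (1 / x) * \<xi> 1 \<omega>))) \<longlongrightarrow> 1) at_top" by simp
    qed
    show "\<forall>\<^sub>F x in at_top. AE \<omega> in \<Omega>. norm (exp (- (max 0 (1 / x) * \<xi> 1 \<omega>))) \<le> 1"
      by (rule always_eventually) (use exp_bound[of "max 0 (1 / _)" 1] in auto)
  qed auto
  then have "((\<lambda>x. q (1 / x)) \<longlongrightarrow> 1) at_top" by (simp add: q_def prob_space)
  then have "((\<lambda>x. - ln (q (1 / x))) \<longlongrightarrow> - ln 1) at_top" by (intro tendsto_intros) auto
  then show ?thesis by (simp add: \<psi>_def[abs_def] \<phi>_def)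
qed

text \<open>If exactly the first \<open>N\<close> values are at most \<open>x\<close>, the
  increments add up to \<open>rising m N\<close>; in this form each term involves a single
  \<open>\<xi> k\<close>. Extended reals admit infinitely many such values.\<close>

definition Y :: "nat \<Rightarrow> real \<Rightarrow> 'a \<Rightarrow> ennreal" where
  "Y m x \<omega> = (\<Sum>k. ennreal (rising_diff m k) * indicator {\<xi> k \<omega>..} x)"

definition R :: "nat \<Rightarrow> real \<Rightarrow> ennreal" where
  "R m x = (\<integral>\<^sup>+\<omega>. Y m x \<omega> \<partial>\<Omega>)"

lemma Y_measurable [measurable]: "Y m x \<in> borel_measurable \<Omega>"
  unfolding Y_def[abs_def] indicator_def atLeast_iff by measurable

lemma R_mono: "x \<le> y \<Longrightarrow> R m x \<le> R m y"
  unfolding R_def Y_def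
  by (intro nn_integral_mono suminf_le mult_left_mono) (auto split: split_indicator)

lemma nn_integral_exp_law_atLeast:
  assumes "0 \<le> l" "0 \<le> s"
  shows "(\<integral>\<^sup>+u. ennreal (exp (- (l * u))) * indicator {s..} u \<partial>exp_law) = ennreal (exp (- ((1 + l) * s)) / (1 + l))"
proof -
  have "(\<integral>\<^sup>+u. ennreal (exp (- (l * u))) * indicator {s..} u \<partial>exp_law)
      = (\<integral>\<^sup>+u. ennreal (exp (- ((1 + l) * u))) * indicator {s..} u \<partial>lborel)"
    using assms by (subst nn_integral_density)
       (auto simp: exponential_density_def ring_distribs exp_add exp_diff exp_minus field_simps
         split: split_indicator simp flip: ennreal_mult intro!: nn_integral_cong)
  also have "\<dots> = ennreal (0 - (- exp (- ((1 + l) * s)) / (1 + l)))"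
  proof (rule nn_integral_FTC_atLeast)
    show "((\<lambda>u. - exp (- ((1 + l) * u)) / (1 + l)) \<longlongrightarrow> 0) at_top"
    proof -
      have "filterlim (\<lambda>u::real. - ((1 + l) * u)) at_bot at_top"
        unfolding filterlim_uminus_at_bot using assms
        by (auto intro!: filterlim_tendsto_pos_mult_at_top[OF tendsto_const] filterlim_ident)
      then have "((\<lambda>u. exp (- ((1 + l) * u))) \<longlongrightarrow> 0) at_top"
        by (rule filterlim_compose[OF exp_at_bot])
      then have "((\<lambda>u. - exp (- ((1 + l) * u)) / (1 + l)) \<longlongrightarrow> - 0 / (1 + l)) at_top"
        using assms by (intro tendsto_intros) auto
      then show ?thesis by simp
    qed
    show "DERIV (\<lambda>u. - exp (- ((1 + l) * u)) / (1 + l)) u :> exp (- ((1 + l) * u))" for u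
    proof -
      have "E * (- 1 - l) = - (E * (1 + l))" for E :: real by (simp add: algebra_simps)
      moreover have "1 + l \<noteq> 0" using assms by simp
      ultimately have "- (E * (- 1 - l) / (1 + l)) = E" for E :: real by simp
      then show ?thesis using assms by (auto intro!: derivative_eq_intros)
    qed
  qed auto
  finally show ?thesis by simp
qed

text \<open>By Tonelli, the event that the exponential time \<open>u * x\<close> has passed
  \<open>\<xi> k\<close> contributes a Laplace transform of \<open>\<xi> k\<close> at
  \<open>(1 + l) / x\<close>, that is the \<open>k\<close>-th power of \<open>q\<close>. What
  remains is a negative binomial series.\<close>

lemma nn_integral_R:
  assumes x: "0 < x" and l: "0 \<le> l" and q: "q ((1 + l) / x) < 1"
  shows "(\<integral>\<^sup>+u. ennreal (exp (- (l * u))) * R m (u * x) \<partial>exp_law)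
    = ennreal (fact (Suc m) / (1 + l) / (1 - q ((1 + l) / x)) ^ Suc m)"
proof -
  have meas [measurable]: "(\<lambda>(\<omega>, u). indicator {\<xi> k \<omega>..} (u * x) :: ennreal) \<in> borel_measurable (\<Omega> \<Otimes>\<^sub>M exp_law)" for k
    unfolding indicator_def atLeast_iff by measurable
  have meas' [measurable]: "(\<lambda>(u, \<omega>). indicator {\<xi> k \<omega>..} (u * x) :: ennreal) \<in> borel_measurable (exp_law \<Otimes>\<^sub>M \<Omega>)" for k
    unfolding indicator_def atLeast_iff by measurable
  interpret pair_sigma_finite \<Omega> exp_law ..
  have inner: "(\<integral>\<^sup>+u. ennreal (exp (- (l * u))) * (\<integral>\<^sup>+\<omega>. indicator {\<xi> k \<omega>..} (u * x) \<partial>\<Omega>) \<partial>exp_law)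
      = ennreal (q ((1 + l) / x) ^ k / (1 + l))" for k
  proof -
    have "(\<integral>\<^sup>+u. ennreal (exp (- (l * u))) * (\<integral>\<^sup>+\<omega>. indicator {\<xi> k \<omega>..} (u * x) \<partial>\<Omega>) \<partial>exp_law)
        = (\<integral>\<^sup>+u. (\<integral>\<^sup>+\<omega>. ennreal (exp (- (l * u))) * indicator {\<xi> k \<omega>..} (u * x) \<partial>\<Omega>) \<partial>exp_law)"
      by (subst nn_integral_cmult) (auto simp: indicator_def)
    also have "\<dots> = (\<integral>\<^sup>+\<omega>. (\<integral>\<^sup>+u. ennreal (exp (- (l * u))) * indicator {\<xi> k \<omega>..} (u * x) \<partial>exp_law) \<partial>\<Omega>)"
      by (rule Fubini') measurable
    also have "\<dots> = (\<integral>\<^sup>+\<omega>. ennreal (exp (- ((1 + l) / x * \<xi> k \<omega>)) / (1 + l)) \<partial>\<Omega>)"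
    proof (rule nn_integral_cong_AE)
      show "AE \<omega> in \<Omega>. (\<integral>\<^sup>+u. ennreal (exp (- (l * u))) * indicator {\<xi> k \<omega>..} (u * x) \<partial>exp_law)
          = ennreal (exp (- ((1 + l) / x * \<xi> k \<omega>)) / (1 + l))"
        using \<xi>_nonneg[of k]
      proof eventually_elim
        case (elim \<omega>)
        have "indicator {\<xi> k \<omega>..} (u * x) = (indicator {\<xi> k \<omega> / x..} u :: ennreal)" for u
          using x by (auto simp: indicator_def field_simps)
        then show ?case
          using nn_integral_exp_law_atLeast[of l "\<xi> k \<omega> / x"] elim x l by simp
      qed
    qed
    also have "\<dots> = ennreal (expectation (\<lambda>\<omega>. exp (- ((1 + l) / x * \<xi> k \<omega>)) / (1 + l)))"
      by (rule nn_integral_eq_integral) (use exp_integrable[of "(1 + l) / x" k] l x in auto)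
    also have "expectation (\<lambda>\<omega>. exp (- ((1 + l) / x * \<xi> k \<omega>)) / (1 + l)) = q ((1 + l) / x) ^ k / (1 + l)"
      using \<xi>_Laplace[of "(1 + l) / x" k] l x by (simp add: q_def)
    finally show ?thesis .
  qed
  have "(\<integral>\<^sup>+u. ennreal (exp (- (l * u))) * R m (u * x) \<partial>exp_law)
      = (\<integral>\<^sup>+u. (\<Sum>k. ennreal (rising_diff m k) * (ennreal (exp (- (l * u))) * (\<integral>\<^sup>+\<omega>. indicator {\<xi> k \<omega>..} (u * x) \<partial>\<Omega>))) \<partial>exp_law)"
  proof (rule nn_integral_cong)
    fix u
    have "R m (u * x) = (\<Sum>k. ennreal (rising_diff m k) * (\<integral>\<^sup>+\<omega>. indicator {\<xi> k \<omega>..} (u * x) \<partial>\<Omega>))"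
      unfolding R_def Y_def
      by (subst nn_integral_suminf) (auto simp: nn_integral_cmult indicator_def[abs_def] atLeast_iff)
    then show "ennreal (exp (- (l * u))) * R m (u * x)
        = (\<Sum>k. ennreal (rising_diff m k) * (ennreal (exp (- (l * u))) * (\<integral>\<^sup>+\<omega>. indicator {\<xi> k \<omega>..} (u * x) \<partial>\<Omega>)))"
      by (simp add: ennreal_suminf_cmult[symmetric] mult.left_commute)
  qed
  also have "\<dots> = (\<Sum>k. \<integral>\<^sup>+u. ennreal (rising_diff m k) * (ennreal (exp (- (l * u))) * (\<integral>\<^sup>+\<omega>. indicator {\<xi> k \<omega>..} (u * x) \<partial>\<Omega>)) \<partial>exp_law)"
    by (rule nn_integral_suminf) measurable
  also have "\<dots> = (\<Sum>k. ennreal (rising_diff m k) * ennreal (q ((1 + l) / x) ^ k / (1 + l)))"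
    by (intro suminf_cong) (subst nn_integral_cmult, measurable, simp only: inner)
  also have "\<dots> = (\<Sum>k. ennreal (fact (Suc m) / (1 + l) * (real ((k + m) choose m) * q ((1 + l) / x) ^ k)))"
    using q_pos[of "(1 + l) / x"] l
    by (intro suminf_cong) (simp add: rising_diff_def mult_ac flip: ennreal_mult del: fact_Suc)
  also have "\<dots> = ennreal (fact (Suc m) / (1 + l) * (1 / (1 - q ((1 + l) / x)) ^ Suc m))"
    by (intro suminf_ennreal_eq sums_mult negative_binomial_sums)
       (use q q_pos[of "(1 + l) / x"] l in \<open>auto simp del: fact_Suc\<close>)
  finally show ?thesis by (simp del: fact_Suc)
qed

end

section \<open>Expected renewal counts and their comparison with the clock\<close>

context lamperti_clock
begin

definition M :: "nat \<Rightarrow> real \<Rightarrow> real" where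
  "M m x = enn2real (R m x)"

lemma M_nonneg [simp]: "0 \<le> M m x"
  by (simp add: M_def)

lemma A_power_integrable: "integrable \<Omega> (\<lambda>\<omega>. (s * A t \<omega>) ^ n)"
proof (rule integrable_const_bound)
  show "AE \<omega> in \<Omega>. norm ((s * A t \<omega>) ^ n) \<le> (\<bar>s\<bar> * max 0 t) ^ n"
    using A_nonneg[of t] A_le[of t]
    by eventually_elim (auto simp: power_abs abs_mult intro!: power_mono mult_left_mono)
qed measurable

end

text \<open>\<open>q 1 = 1\<close> means that \<open>\<xi> 1\<close> vanishes almost surely; then no
  positive level is passed and the expected counts are infinite.\<close>

locale nontrivial_lamperti_clock = lamperti_clock +
  assumes nontrivial: "q 1 < 1"
begin

lemma \<phi>_pos:
  assumes "0 < l"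
  shows "0 < \<phi> l"
proof -
  have 1: "0 < \<phi> 1" using nontrivial q_pos[of 1] by (simp add: \<phi>_def)
  show ?thesis
  proof (cases "l \<le> 1")
    case True
    have "0 < l * \<phi> 1" using 1 assms by simp
    also have "\<dots> \<le> \<phi> (l * 1)" by (rule \<phi>_scale) (use True assms in auto)
    finally show ?thesis by simp
  next
    case False
    then show ?thesis using \<phi>_mono[of 1 l] 1 by simp
  qed
qed

lemma \<psi>_pos: "0 < x \<Longrightarrow> 0 < \<psi> x"
  by (simp add: \<psi>_def \<phi>_pos)

lemma q_less_1: "0 < l \<Longrightarrow> q l < 1"
  using \<phi>_pos[of l] q_pos[of l] by (simp add: \<phi>_def)

text \<open>\<open>R m\<close> is nondecreasing and the exponential variable exceeds
  \<open>1\<close> with probability \<open>exp (- 1)\<close>, so the value at \<open>x\<close> is at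
  most \<open>exp 1\<close> times the exponential average, which is known exactly.\<close>

lemma R_le:
  assumes x: "0 < x"
  shows "R m x \<le> ennreal (exp 1 * fact (Suc m) / (1 - q (1 / x)) ^ Suc m)"
proof -
  have "ennreal (exp (- 1)) * R m x = (\<integral>\<^sup>+u. ennreal (exp (- (0 * u))) * indicator {1..} u \<partial>exp_law) * R m x"
    using nn_integral_exp_law_atLeast[of 0 1] by simp
  also have "\<dots> = (\<integral>\<^sup>+u. indicator {1..} u * R m x \<partial>exp_law)"
    by (simp add: nn_integral_multc)
  also have "\<dots> \<le> (\<integral>\<^sup>+u. ennreal (exp (- (0 * u))) * R m (u * x) \<partial>exp_law)"
    using x by (intro nn_integral_mono) (auto split: split_indicator intro!: R_mono)
  also have "\<dots> = ennreal (fact (Suc m) / (1 - q (1 / x)) ^ Suc m)"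
    using nn_integral_R[of x 0 m] q_less_1[of "1 / x"] x by simp
  finally have "ennreal (exp 1) * (ennreal (exp (- 1)) * R m x)
      \<le> ennreal (exp 1) * ennreal (fact (Suc m) / (1 - q (1 / x)) ^ Suc m)"
    by (rule mult_left_mono) simp
  moreover have "ennreal (exp 1) * (ennreal (exp (- 1)) * R m x) = R m x"
    by (simp add: mult.assoc[symmetric] exp_minus flip: ennreal_mult)
  moreover have "ennreal (exp 1) * ennreal (fact (Suc m) / (1 - q (1 / x)) ^ Suc m)
      = ennreal (exp 1 * fact (Suc m) / (1 - q (1 / x)) ^ Suc m)"
    using q_less_1[of "1 / x"] x by (subst ennreal_mult[symmetric]) (auto simp del: fact_Suc power_Suc)
  ultimately show ?thesis by simp
qed

lemma R_finite: "R m x < \<infinity>"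
proof -
  have "R m x \<le> R m (max 1 x)" by (rule R_mono) simp
  also have "\<dots> < \<infinity>" by (rule le_less_trans[OF R_le]) auto
  finally show ?thesis .
qed

lemma ennreal_M: "ennreal (M m x) = R m x"
  using R_finite[of m x] by (simp add: M_def)

lemma M_mono: "x \<le> y \<Longrightarrow> M m x \<le> M m y"
  using R_mono[of x y m] by (simp flip: ennreal_M)

lemma M_measurable [measurable]: "M m \<in> borel_measurable borel"
  by (rule borel_measurable_mono) (auto simp: mono_def M_mono)

lemma M_le:
  assumes "0 < x"
  shows "M m x \<le> exp 1 * fact (Suc m) / (1 - q (1 / x)) ^ Suc m"
proof -
  have "0 < 1 - q (1 / x)" using q_less_1[of "1 / x"] assms by simp
  then have "0 \<le> exp 1 * fact (Suc m) / (1 - q (1 / x)) ^ Suc m"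
    by (intro divide_nonneg_nonneg) auto
  then show ?thesis
    using R_le[OF assms, of m] unfolding ennreal_M[symmetric] by (subst (asm) ennreal_le_iff)
qed

lemma M_Laplace:
  assumes x: "0 < x" and l: "0 \<le> l"
  shows "has_bochner_integral exp_law (\<lambda>u. exp (- (l * u)) * M m (u * x))
    (fact (Suc m) / (1 + l) / (1 - q ((1 + l) / x)) ^ Suc m)"
proof (rule has_bochner_integral_nn_integral)
  have q: "q ((1 + l) / x) < 1" by (rule q_less_1) (use x l in auto)
  show "(\<integral>\<^sup>+u. ennreal (exp (- (l * u)) * M m (u * x)) \<partial>exp_law) = ennreal (fact (Suc m) / (1 + l) / (1 - q ((1 + l) / x)) ^ Suc m)"
    unfolding nn_integral_R[OF x l q, symmetric] by (simp add: ennreal_mult ennreal_M)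
  show "0 \<le> fact (Suc m) / (1 + l) / (1 - q ((1 + l) / x)) ^ Suc m"
    using q l by (intro divide_nonneg_nonneg) auto
qed auto

text \<open>The finite expectation of \<open>Y 0 x\<close> excludes that all \<open>\<xi> k\<close>
  stay at or below \<open>x\<close>; monotonicity then makes the indices with
  \<open>\<xi> k \<le> x\<close> an initial segment, whose length serves all \<open>m\<close> at
  once.\<close>

lemma AE_renewal_count:
  "AE \<omega> in \<Omega>. \<exists>N. (\<forall>m. Y m x \<omega> = ennreal (rising m N)) \<and> (\<forall>k<N. \<xi> k \<omega> \<le> x) \<and> x < \<xi> N \<omega>"
proof -
  have "AE \<omega> in \<Omega>. Y 0 x \<omega> \<noteq> \<infinity>"
    using R_finite[of 0 x] by (intro nn_integral_PInf_AE) (auto simp: R_def)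
  with \<xi>_mono show ?thesis
  proof eventually_elim
    case (elim \<omega>)
    have "\<exists>k. x < \<xi> k \<omega>"
    proof (rule ccontr)
      assume "\<not> ?thesis"
      then have "Y 0 x \<omega> = (\<Sum>k::nat. 1)"
        unfolding Y_def by (intro suminf_cong) (auto simp: rising_diff_def not_less)
      moreover have "(\<Sum>k::nat. 1 :: ennreal) = \<infinity>"
        by (simp add: nn_integral_count_space_nat[symmetric])
      ultimately show False using elim by simp
    qed
    define N where "N = (LEAST k. x < \<xi> k \<omega>)"
    have N: "x < \<xi> N \<omega>" unfolding N_def by (rule LeastI_ex) fact
    have lt: "\<xi> k \<omega> \<le> x" if "k < N" for k
      using not_less_Least[of k "\<lambda>k. x < \<xi> k \<omega>"] that by (simp add: N_def)
    have ge: "x < \<xi> k \<omega>" if "N \<le> k" for k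
      using N monoD[OF elim(1) that] by simp
    have "Y m x \<omega> = ennreal (rising m N)" for m
    proof -
      have "Y m x \<omega> = (\<Sum>k<N. ennreal (rising_diff m k) * indicator {\<xi> k \<omega>..} x)"
        unfolding Y_def
      proof (rule suminf_finite)
        fix k assume "k \<notin> {..<N}"
        then show "ennreal (rising_diff m k) * indicator {\<xi> k \<omega>..} x = 0" using ge[of k] by simp
      qed simp
      also have "\<dots> = (\<Sum>k<N. ennreal (rising_diff m k))"
        by (intro sum.cong) (auto simp: lt)
      finally show ?thesis by (simp add: sum_rising_diff)
    qed
    with N lt show ?case by blast
  qed
qed

lemma M_expectation: "has_bochner_integral \<Omega> (\<lambda>\<omega>. enn2real (Y m x \<omega>)) (M m x)"
proof (rule has_bochner_integral_nn_integral)
  have "(\<integral>\<^sup>+\<omega>. ennreal (enn2real (Y m x \<omega>)) \<partial>\<Omega>) = R m x"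
    unfolding R_def
  proof (rule nn_integral_cong_AE)
    show "AE \<omega> in \<Omega>. ennreal (enn2real (Y m x \<omega>)) = Y m x \<omega>"
      using AE_renewal_count[of x] by eventually_elim auto
  qed
  then show "(\<integral>\<^sup>+\<omega>. ennreal (enn2real (Y m x \<omega>)) \<partial>\<Omega>) = ennreal (M m x)"
    by (simp add: ennreal_M)
qed auto

text \<open>\<open>A_upper\<close> is used at \<open>k = N\<close>, the first index beyond the level
  \<open>x\<close>. The remaining term, scaled by \<open>s\<close>, is \<open>d\<close>, and
  \<open>power_add_le\<close> turns it into a multiplicative and additive error of order
  \<open>d\<close>.\<close>

lemma A_moment_le:
  fixes m :: nat
  defines "n \<equiv> Suc m" and "K \<equiv> real (Suc m) * 2 ^ Suc m"
  assumes t: "0 \<le> t" and s: "0 \<le> s" and d: "d = s * (t * exp (- (\<alpha> * x)))" "d \<le> 1"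
  shows "expectation (\<lambda>\<omega>. (s * A t \<omega>) ^ n) \<le> s ^ n * M m x + d * K * (1 + s ^ n * M m x)"
proof -
  note iM = M_expectation[of m x, unfolded has_bochner_integral_iff]
  have d0: "0 \<le> d" using d t s by simp
  have "expectation (\<lambda>\<omega>. (s * A t \<omega>) ^ n)
      \<le> expectation (\<lambda>\<omega>. s ^ n * enn2real (Y m x \<omega>) + d * K * (1 + s ^ n * enn2real (Y m x \<omega>)))"
  proof (rule integral_mono_AE)
    show "AE \<omega> in \<Omega>. (s * A t \<omega>) ^ n \<le> s ^ n * enn2real (Y m x \<omega>) + d * K * (1 + s ^ n * enn2real (Y m x \<omega>))"
      using AE_renewal_count[of x] A_upper[OF t, of x] A_nonneg[of t]
    proof eventually_elim
      case (elim \<omega>)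
      then obtain N where N: "\<And>m. Y m x \<omega> = ennreal (rising m N)" "x < \<xi> N \<omega>" by blast
      have "s * A t \<omega> \<le> s * (real N + t * exp (- (\<alpha> * x)))"
        using elim N s by (intro mult_left_mono) auto
      then have "s * A t \<omega> \<le> s * real N + d" by (simp add: d ring_distribs)
      then have "(s * A t \<omega>) ^ n \<le> (s * real N + d) ^ n"
        using elim s by (intro power_mono) auto
      also have "\<dots> \<le> (s * real N) ^ n + d * K * (1 + (s * real N) ^ n)"
        using power_add_le[of "s * real N" d n] s d0 d(2) by (simp add: K_def n_def)
      also have "\<dots> \<le> s ^ n * rising m N + d * K * (1 + s ^ n * rising m N)"
      proof -
        have "(s * real N) ^ n \<le> s ^ n * rising m N"
          unfolding power_mult_distrib using power_le_rising[of N m] s by (intro mult_left_mono) (auto simp: n_def)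
        then show ?thesis using d0 by (intro add_mono mult_left_mono) (auto simp: K_def)
      qed
      finally show ?case by (simp add: N)
    qed
  qed (use iM in \<open>auto intro!: A_power_integrable\<close>)
  also have "\<dots> = s ^ n * M m x + d * K * (1 + s ^ n * M m x)"
    using iM by (simp add: prob_space)
  finally show ?thesis .
qed

text \<open>The lower bound on the clock is capped by \<open>T\<close>. While \<open>N - 1\<close>
  is below the cap it gives \<open>N - 1 \<le> A t\<close>. Beyond it,
  \<open>rising (Suc m) N\<close> exceeds \<open>rising m N\<close> by a factor larger than
  \<open>T\<close>: a Markov-type estimate paying with the next moment divided by
  \<open>T\<close>.\<close>

lemma M_le_A_moment:
  fixes m :: nat
  defines "n \<equiv> Suc m" and "K \<equiv> real (Suc m) * 2 ^ Suc m"
  assumes t: "0 \<le> t" and s: "0 \<le> s" and d: "d = s * (real m + 1)" "d \<le> 1"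
    and T: "T = t * exp (- (\<alpha> * x))" "0 < T"
  shows "s ^ n * M m x \<le> expectation (\<lambda>\<omega>. (s * A t \<omega>) ^ n)
      + d * K * (1 + expectation (\<lambda>\<omega>. (s * A t \<omega>) ^ n)) + s ^ n * M (Suc m) x / T"
proof -
  note iM = M_expectation[of m x, unfolded has_bochner_integral_iff] M_expectation[of "Suc m" x, unfolded has_bochner_integral_iff]
  note iA = A_power_integrable[of s t n]
  have d0: "0 \<le> d" using d s by simp
  have "s ^ n * M m x = expectation (\<lambda>\<omega>. s ^ n * enn2real (Y m x \<omega>))"
    using iM by simp
  also have "\<dots> \<le> expectation (\<lambda>\<omega>. (s * A t \<omega>) ^ n + d * K * (1 + (s * A t \<omega>) ^ n)
      + s ^ n * enn2real (Y (Suc m) x \<omega>) / T)"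
  proof (rule integral_mono_AE)
    show "AE \<omega> in \<Omega>. s ^ n * enn2real (Y m x \<omega>) \<le> (s * A t \<omega>) ^ n + d * K * (1 + (s * A t \<omega>) ^ n)
        + s ^ n * enn2real (Y (Suc m) x \<omega>) / T"
      using AE_renewal_count[of x] A_lower[OF t, of x] A_nonneg[of t]
    proof eventually_elim
      case (elim \<omega>)
      then obtain N where N: "\<And>m. Y m x \<omega> = ennreal (rising m N)" "\<And>k. k < N \<Longrightarrow> \<xi> k \<omega> \<le> x" by blast
      have rest: "0 \<le> (s * A t \<omega>) ^ n + d * K * (1 + (s * A t \<omega>) ^ n)" "0 \<le> s ^ n * rising (Suc m) N / T"
        using elim s d0 T by (auto simp: K_def)
      consider "N = 0" | "0 < N" "real (N - 1) \<le> T" | "T < real N - 1" by linarith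
      then have "s ^ n * rising m N \<le> (s * A t \<omega>) ^ n + d * K * (1 + (s * A t \<omega>) ^ n) + s ^ n * rising (Suc m) N / T"
      proof cases
        case 1
        then have "rising m N = 0" by (simp add: rising_def)
        then show ?thesis using rest by simp
      next
        case 2
        \<comment> \<open>\<open>N - 1\<close> is the last index with
          \<open>\<xi> k \<le> x\<close>; this loses one unit and \<open>rising_le_power\<close>
          loses \<open>m\<close>, together the \<open>m + 1\<close> in \<open>d\<close>.\<close>
        have "min (real (N - 1)) T \<le> A t \<omega>"
          unfolding T(1) by (rule elim(2)[rule_format, OF N(2)]) (use 2 in simp)
        with 2 have "real (N + m) \<le> A t \<omega> + (real m + 1)" by (simp add: min_def of_nat_diff)
        then have le: "s * real (N + m) \<le> s * A t \<omega> + d"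
          unfolding d distrib_left[symmetric] using s by (rule mult_left_mono)
        have "s ^ n * rising m N \<le> s ^ n * real (N + m) ^ n"
          using rising_le_power[of m N] s by (intro mult_left_mono) (auto simp: n_def)
        also have "\<dots> = (s * real (N + m)) ^ n" by (simp add: power_mult_distrib)
        also have "\<dots> \<le> (s * A t \<omega> + d) ^ n" using le s by (intro power_mono) auto
        also have "\<dots> \<le> (s * A t \<omega>) ^ n + d * K * (1 + (s * A t \<omega>) ^ n)"
          using power_add_le[of "s * A t \<omega>" d n] s d0 d(2) elim by (simp add: K_def n_def)
        finally show ?thesis using rest by simp
      next
        case 3
        have "T * rising m N \<le> real (N + m + 1) * rising m N"
          using 3 by (intro mult_right_mono) auto
        then have "rising m N \<le> rising (Suc m) N / T"
          using T by (simp add: rising_Suc field_simps)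
        then have "s ^ n * rising m N \<le> s ^ n * (rising (Suc m) N / T)"
          using s by (intro mult_left_mono) auto
        then show ?thesis using rest by simp
      qed
      then show ?case by (simp add: N)
    qed
  qed (use iM iA in auto)
  also have "\<dots> = expectation (\<lambda>\<omega>. (s * A t \<omega>) ^ n)
      + d * K * (1 + expectation (\<lambda>\<omega>. (s * A t \<omega>) ^ n)) + s ^ n * M (Suc m) x / T"
    using iM iA by (simp add: prob_space)
  finally show ?thesis .
qed

end

text \<open>A dilation by \<open>1 - e\<close> does not affect a limit at infinity, and the factor
  \<open>(1 - e) ^ n\<close> disappears when \<open>e\<close> tends to \<open>0\<close> after
  \<open>y\<close> tends to infinity. To bound \<open>b\<close> from above, the lower estimate is
  read at \<open>y / (1 - e)\<close>.\<close>

lemma tendsto_iff_of_dilation_bounds: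
  fixes a b u :: "real \<Rightarrow> real"
  assumes u: "(u \<longlongrightarrow> 0) at_top" and upper: "eventually (\<lambda>y. a y \<le> b y + u y) at_top"
    and lower: "\<And>e. 0 < e \<Longrightarrow> e < 1 \<Longrightarrow>
      \<exists>v. (v \<longlongrightarrow> 0) at_top \<and> eventually (\<lambda>y. (1 - e) ^ n * b ((1 - e) * y) \<le> a y + v y) at_top"
  shows "(a \<longlongrightarrow> K) at_top \<longleftrightarrow> (b \<longlongrightarrow> K) at_top"
proof -
  have scale: "((\<lambda>e. (1 - e) ^ n * k) \<longlongrightarrow> k) (at_right (0 :: real))" for k :: real
  proof -
    have "((\<lambda>e. (1 - e) ^ n * k) \<longlongrightarrow> (1 - 0) ^ n * k) (at_right (0 :: real))"
      by (intro tendsto_intros)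
    then show ?thesis by simp
  qed
  have small: "eventually (\<lambda>e. 0 < e \<and> e < 1) (at_right (0 :: real))"
    by (auto simp: eventually_at_right_field intro: exI[of _ 1])
  show ?thesis
  proof
    assume b: "(b \<longlongrightarrow> K) at_top"
    show "(a \<longlongrightarrow> K) at_top"
    proof (rule order_tendstoI)
      fix z assume z: "K < z"
      have "((\<lambda>y. b y + u y) \<longlongrightarrow> K + 0) at_top" by (intro tendsto_intros b u)
      then have "eventually (\<lambda>y. b y + u y < z) at_top" by (rule order_tendstoD) (use z in simp)
      with upper show "eventually (\<lambda>y. a y < z) at_top" by eventually_elim simp
    next
      fix z assume z: "z < K"
      have "eventually (\<lambda>e. z < (1 - e) ^ n * K \<and> 0 < e \<and> e < 1) (at_right 0)"
        using order_tendstoD(1)[OF scale z] small by eventually_elim simp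
      then obtain e where e: "z < (1 - e) ^ n * K" "0 < e" "e < 1"
        by (auto dest!: eventually_happens' [OF trivial_limit_at_right_real])
      obtain v where v: "(v \<longlongrightarrow> 0) at_top" "eventually (\<lambda>y. (1 - e) ^ n * b ((1 - e) * y) \<le> a y + v y) at_top"
        using lower[OF e(2,3)] by blast
      have "filterlim (\<lambda>y. (1 - e) * y) at_top at_top"
        by (rule filterlim_tendsto_pos_mult_at_top[OF tendsto_const]) (use e in \<open>auto intro: filterlim_ident\<close>)
      then have "((\<lambda>y. (1 - e) ^ n * b ((1 - e) * y) - v y) \<longlongrightarrow> (1 - e) ^ n * K - 0) at_top"
        by (intro tendsto_intros filterlim_compose[OF b] v)
      then have "eventually (\<lambda>y. z < (1 - e) ^ n * b ((1 - e) * y) - v y) at_top"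
        by (rule order_tendstoD) (use e in simp)
      with v(2) show "eventually (\<lambda>y. z < a y) at_top" by eventually_elim simp
    qed
  next
    assume a: "(a \<longlongrightarrow> K) at_top"
    show "(b \<longlongrightarrow> K) at_top"
    proof (rule order_tendstoI)
      fix z assume z: "z < K"
      have "((\<lambda>y. a y - u y) \<longlongrightarrow> K - 0) at_top" by (intro tendsto_intros a u)
      then have "eventually (\<lambda>y. z < a y - u y) at_top" by (rule order_tendstoD) (use z in simp)
      with upper show "eventually (\<lambda>y. z < b y) at_top" by eventually_elim simp
    next
      fix z assume z: "K < z"
      have "eventually (\<lambda>e. K < (1 - e) ^ n * z \<and> 0 < e \<and> e < 1) (at_right 0)"
        using order_tendstoD(1)[OF scale z] small by eventually_elim simp
      then obtain e where e: "K < (1 - e) ^ n * z" "0 < e" "e < 1"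
        by (auto dest!: eventually_happens' [OF trivial_limit_at_right_real])
      obtain v where v: "(v \<longlongrightarrow> 0) at_top" "eventually (\<lambda>y. (1 - e) ^ n * b ((1 - e) * y) \<le> a y + v y) at_top"
        using lower[OF e(2,3)] by blast
      have "((\<lambda>y. a y + v y) \<longlongrightarrow> K + 0) at_top" by (intro tendsto_intros a v)
      then have "eventually (\<lambda>y. a y + v y < (1 - e) ^ n * z) at_top"
        by (rule order_tendstoD) (use e in simp)
      with v(2) have ev: "eventually (\<lambda>y. b ((1 - e) * y) < z) at_top"
      proof eventually_elim
        case (elim y)
        then have "(1 - e) ^ n * b ((1 - e) * y) < (1 - e) ^ n * z" by simp
        then show ?case using e by simp
      qed
      have "filterlim (\<lambda>y. 1 / (1 - e) * y) at_top at_top"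
        by (rule filterlim_tendsto_pos_mult_at_top[OF tendsto_const]) (use e in \<open>auto intro: filterlim_ident\<close>)
      from eventually_compose_filterlim[OF ev this] show "eventually (\<lambda>y. b y < z) at_top"
        using e by simp
    qed
  qed
qed

lemma integrable_exp_law_affine_power: "integrable exp_law (\<lambda>u. (c + d * u) ^ n)"
  unfolding binomial_ring power_mult_distrib
  by (intro Bochner_Integration.integrable_sum integrable_mult_right integrable_exp_law_power)

section \<open>Normalised moments of the clock and of the renewal count\<close>

context nontrivial_lamperti_clock
begin

lemma \<psi>_measurable [measurable]: "\<psi> \<in> borel_measurable borel"
  unfolding \<psi>_def[abs_def] by measurable

text \<open>Monotonicity settles \<open>c \<le> 1\<close> and the Jensen-type bound the other case.
  Growth at most linear in \<open>c\<close> is what makes dominated convergence under the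
  exponential law possible.\<close>

lemma \<psi>_ratio_le:
  assumes "0 < x" "0 < c"
  shows "\<psi> x / \<psi> (c * x) \<le> max 1 c"
proof (cases "c \<le> 1")
  case True
  then have "\<psi> x \<le> \<psi> (c * x)" using assms by (intro \<psi>_antimono) auto
  then show ?thesis using \<psi>_pos[of "c * x"] assms by (simp add: le_max_iff_disj)
next
  case False
  then have "x / (c * x) * \<psi> x \<le> \<psi> (c * x)" using assms by (intro \<psi>_scale) auto
  then have "\<psi> x \<le> c * \<psi> (c * x)" using assms by (simp add: field_simps)
  then have "\<psi> x / \<psi> (c * x) \<le> c" using \<psi>_pos[of "c * x"] assms by (simp add: divide_le_eq)
  then show ?thesis by simp
qed

lemma one_minus_q_pos: "0 < l \<Longrightarrow> 0 < 1 - q l"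
  using q_less_1[of l] by simp

text \<open>As \<open>q (1 / x) = exp (- \<psi> x)\<close>, both are instances of
  \<open>1 + z \<le> exp z\<close>, at \<open>z = - \<psi> x\<close> and at
  \<open>z = \<psi> x\<close>. They let the exact formulas in \<open>1 - q\<close> be read as
  formulas in \<phi>.\<close>

lemma one_minus_q_bounds:
  assumes "0 < x"
  shows "1 \<le> \<psi> x / (1 - q (1 / x))" "\<psi> x / (1 - q (1 / x)) \<le> 1 + \<psi> x"
proof -
  have q: "q (1 / x) = exp (- \<psi> x)"
    using q_pos[of "1 / x"] by (simp add: \<psi>_def \<phi>_def)
  have pos: "0 < 1 - q (1 / x)" using one_minus_q_pos[of "1 / x"] assms by simp
  have "1 - \<psi> x \<le> q (1 / x)" unfolding q using exp_ge_add_one_self[of "- \<psi> x"] by simp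
  then show "1 \<le> \<psi> x / (1 - q (1 / x))" using pos by simp
  have "(1 + \<psi> x) * q (1 / x) \<le> exp (\<psi> x) * exp (- \<psi> x)"
    unfolding q using exp_ge_add_one_self[of "\<psi> x"] by (intro mult_right_mono) auto
  also have "\<dots> = 1" by (simp flip: exp_add)
  finally have "\<psi> x \<le> (1 + \<psi> x) * (1 - q (1 / x))" by (simp add: algebra_simps)
  then show "\<psi> x / (1 - q (1 / x)) \<le> 1 + \<psi> x" using pos by (simp add: divide_le_eq)
qed

lemma one_minus_q_asymp: "((\<lambda>x. \<psi> x / (1 - q (1 / x))) \<longlongrightarrow> 1) at_top"
proof (rule tendsto_sandwich)
  show "eventually (\<lambda>x. 1 \<le> \<psi> x / (1 - q (1 / x))) at_top"
    using eventually_gt_at_top[of 0] by eventually_elim (rule one_minus_q_bounds)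
  show "eventually (\<lambda>x. \<psi> x / (1 - q (1 / x)) \<le> 1 + \<psi> x) at_top"
    using eventually_gt_at_top[of 0] by eventually_elim (rule one_minus_q_bounds)
  have "((\<lambda>x. 1 + \<psi> x) \<longlongrightarrow> 1 + 0) at_top" by (intro tendsto_intros \<psi>_tendsto_0)
  then show "((\<lambda>x. 1 + \<psi> x) \<longlongrightarrow> 1) at_top" by simp
qed simp

lemma M_scaled_le:
  assumes x: "0 < x" and c: "0 < c"
  shows "\<psi> x ^ Suc m * M m (c * x) \<le> exp 1 * fact (Suc m) * (max 1 c + \<psi> x) ^ Suc m"
proof -
  have cx: "0 < c * x" using assms by simp
  have pos: "0 < 1 - q (1 / (c * x))" using one_minus_q_pos[of "1 / (c * x)"] cx by simp
  have "\<psi> x / (1 - q (1 / (c * x))) = \<psi> x / \<psi> (c * x) * (\<psi> (c * x) / (1 - q (1 / (c * x))))"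
    using \<psi>_pos[OF cx] by simp
  also have "\<dots> \<le> \<psi> x / \<psi> (c * x) * (1 + \<psi> (c * x))"
    using one_minus_q_bounds(2)[OF cx] \<psi>_nonneg by (intro mult_left_mono) auto
  also have "\<dots> = \<psi> x / \<psi> (c * x) + \<psi> x" using \<psi>_pos[OF cx] by (simp add: field_simps)
  also have "\<dots> \<le> max 1 c + \<psi> x" using \<psi>_ratio_le[OF x c] by simp
  finally have le: "\<psi> x / (1 - q (1 / (c * x))) \<le> max 1 c + \<psi> x" .
  have "\<psi> x ^ Suc m * M m (c * x) \<le> \<psi> x ^ Suc m * (exp 1 * fact (Suc m) / (1 - q (1 / (c * x))) ^ Suc m)"
    by (intro mult_left_mono M_le cx) (simp add: \<psi>_nonneg)
  also have "\<dots> = exp 1 * fact (Suc m) * (\<psi> x / (1 - q (1 / (c * x)))) ^ Suc m"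
    by (simp add: power_divide del: fact_Suc power_Suc)
  also have "\<dots> \<le> exp 1 * fact (Suc m) * (max 1 c + \<psi> x) ^ Suc m"
    using le pos \<psi>_nonneg[of x] by (intro mult_left_mono power_mono) auto
  finally show ?thesis .
qed

definition clock_moment :: "nat \<Rightarrow> real \<Rightarrow> real" where
  "clock_moment m y = expectation (\<lambda>\<omega>. (\<psi> y * A (exp y) \<omega>) ^ Suc m)"

text \<open>For \<open>t = exp y\<close> the level \<open>y / \<alpha>\<close> is the one at which
  \<open>t * exp (- (\<alpha> * x))\<close> equals \<open>1\<close>.\<close>

definition renewal_moment :: "nat \<Rightarrow> real \<Rightarrow> real" where
  "renewal_moment m y = \<psi> y ^ Suc m * M m (y / \<alpha>)"

text \<open>The bound of \<open>M_scaled_le\<close> at \<open>c = 1 / \<alpha>\<close>, with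
  \<open>\<psi> y\<close> replaced by \<open>1\<close>.\<close>

definition moment_bound :: "nat \<Rightarrow> real" where
  "moment_bound m = exp 1 * fact (Suc m) * (max 1 (1 / \<alpha>) + 1) ^ Suc m"

lemma \<psi>_eventually_le: "0 < e \<Longrightarrow> eventually (\<lambda>y. \<psi> y \<le> e) at_top"
proof -
  assume "0 < e"
  from order_tendstoD(2)[OF \<psi>_tendsto_0 this] show ?thesis by eventually_elim simp
qed

lemma renewal_moment_le: "eventually (\<lambda>y. renewal_moment m y \<le> moment_bound m) at_top"
  using \<psi>_eventually_le[of 1, simplified] eventually_gt_at_top[of 0]
proof eventually_elim
  case (elim y)
  have "renewal_moment m y \<le> exp 1 * fact (Suc m) * (max 1 (1 / \<alpha>) + \<psi> y) ^ Suc m"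
    using M_scaled_le[of y "1 / \<alpha>" m] \<alpha> elim by (simp add: renewal_moment_def del: fact_Suc power_Suc)
  also have "\<dots> \<le> moment_bound m"
    unfolding moment_bound_def using elim \<psi>_nonneg[of y] by (intro mult_left_mono power_mono) auto
  finally show ?case .
qed

lemma moment_bound_nonneg: "0 \<le> moment_bound m"
  by (simp add: moment_bound_def del: power_Suc fact_Suc)

lemma clock_moment_le:
  "eventually (\<lambda>y. clock_moment m y \<le> renewal_moment m y
      + \<psi> y * (real (Suc m) * 2 ^ Suc m * (1 + moment_bound m))) at_top"
  using \<psi>_eventually_le[of 1, simplified] eventually_gt_at_top[of 0] renewal_moment_le[of m]
proof eventually_elim
  case (elim y)
  have "clock_moment m y \<le> renewal_moment m y + \<psi> y * (real (Suc m) * 2 ^ Suc m) * (1 + renewal_moment m y)"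
    unfolding clock_moment_def renewal_moment_def
    by (rule A_moment_le) (use elim \<alpha> \<psi>_nonneg in \<open>auto simp flip: exp_add\<close>)
  also have "\<dots> \<le> renewal_moment m y + \<psi> y * (real (Suc m) * 2 ^ Suc m) * (1 + moment_bound m)"
    using elim \<psi>_nonneg[of y] by (intro add_left_mono mult_left_mono) auto
  finally show ?case by (simp add: mult.assoc)
qed

lemma clock_moment_bounded:
  "eventually (\<lambda>y. clock_moment m y \<le> moment_bound m + real (Suc m) * 2 ^ Suc m * (1 + moment_bound m)) at_top"
  using \<psi>_eventually_le[of 1, simplified] clock_moment_le[of m] renewal_moment_le[of m]
proof eventually_elim
  case (elim y)
  have "\<psi> y * (real (Suc m) * 2 ^ Suc m * (1 + moment_bound m)) \<le> 1 * (real (Suc m) * 2 ^ Suc m * (1 + moment_bound m))"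
    using elim moment_bound_nonneg[of m] by (intro mult_right_mono) auto
  then show ?case using elim by linarith
qed

lemma clock_moment_tendsto_iff:
  "(clock_moment m \<longlongrightarrow> K) at_top \<longleftrightarrow> (renewal_moment m \<longlongrightarrow> K) at_top"
proof (rule tendsto_iff_of_dilation_bounds[where n = "Suc m"])
  show "((\<lambda>y. \<psi> y * (real (Suc m) * 2 ^ Suc m * (1 + moment_bound m))) \<longlongrightarrow> 0) at_top"
    by (rule tendsto_mult_left_zero[OF \<psi>_tendsto_0])
  show "eventually (\<lambda>y. clock_moment m y \<le> renewal_moment m y
      + \<psi> y * (real (Suc m) * 2 ^ Suc m * (1 + moment_bound m))) at_top"
    by (rule clock_moment_le)
next
  fix e :: real assume e: "0 < e" "e < 1"
  define B where "B = moment_bound m + real (Suc m) * 2 ^ Suc m * (1 + moment_bound m)"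
  \<comment> \<open>The second summand pays for the cap. \<open>M (Suc m)\<close> comes with one
    factor \<open>\<psi> y\<close> too few, and by \<open>\<psi>_scale\<close> the missing factor
    costs at most \<open>y / \<psi> 1\<close>; this linear growth is beaten by the cap
    \<open>exp (e * y)\<close>.\<close>
  define v where "v y = \<psi> y * ((real m + 1) * (real (Suc m) * 2 ^ Suc m) * (1 + B))
      + moment_bound (Suc m) / \<psi> 1 / e * ((e * y) ^ 1 / exp (e * y))" for y
  have "filterlim (\<lambda>y. e * y) at_top at_top"
    by (rule filterlim_tendsto_pos_mult_at_top[OF tendsto_const]) (use e in \<open>auto intro: filterlim_ident\<close>)
  then have "((\<lambda>y. (e * y) ^ 1 / exp (e * y)) \<longlongrightarrow> 0) at_top"
    by (rule filterlim_compose[OF tendsto_power_div_exp_0])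
  then have "(v \<longlongrightarrow> 0 + moment_bound (Suc m) / \<psi> 1 / e * 0) at_top"
    unfolding v_def[abs_def] by (intro tendsto_intros tendsto_mult_left_zero[OF \<psi>_tendsto_0])
  then have v0: "(v \<longlongrightarrow> 0) at_top" by simp
  have "eventually (\<lambda>y. \<psi> y \<le> 1 / (real m + 1)) at_top"
    by (rule \<psi>_eventually_le) simp
  then have "eventually (\<lambda>y. (1 - e) ^ Suc m * renewal_moment m ((1 - e) * y) \<le> clock_moment m y + v y) at_top"
    using eventually_ge_at_top[of 1] renewal_moment_le[of "Suc m"] clock_moment_bounded[of m, folded B_def]
  proof eventually_elim
    case (elim y)
    define x where "x = (1 - e) * y / \<alpha>"
    have y: "1 \<le> y" "0 < (1 - e) * y" "(1 - e) * y \<le> y" using elim e by (auto simp: mult_left_le_one_le)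
    have \<psi>y: "0 < \<psi> y" "0 < \<psi> 1" using y \<psi>_pos by auto
    have "\<alpha> * x = (1 - e) * y" using \<alpha> by (simp add: x_def)
    then have T: "exp (e * y) = exp y * exp (- (\<alpha> * x))"
      by (simp add: algebra_simps flip: exp_add)
    have "(1 - e) ^ Suc m * renewal_moment m ((1 - e) * y) = ((1 - e) * \<psi> ((1 - e) * y)) ^ Suc m * M m x"
      by (simp add: renewal_moment_def x_def power_mult_distrib del: power_Suc)
    also have "\<dots> \<le> \<psi> y ^ Suc m * M m x"
    proof (intro mult_right_mono power_mono)
      show "(1 - e) * \<psi> ((1 - e) * y) \<le> \<psi> y"
        using \<psi>_scale[OF y(2,3)] y(1) by simp
    qed (use e \<psi>_nonneg in auto)
    also have "\<dots> \<le> clock_moment m y + \<psi> y * (real m + 1) * (real (Suc m) * 2 ^ Suc m) * (1 + clock_moment m y)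
        + \<psi> y ^ Suc m * M (Suc m) x / exp (e * y)"
      unfolding clock_moment_def
      by (rule M_le_A_moment) (use elim T \<psi>_nonneg in \<open>auto simp: field_simps\<close>)
    also have "\<psi> y * (real m + 1) * (real (Suc m) * 2 ^ Suc m) * (1 + clock_moment m y)
        \<le> \<psi> y * (real m + 1) * (real (Suc m) * 2 ^ Suc m) * (1 + B)"
      using elim \<psi>_nonneg[of y] by (intro mult_left_mono) auto
    also have "\<psi> y ^ Suc m * M (Suc m) x / exp (e * y) \<le> moment_bound (Suc m) / \<psi> 1 / e * ((e * y) ^ 1 / exp (e * y))"
    proof -
      have "\<psi> y * (\<psi> y ^ Suc m * M (Suc m) x) \<le> renewal_moment (Suc m) y"
        unfolding renewal_moment_def power_Suc[of "\<psi> y" "Suc m"] mult.assoc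
        using y \<alpha> \<psi>_nonneg by (intro mult_left_mono M_mono) (auto simp: x_def divide_right_mono)
      also have "\<dots> \<le> moment_bound (Suc m)" by (rule elim)
      finally have "\<psi> y ^ Suc m * M (Suc m) x \<le> moment_bound (Suc m) / \<psi> y"
        using \<psi>y by (simp add: pos_le_divide_eq mult.commute)
      also have "\<dots> \<le> moment_bound (Suc m) / (\<psi> 1 / y)"
        using \<psi>_scale[of 1 y] \<psi>y y moment_bound_nonneg by (intro divide_left_mono) auto
      finally have "\<psi> y ^ Suc m * M (Suc m) x \<le> moment_bound (Suc m) / \<psi> 1 / e * (e * y) ^ 1"
        using e by simp
      then show ?thesis by (simp only: times_divide_eq_right[symmetric]) (simp add: divide_right_mono)
    qed
    finally show ?case by (simp add: v_def algebra_simps)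
  qed
  with v0 show "\<exists>v. (v \<longlongrightarrow> 0) at_top \<and>
      eventually (\<lambda>y. (1 - e) ^ Suc m * renewal_moment m ((1 - e) * y) \<le> clock_moment m y + v y) at_top"
    by blast
qed

section \<open>Karamata's argument and its converse\<close>

lemma regularly_varying_iff_\<psi>:
  "regularly_varying_at_0 \<phi> \<beta> \<longleftrightarrow> (\<forall>c>0. ((\<lambda>x. \<psi> x / \<psi> (c * x)) \<longlongrightarrow> c powr \<beta>) at_top)"
proof (unfold regularly_varying_at_0_def, intro iffI allI impI)
  fix c :: real assume c: "0 < c" and rv: "\<forall>c>0. ((\<lambda>l. \<phi> (c * l) / \<phi> l) \<longlongrightarrow> c powr \<beta>) (at_right 0)"
  have "filterlim (\<lambda>x. c * x) at_top at_top"
    by (rule filterlim_tendsto_pos_mult_at_top[OF tendsto_const]) (use c in \<open>auto intro: filterlim_ident\<close>)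
  then have "filterlim (\<lambda>x. inverse (c * x)) (at_right 0) at_top"
    by (rule filterlim_compose[OF filterlim_inverse_at_right_top])
  from filterlim_compose[OF rv[rule_format, OF c] this]
  show "((\<lambda>x. \<psi> x / \<psi> (c * x)) \<longlongrightarrow> c powr \<beta>) at_top"
    using c by (simp add: \<psi>_def divide_inverse mult.assoc[symmetric])
next
  fix c :: real assume c: "0 < c" and rv: "\<forall>c>0. ((\<lambda>x. \<psi> x / \<psi> (c * x)) \<longlongrightarrow> c powr \<beta>) at_top"
  have "filterlim (\<lambda>l. 1 / c * inverse l) at_top (at_right 0)"
    by (rule filterlim_tendsto_pos_mult_at_top[OF tendsto_const])
       (use c in \<open>auto intro: filterlim_inverse_at_top_right\<close>)
  from filterlim_compose[OF rv[rule_format, OF c] this]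
  show "((\<lambda>l. \<phi> (c * l) / \<phi> l) \<longlongrightarrow> c powr \<beta>) (at_right 0)"
    using c by (simp add: \<psi>_def divide_inverse mult.assoc[symmetric])
qed

text \<open>The quotient splits at \<open>\<psi> (x / c)\<close>: regular variation handles the
  first factor, and the second is \<open>one_minus_q_asymp\<close> along
  \<open>x / c\<close>.\<close>

lemma Laplace_ratio_tendsto:
  assumes rv: "regularly_varying_at_0 \<phi> \<beta>" and c: "0 < c"
  shows "((\<lambda>x. \<psi> x / (1 - q (c / x))) \<longlongrightarrow> (1 / c) powr \<beta>) at_top"
proof -
  have "filterlim (\<lambda>x. 1 / c * x) at_top at_top"
    by (rule filterlim_tendsto_pos_mult_at_top[OF tendsto_const]) (use c in \<open>auto intro: filterlim_ident\<close>)
  from filterlim_compose[OF one_minus_q_asymp this]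
  have "((\<lambda>x. \<psi> (1 / c * x) / (1 - q (1 / (1 / c * x)))) \<longlongrightarrow> 1) at_top" .
  moreover have "((\<lambda>x. \<psi> x / \<psi> (1 / c * x)) \<longlongrightarrow> (1 / c) powr \<beta>) at_top"
    by (rule rv[unfolded regularly_varying_iff_\<psi>, rule_format]) (use c in simp)
  ultimately have "((\<lambda>x. \<psi> x / \<psi> (1 / c * x) * (\<psi> (1 / c * x) / (1 - q (1 / (1 / c * x))))) \<longlongrightarrow> (1 / c) powr \<beta> * 1) at_top"
    by (intro tendsto_mult)
  then have "((\<lambda>x. \<psi> x / \<psi> (1 / c * x) * (\<psi> (1 / c * x) / (1 - q (1 / (1 / c * x))))) \<longlongrightarrow> (1 / c) powr \<beta>) at_top"
    by simp
  then show ?thesis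
  proof (rule Lim_transform_eventually)
    show "eventually (\<lambda>x. \<psi> x / \<psi> (1 / c * x) * (\<psi> (1 / c * x) / (1 - q (1 / (1 / c * x)))) = \<psi> x / (1 - q (c / x))) at_top"
      using eventually_gt_at_top[of 0]
    proof eventually_elim
      case (elim x)
      then have "\<psi> (1 / c * x) \<noteq> 0" using \<psi>_pos[of "1 / c * x"] c by simp
      then show ?case by simp
    qed
  qed
qed

lemma filterlim_max_1: "filterlim (\<lambda>x::real. max 1 x) at_top at_top"
  by (rule filterlim_at_top_mono[OF filterlim_ident]) (simp add: eventually_at_top_linorder)

text \<open>\<open>f x\<close> collects the normalised counts at all levels \<open>u * x\<close>.
  Its Laplace transforms in \<open>u\<close> are explicit and converge to those of a multiple of
  \<open>u powr (n * \<beta>)\<close>; monotonicity in \<open>u\<close> gives pointwise convergence,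
  which is used at \<open>u = 1 / \<alpha>\<close>.\<close>

lemma renewal_moment_tendsto:
  assumes rv: "regularly_varying_at_0 \<phi> \<beta>" and \<beta>: "0 \<le> \<beta>"
  shows "(renewal_moment m \<longlongrightarrow> \<alpha> powr (- \<beta> * real (Suc m)) * fact (Suc m) / Gamma (1 + real (Suc m) * \<beta>)) at_top"
proof -
  define n where "n = Suc m"
  define G where "G = Gamma (1 + real n * \<beta>)"
  have G: "0 < G" using \<beta> by (simp add: G_def Gamma_real_pos add_pos_nonneg)
  have nb: "0 \<le> real n * \<beta>" using \<beta> by simp
  \<comment> \<open>\<open>max 1 x\<close> keeps the argument of \<psi> positive for every
    \<open>x\<close>, since integrability and monotonicity are required of the whole family and not
    only eventually.\<close>
  define f where "f x u = \<psi> (max 1 x) ^ n * M m (u * max 1 x)" for x u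
  define f' where "f' u = fact n / G * u powr (real n * \<beta>)" for u :: real
  have f_int: "has_bochner_integral exp_law (\<lambda>u. exp (- (real k * u)) * f x u)
      (\<psi> (max 1 x) ^ n * (fact n / (1 + real k) / (1 - q ((1 + real k) / max 1 x)) ^ n))" for x k
  proof -
    have "has_bochner_integral exp_law (\<lambda>u. \<psi> (max 1 x) ^ n * (exp (- (real k * u)) * M m (u * max 1 x)))
        (\<psi> (max 1 x) ^ n * (fact (Suc m) / (1 + real k) / (1 - q ((1 + real k) / max 1 x)) ^ Suc m))"
      by (intro has_bochner_integral_mult_right M_Laplace) auto
    then show ?thesis by (simp add: f_def n_def mult.left_commute del: fact_Suc power_Suc)
  qed
  have f'_int: "has_bochner_integral exp_law (\<lambda>u. exp (- (real k * u)) * f' u)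
      (fact n / G * (G / (1 + real k) powr (1 + real n * \<beta>)))" for k
  proof -
    have "has_bochner_integral exp_law (\<lambda>u. fact n / G * (exp (- (real k * u)) * u powr (real n * \<beta>)))
        (fact n / G * (Gamma (1 + real n * \<beta>) / (1 + real k) powr (1 + real n * \<beta>)))"
      by (intro has_bochner_integral_mult_right has_bochner_integral_exp_law_powr nb) auto
    then show ?thesis by (simp add: f'_def G_def mult.left_commute)
  qed
  have "((\<lambda>x. f x (1 / \<alpha>)) \<longlongrightarrow> f' (1 / \<alpha>)) at_top"
  proof (rule mono_tendsto_of_Laplace_transforms[where m = f and m' = f'])
    show "integrable exp_law (f x)" for x using f_int[of 0 x] by (simp add: has_bochner_integral_iff)
    show "integrable exp_law f'" using f'_int[of 0] by (simp add: has_bochner_integral_iff)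
    show "mono_on {0..} (f x)" for x
      by (auto simp: mono_on_def f_def \<psi>_nonneg intro!: mult_left_mono M_mono mult_right_mono)
    show "mono_on {0..} f'"
      using nb G by (auto simp: mono_on_def f'_def intro!: divide_right_mono mult_left_mono powr_mono2)
    show "0 \<le> f x u" for x u by (simp add: f_def \<psi>_nonneg)
    show "0 \<le> f' u" for u using G by (simp add: f'_def)
    show "0 < 1 / \<alpha>" using \<alpha> by simp
    show "isCont f' (1 / \<alpha>)" unfolding f'_def using \<alpha> by (intro continuous_intros) auto
    fix k :: nat
    have "((\<lambda>x. \<psi> (max 1 x) / (1 - q ((1 + real k) / max 1 x))) \<longlongrightarrow> (1 / (1 + real k)) powr \<beta>) at_top"
      by (rule filterlim_compose[OF Laplace_ratio_tendsto[OF rv] filterlim_max_1]) simp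
    then have "((\<lambda>x. fact n / (1 + real k) * (\<psi> (max 1 x) / (1 - q ((1 + real k) / max 1 x))) ^ n)
        \<longlongrightarrow> fact n / (1 + real k) * ((1 / (1 + real k)) powr \<beta>) ^ n) at_top"
      by (intro tendsto_intros)
    moreover have "fact n / (1 + real k) * ((1 / (1 + real k)) powr \<beta>) ^ n
        = fact n / G * (G / (1 + real k) powr (1 + real n * \<beta>))"
    proof -
      have "((1 / (1 + real k)) powr \<beta>) ^ n = 1 / (1 + real k) powr (real n * \<beta>)"
        by (simp add: powr_power powr_divide power_divide mult.commute)
      then show ?thesis using G by (simp add: powr_add)
    qed
    ultimately show "((\<lambda>x. \<integral>u. exp (- (real k * u)) * f x u \<partial>exp_law) \<longlongrightarrow>
        (\<integral>u. exp (- (real k * u)) * f' u \<partial>exp_law)) at_top"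
      using has_bochner_integral_integral_eq[OF f_int] has_bochner_integral_integral_eq[OF f'_int]
      by (simp add: power_divide mult.commute)
  qed
  then have "(renewal_moment m \<longlongrightarrow> f' (1 / \<alpha>)) at_top"
  proof (rule Lim_transform_eventually)
    show "eventually (\<lambda>x. f x (1 / \<alpha>) = renewal_moment m x) at_top"
      using eventually_ge_at_top[of 1] by eventually_elim (simp add: f_def renewal_moment_def n_def del: power_Suc)
  qed
  also have "f' (1 / \<alpha>) = \<alpha> powr (- \<beta> * real n) * fact n / G"
    using \<alpha> by (simp add: f'_def powr_divide powr_minus_divide mult.commute)
  finally show ?thesis by (simp only: n_def G_def)
qed

text \<open>Whatever \<phi> is, the exponential average of \<open>g\<close> tends to
  \<open>fact n\<close>. But \<open>g\<close> is \<open>f ^ n\<close> times a renewal moment at a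
  point tending to infinity, hence close to \<open>K m * f ^ n\<close>. So the moments of the ratio
  \<open>f\<close> tend to \<open>fact n / K m\<close>, which are those of
  \<open>(\<alpha> * u) powr \<beta>\<close>, and both functions are monotone in
  \<open>u\<close>.\<close>

lemma regularly_varying_of_renewal_moments:
  assumes \<beta>: "0 \<le> \<beta>" "\<beta> \<le> 1"
    and conv: "\<And>m. (renewal_moment m \<longlongrightarrow> \<alpha> powr (- \<beta> * real (Suc m)) * fact (Suc m) / Gamma (1 + real (Suc m) * \<beta>)) at_top"
  shows "regularly_varying_at_0 \<phi> \<beta>"
proof -
  define K where "K m = \<alpha> powr (- \<beta> * real (Suc m)) * fact (Suc m) / Gamma (1 + real (Suc m) * \<beta>)" for m
  define f where "f x u = \<psi> (max 1 x) / \<psi> (\<alpha> * u * max 1 x)" for x u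
  define f' where "f' u = (\<alpha> * u) powr \<beta>" for u
  have G: "0 < Gamma (1 + real n * \<beta>)" for n using \<beta> by (simp add: Gamma_real_pos add_pos_nonneg)
  have Kpos: "0 < K m" for m using G[of "Suc m"] \<alpha> by (simp add: K_def del: of_nat_Suc)
  have [measurable]: "f x \<in> borel_measurable borel" "f' \<in> borel_measurable borel" for x
    unfolding f_def f'_def by measurable
  have f_nonneg: "0 \<le> f x u" for x u by (simp add: f_def \<psi>_nonneg)
  have f_le: "f x u \<le> 1 + \<alpha> * u" if "0 < u" for x u
    unfolding f_def by (rule order_trans[OF \<psi>_ratio_le]) (use that \<alpha> in auto)
  have f_int: "integrable exp_law (\<lambda>u. f x u ^ n)" for x n
  proof (rule Bochner_Integration.integrable_bound[OF integrable_exp_law_affine_power[of 1 \<alpha> n]])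
    show "AE u in exp_law. norm (f x u ^ n) \<le> norm ((1 + \<alpha> * u) ^ n)"
      using AE_exp_law_pos
    proof eventually_elim
      case (elim u)
      then have "f x u ^ n \<le> (1 + \<alpha> * u) ^ n" by (intro power_mono f_le f_nonneg)
      then show ?case using f_nonneg[of x u] elim \<alpha> by simp
    qed
  qed simp
  have f'_pow: "AE u in exp_law. f' u ^ n = \<alpha> powr (\<beta> * real n) * u powr (real n * \<beta>)" for n
    using AE_exp_law_pos
    by eventually_elim (use \<alpha> in \<open>simp add: f'_def powr_mult powr_power power_mult_distrib mult.commute\<close>)
  have f'_int: "integrable exp_law (\<lambda>u. f' u ^ n)" for n
  proof -
    have "integrable exp_law (\<lambda>u. f' u ^ n) \<longleftrightarrow> integrable exp_law (\<lambda>u. \<alpha> powr (\<beta> * real n) * u powr (real n * \<beta>))"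
      using f'_pow by (intro integrable_cong_AE) auto
    then show ?thesis using integrable_exp_law_powr[of "real n * \<beta>"] \<beta> by simp
  qed
  have f'_integral: "(\<integral>u. f' u ^ n \<partial>exp_law) = \<alpha> powr (\<beta> * real n) * Gamma (1 + real n * \<beta>)" for n
  proof -
    have "(\<integral>u. f' u ^ n \<partial>exp_law) = (\<integral>u. \<alpha> powr (\<beta> * real n) * u powr (real n * \<beta>) \<partial>exp_law)"
      using f'_pow by (intro integral_cong_AE) auto
    then show ?thesis using \<beta> by (simp add: integral_exp_law_powr)
  qed
  have moments: "((\<lambda>x. \<integral>u. f x u ^ n \<partial>exp_law) \<longlongrightarrow> (\<integral>u. f' u ^ n \<partial>exp_law)) at_top" for n
  proof (cases n)
    case 0
    then show ?thesis by (simp add: exp_law.prob_space)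
  next
    case (Suc m)
    define g where "g x u = \<psi> (max 1 x) ^ n * M m (u * max 1 x)" for x u
    have g_hbi: "has_bochner_integral exp_law (g x) (fact n * (\<psi> (max 1 x) / (1 - q (1 / max 1 x))) ^ n)" for x
    proof -
      have "has_bochner_integral exp_law (\<lambda>u. \<psi> (max 1 x) ^ n * (exp (- (0 * u)) * M m (u * max 1 x)))
          (\<psi> (max 1 x) ^ n * (fact (Suc m) / (1 + 0) / (1 - q ((1 + 0) / max 1 x)) ^ Suc m))"
        by (intro has_bochner_integral_mult_right M_Laplace) auto
      then show ?thesis by (simp add: g_def[abs_def] Suc power_divide mult.commute del: fact_Suc power_Suc)
    qed
    have [measurable]: "g x \<in> borel_measurable borel" for x unfolding g_def by measurable
    have g_eq: "g x u = f x u ^ n * renewal_moment m (\<alpha> * u * max 1 x)" if "0 < u" for x u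
      using \<psi>_pos[of "\<alpha> * u * max 1 x"] \<alpha> that
      by (simp add: g_def f_def renewal_moment_def Suc power_divide del: power_Suc)
    have g_le: "g x u \<le> exp 1 * fact (Suc m) * (1 + \<psi> 1 + 1 * u) ^ n" if "0 < u" for x u
    proof -
      have "g x u \<le> exp 1 * fact (Suc m) * (max 1 u + \<psi> (max 1 x)) ^ n"
        using M_scaled_le[of "max 1 x" u m] that by (simp add: g_def Suc del: fact_Suc power_Suc)
      also have "\<dots> \<le> exp 1 * fact (Suc m) * (1 + \<psi> 1 + 1 * u) ^ n"
        using \<psi>_antimono[of 1 "max 1 x"] that \<psi>_nonneg[of "max 1 x"] \<psi>_nonneg[of 1]
        by (intro mult_left_mono power_mono) (auto simp: max_def)
      finally show ?thesis .
    qed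
    \<comment> \<open>The hypothesis applies at each fixed \<open>u > 0\<close>; the polynomial
      bounds \<open>f_le\<close> and \<open>g_le\<close> carry the limit under the exponential
      integral.\<close>
    have "((\<lambda>x. \<integral>u. g x u - f x u ^ n * K m \<partial>exp_law) \<longlongrightarrow> (\<integral>u. 0 \<partial>exp_law)) at_top"
    proof (rule integral_dominated_convergence_at_top[where
          w = "\<lambda>u. exp 1 * fact (Suc m) * (1 + \<psi> 1 + 1 * u) ^ n + K m * (1 + \<alpha> * u) ^ n"])
      show "integrable exp_law (\<lambda>u. exp 1 * fact (Suc m) * (1 + \<psi> 1 + 1 * u) ^ n + K m * (1 + \<alpha> * u) ^ n)"
        by (intro Bochner_Integration.integrable_add integrable_mult_right integrable_exp_law_affine_power)
      show "\<forall>\<^sub>F x in at_top. AE u in exp_law. norm (g x u - f x u ^ n * K m)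
          \<le> exp 1 * fact (Suc m) * (1 + \<psi> 1 + 1 * u) ^ n + K m * (1 + \<alpha> * u) ^ n"
      proof (rule always_eventually, rule allI)
        fix x
        show "AE u in exp_law. norm (g x u - f x u ^ n * K m)
          \<le> exp 1 * fact (Suc m) * (1 + \<psi> 1 + 1 * u) ^ n + K m * (1 + \<alpha> * u) ^ n"
          using AE_exp_law_pos
        proof eventually_elim
          case (elim u)
          have 1: "0 \<le> g x u" by (simp add: g_def \<psi>_nonneg)
          have "f x u ^ n \<le> (1 + \<alpha> * u) ^ n" using elim by (intro power_mono f_le f_nonneg)
          then have 2: "f x u ^ n * K m \<le> K m * (1 + \<alpha> * u) ^ n" using Kpos[of m] by (simp add: mult.commute)
          have 3: "0 \<le> f x u ^ n * K m" using Kpos[of m] f_nonneg by simp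
          show ?case using 1 2 3 g_le[OF elim, of x] unfolding real_norm_def by linarith
        qed
      qed
      show "AE u in exp_law. ((\<lambda>x. g x u - f x u ^ n * K m) \<longlongrightarrow> 0) at_top"
        using AE_exp_law_pos
      proof eventually_elim
        case (elim u)
        have "filterlim (\<lambda>x. \<alpha> * u * max 1 x) at_top at_top"
          by (rule filterlim_tendsto_pos_mult_at_top[OF tendsto_const _ filterlim_max_1]) (use \<alpha> elim in simp)
        then have "((\<lambda>x. renewal_moment m (\<alpha> * u * max 1 x) - K m) \<longlongrightarrow> K m - K m) at_top"
          by (intro tendsto_intros filterlim_compose[OF conv[of m, folded K_def]])
        then have "((\<lambda>x. (renewal_moment m (\<alpha> * u * max 1 x) - K m) * (1 + \<alpha> * u) ^ n) \<longlongrightarrow> 0) at_top"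
          by (intro tendsto_mult_left_zero) simp
        from tendsto_norm_zero[OF this] show ?case
        proof (rule Lim_null_comparison[rotated])
          show "\<forall>\<^sub>F x in at_top. norm (g x u - f x u ^ n * K m)
              \<le> norm ((renewal_moment m (\<alpha> * u * max 1 x) - K m) * (1 + \<alpha> * u) ^ n)"
          proof (rule always_eventually, rule allI)
            fix x
            have "g x u - f x u ^ n * K m = (renewal_moment m (\<alpha> * u * max 1 x) - K m) * f x u ^ n"
              by (simp add: g_eq[OF elim] algebra_simps)
            moreover have "\<bar>f x u ^ n\<bar> \<le> \<bar>(1 + \<alpha> * u) ^ n\<bar>"
              using power_mono[OF f_le[OF elim, of x] f_nonneg, of n] f_nonneg[of x u] elim \<alpha>
              by (simp add: power_abs)
            ultimately show "norm (g x u - f x u ^ n * K m)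
              \<le> norm ((renewal_moment m (\<alpha> * u * max 1 x) - K m) * (1 + \<alpha> * u) ^ n)"
              by (simp add: abs_mult mult_left_mono)
          qed
        qed
      qed
    qed auto
    moreover have "(\<integral>u. g x u - f x u ^ n * K m \<partial>exp_law)
        = fact n * (\<psi> (max 1 x) / (1 - q (1 / max 1 x))) ^ n - (\<integral>u. f x u ^ n \<partial>exp_law) * K m" for x
      using g_hbi[of x] f_int[of x n] by (simp add: has_bochner_integral_iff)
    ultimately have 1: "((\<lambda>x. fact n * (\<psi> (max 1 x) / (1 - q (1 / max 1 x))) ^ n - (\<integral>u. f x u ^ n \<partial>exp_law) * K m) \<longlongrightarrow> 0) at_top"
      by simp
    have 2: "((\<lambda>x. fact n * (\<psi> (max 1 x) / (1 - q (1 / max 1 x))) ^ n) \<longlongrightarrow> fact n * 1 ^ n) at_top"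
      by (intro tendsto_intros filterlim_compose[OF one_minus_q_asymp filterlim_max_1])
    have "((\<lambda>x. (\<integral>u. f x u ^ n \<partial>exp_law) * K m / K m) \<longlongrightarrow> (fact n * 1 ^ n - 0) / K m) at_top"
      using tendsto_divide[OF tendsto_diff[OF 2 1] tendsto_const[of "K m"]] Kpos[of m] by simp
    then have "((\<lambda>x. \<integral>u. f x u ^ n \<partial>exp_law) \<longlongrightarrow> fact n / K m) at_top"
      using Kpos[of m] by simp
    also have "fact n / K m = \<alpha> powr (\<beta> * real n) * Gamma (1 + real n * \<beta>)"
      using \<alpha> by (simp add: K_def Suc powr_minus divide_inverse del: fact_Suc of_nat_Suc)
    finally show ?thesis by (simp add: f'_integral)
  qed
  have f_conv: "((\<lambda>x. f x u) \<longlongrightarrow> f' u) at_top" if u: "0 < u" for u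
  \<comment> \<open>\<open>\<rho>\<close> is read off \<open>f'_integral\<close>, and
    \<open>C = 2\<close> is the constant of \<open>Gamma_le_fact\<close>.\<close>
  proof (rule mono_tendsto_of_moments[where \<rho> = "\<alpha> powr \<beta>" and C = 2, OF _ _ _ _ _ _ _ f'_int moments])
    show "mono_on {0<..} (f x)" for x
      using \<alpha> by (auto simp: mono_on_def f_def intro!: divide_left_mono \<psi>_antimono \<psi>_nonneg mult_pos_pos \<psi>_pos mult_right_mono)
    show "mono_on {0<..} f'"
      using \<alpha> \<beta> by (auto simp: mono_on_def f'_def intro!: powr_mono2)
    show "isCont f' u" unfolding f'_def using \<alpha> u by (intro continuous_intros) auto
    show "(\<integral>u. f' u ^ k \<partial>exp_law) \<le> 2 * (\<alpha> powr \<beta>) ^ k * fact k" for k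
      using Gamma_le_fact[OF \<beta>, of k] \<alpha>
      by (simp add: f'_integral powr_power mult.commute mult.left_commute mult_left_mono)
  qed (use f_int f_nonneg u in \<open>auto simp: f'_def\<close>)
  show ?thesis
    unfolding regularly_varying_iff_\<psi>
  proof (intro allI impI)
    fix c :: real assume c: "0 < c"
    have "((\<lambda>x. f x (c / \<alpha>)) \<longlongrightarrow> f' (c / \<alpha>)) at_top" by (rule f_conv) (use c \<alpha> in simp)
    then have "((\<lambda>x. \<psi> x / \<psi> (c * x)) \<longlongrightarrow> f' (c / \<alpha>)) at_top"
    proof (rule Lim_transform_eventually)
      show "eventually (\<lambda>x. f x (c / \<alpha>) = \<psi> x / \<psi> (c * x)) at_top"
        using eventually_ge_at_top[of 1] by eventually_elim (use \<alpha> in \<open>simp add: f_def\<close>)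
    qed
    then show "((\<lambda>x. \<psi> x / \<psi> (c * x)) \<longlongrightarrow> c powr \<beta>) at_top" using \<alpha> by (simp add: f'_def)
  qed
qed

lemma regularly_varying_iff_clock_moments:
  assumes \<beta>: "0 \<le> \<beta>" "\<beta> \<le> 1"
  shows "regularly_varying_at_0 \<phi> \<beta> \<longleftrightarrow>
    (\<forall>m. (clock_moment m \<longlongrightarrow> \<alpha> powr (- \<beta> * real (Suc m)) * fact (Suc m) / Gamma (1 + real (Suc m) * \<beta>)) at_top)"
  unfolding clock_moment_tendsto_iff
  using renewal_moment_tendsto[OF _ \<beta>(1)] regularly_varying_of_renewal_moments[OF \<beta>] by blast

end

section \<open>From moments to the Mittag-Leffler limit\<close>

lemma mittag_leffler_law_scaled:
  assumes \<nu>: "real_distribution \<nu>" and nonneg: "AE x in \<nu>. 0 \<le> x" and s: "0 < s"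
    and int: "\<And>n. integrable \<nu> (\<lambda>x. x ^ n)"
    and moments: "\<And>n. (\<integral>x. x ^ n \<partial>\<nu>) = s ^ n * fact n / Gamma (1 + real n * \<beta>)"
  shows "mittag_leffler_law \<beta> (distr \<nu> borel (\<lambda>x. x / s))"
    and "distr (distr \<nu> borel (\<lambda>x. x / s)) borel (\<lambda>w. s * w) = \<nu>"
proof -
  interpret real_distribution \<nu> by fact
  have "distr (distr \<nu> borel (\<lambda>x. x / s)) borel (\<lambda>w. s * w) = distr \<nu> borel (\<lambda>x. x)"
    using s by (subst distr_distr) (auto simp: o_def)
  also have "\<dots> = \<nu>" by (rule distr_id2) simp
  finally show "distr (distr \<nu> borel (\<lambda>x. x / s)) borel (\<lambda>w. s * w) = \<nu>" .
  show "mittag_leffler_law \<beta> (distr \<nu> borel (\<lambda>x. x / s))"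
    unfolding mittag_leffler_law_def
  proof (intro conjI allI)
    show "prob_space (distr \<nu> borel (\<lambda>x. x / s))" by (rule prob_space_distr) simp
    show "AE w in distr \<nu> borel (\<lambda>x. x / s). 0 \<le> w"
    proof (subst AE_distr_iff)
      show "AE x in \<nu>. 0 \<le> x / s" using nonneg by eventually_elim (use s in simp)
    qed simp_all
    show "has_bochner_integral (distr \<nu> borel (\<lambda>x. x / s)) (\<lambda>w. w ^ n) (fact n / Gamma (1 + real n * \<beta>))" for n
      using int[of n] moments[of n] s
      by (simp add: has_bochner_integral_iff integrable_distr_eq integral_distr power_divide)
  qed simp
qed

lemma tendsto_at_top_exp_iff:
  fixes f :: "real \<Rightarrow> 'b::topological_space"
  shows "((\<lambda>y. f (exp y)) \<longlongrightarrow> L) at_top \<longleftrightarrow> (f \<longlongrightarrow> L) at_top"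
proof
  assume "((\<lambda>y. f (exp y)) \<longlongrightarrow> L) at_top"
  from filterlim_compose[OF this ln_at_top] have "((\<lambda>t. f (exp (ln t))) \<longlongrightarrow> L) at_top" .
  then show "(f \<longlongrightarrow> L) at_top"
  proof (rule Lim_transform_eventually)
    show "eventually (\<lambda>t. f (exp (ln t)) = f t) at_top"
      using eventually_gt_at_top[of 0] by eventually_elim simp
  qed
next
  assume "(f \<longlongrightarrow> L) at_top"
  then show "((\<lambda>y. f (exp y)) \<longlongrightarrow> L) at_top" by (rule filterlim_compose[OF _ exp_at_top])
qed

context lamperti_clock
begin

text \<open>\<open>q 1 = 1\<close> forces the nonnegative variable \<open>\<xi> 1\<close> to vanish
  almost surely, so its Laplace transform is constant.\<close>

lemma \<phi>_trivial:
  assumes "\<not> q 1 < 1"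
  shows "\<phi> l = 0"
proof -
  have "q 1 = 1" using assms q_le_1[of 1] by simp
  then have "expectation (\<lambda>\<omega>. 1 - exp (- (1 * \<xi> 1 \<omega>))) = 0"
    using exp_integrable[of 1 1] by (simp add: q_def prob_space)
  moreover have "AE \<omega> in \<Omega>. 0 \<le> 1 - exp (- (1 * \<xi> 1 \<omega>))" using exp_bound[of 1 1] by simp
  ultimately have AE: "AE \<omega> in \<Omega>. 1 - exp (- (1 * \<xi> 1 \<omega>)) = 0"
    using exp_integrable[of 1 1] by (subst (asm) integral_nonneg_eq_0_iff_AE) auto
  have "q l = expectation (\<lambda>\<omega>. 1)"
    unfolding q_def
  proof (rule integral_cong_AE)
    show "AE \<omega> in \<Omega>. exp (- (max 0 l * \<xi> 1 \<omega>)) = 1" using AE by eventually_elim auto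
  qed auto
  then show ?thesis by (simp add: \<phi>_def prob_space)
qed

definition limit_moment :: "real \<Rightarrow> nat \<Rightarrow> real" where
  "limit_moment \<beta> n = \<alpha> powr (- \<beta> * real n) * fact n / Gamma (1 + real n * \<beta>)"

lemma limit_moment_eq: "limit_moment \<beta> n = (\<alpha> powr - \<beta>) ^ n * fact n / Gamma (1 + real n * \<beta>)"
  using \<alpha> by (simp add: limit_moment_def powr_power mult.commute)

lemma limit_moment_le:
  assumes "0 \<le> \<beta>"
  shows "limit_moment \<beta> n \<le> exp 2 * (\<alpha> powr - \<beta>) ^ n * fact n"
proof -
  have "(\<alpha> powr - \<beta>) ^ n * fact n * (1 / Gamma (1 + real n * \<beta>)) \<le> (\<alpha> powr - \<beta>) ^ n * fact n * exp 2"
    using assms by (intro mult_left_mono inverse_Gamma_le) auto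
  then show ?thesis by (simp add: limit_moment_eq mult_ac)
qed

lemma scaled_clock_nonneg: "AE \<omega> in \<Omega>. 0 \<le> \<phi> (1 / ln t) * A t \<omega>"
  using A_nonneg[of t] by eventually_elim (simp add: \<phi>_nonneg)

text \<open>Existence of a Mittag-Leffler law is part of the claim: it is obtained as the limit law
  of the method of moments, divided by \<open>\<alpha> powr (- \<beta>)\<close>.\<close>

lemma convergence_in_distribution_of_moments:
  assumes \<beta>: "0 \<le> \<beta>"
    and conv: "\<And>n. ((\<lambda>t. expectation (\<lambda>\<omega>. (\<phi> (1 / ln t) * A t \<omega>) ^ n)) \<longlongrightarrow> limit_moment \<beta> n) at_top"
  shows "\<exists>W. mittag_leffler_law \<beta> W \<and> converges_in_distribution
      (\<lambda>t. distr \<Omega> borel (\<lambda>\<omega>. \<phi> (1 / ln t) * A t \<omega>)) (distr W borel (\<lambda>w. \<alpha> powr - \<beta> * w)) at_top"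
proof -
  obtain \<nu> where \<nu>: "real_distribution \<nu>" "AE x in \<nu>. 0 \<le> x" "\<And>n. integrable \<nu> (\<lambda>x. x ^ n)"
      "\<And>n. (\<integral>x. x ^ n \<partial>\<nu>) = limit_moment \<beta> n"
      "converges_in_distribution (\<lambda>t. distr \<Omega> borel (\<lambda>\<omega>. \<phi> (1 / ln t) * A t \<omega>)) \<nu> at_top"
  proof (rule converges_in_distribution_of_moments[OF prob_space_axioms _ scaled_clock_nonneg A_power_integrable conv
        limit_moment_le[OF \<beta>]])
  qed auto
  have "mittag_leffler_law \<beta> (distr \<nu> borel (\<lambda>x. x / \<alpha> powr - \<beta>))"
      "distr (distr \<nu> borel (\<lambda>x. x / \<alpha> powr - \<beta>)) borel (\<lambda>w. \<alpha> powr - \<beta> * w) = \<nu>"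
    using mittag_leffler_law_scaled[OF \<nu>(1,2) _ \<nu>(3), of "\<alpha> powr - \<beta>" \<beta>] \<nu>(4) \<alpha> by (auto simp: limit_moment_eq)
  with \<nu>(5) show ?thesis by metis
qed

text \<open>Bounds of every order hold before any regular variation is known; they supply the
  uniform integrability that lifts convergence in distribution to moments.\<close>

lemma scaled_clock_moment_bounded:
  "\<exists>B. eventually (\<lambda>t. expectation (\<lambda>\<omega>. (\<phi> (1 / ln t) * A t \<omega>) ^ n) \<le> B) at_top"
proof (cases "q 1 < 1")
  case False
  have "expectation (\<lambda>\<omega>. (\<phi> (1 / ln t) * A t \<omega>) ^ n) \<le> 1" for t
    using \<phi>_trivial[OF False] by (cases n) (auto simp: prob_space)
  then show ?thesis by (intro exI[of _ 1]) simp
next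
  case True
  interpret nontrivial_lamperti_clock \<Omega> \<xi> A \<alpha> by unfold_locales (rule True)
  show ?thesis
  proof (cases n)
    case 0
    then show ?thesis by (auto simp: prob_space)
  next
    case (Suc m)
    obtain B where "eventually (\<lambda>y. clock_moment m y \<le> B) at_top" using clock_moment_bounded by blast
    from eventually_compose_filterlim[OF this ln_at_top]
    have "eventually (\<lambda>t. expectation (\<lambda>\<omega>. (\<phi> (1 / ln t) * A t \<omega>) ^ n) \<le> B) at_top"
      using eventually_gt_at_top[of 0] by eventually_elim (simp add: clock_moment_def \<psi>_def Suc)
    then show ?thesis by blast
  qed
qed

lemma moments_of_convergence_in_distribution:
  assumes W: "mittag_leffler_law \<beta> W"
    and conv: "converges_in_distribution
      (\<lambda>t. distr \<Omega> borel (\<lambda>\<omega>. \<phi> (1 / ln t) * A t \<omega>)) (distr W borel (\<lambda>w. \<alpha> powr - \<beta> * w)) at_top"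
  shows "((\<lambda>t. expectation (\<lambda>\<omega>. (\<phi> (1 / ln t) * A t \<omega>) ^ n)) \<longlongrightarrow> limit_moment \<beta> n) at_top"
proof -
  interpret W: prob_space W using W by (simp add: mittag_leffler_law_def)
  have [measurable_cong]: "sets W = sets borel" using W by (simp add: mittag_leffler_law_def)
  have int: "has_bochner_integral W (\<lambda>w. w ^ n) (fact n / Gamma (1 + real n * \<beta>))"
    using W by (simp add: mittag_leffler_law_def)
  have eq: "(\<integral>x. x ^ n \<partial>distr W borel (\<lambda>w. \<alpha> powr - \<beta> * w)) = limit_moment \<beta> n"
    using int by (subst integral_distr) (auto simp: has_bochner_integral_iff power_mult_distrib limit_moment_eq)
  have "real_distribution (distr W borel (\<lambda>w. \<alpha> powr - \<beta> * w))"
    by (rule W.real_distribution_distr) simp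
  from moments_tendsto_of_converges_in_distribution[OF prob_space_axioms this _ scaled_clock_nonneg A_power_integrable
      scaled_clock_moment_bounded conv, of n]
  show ?thesis unfolding eq by simp
qed

lemma regularly_varying_iff_moments:
  assumes \<beta>: "0 \<le> \<beta>" "\<beta> \<le> 1"
  shows "regularly_varying_at_0 \<phi> \<beta> \<longleftrightarrow>
    (\<forall>n. ((\<lambda>t. expectation (\<lambda>\<omega>. (\<phi> (1 / ln t) * A t \<omega>) ^ n)) \<longlongrightarrow> limit_moment \<beta> n) at_top)"
proof (cases "q 1 < 1")
  case False
  note [simp] = \<phi>_trivial[OF False]
  have "\<not> regularly_varying_at_0 \<phi> \<beta>"
  proof
    assume "regularly_varying_at_0 \<phi> \<beta>"
    \<comment> \<open>At \<open>c = 1\<close> the quotient would have to tend to \<open>1\<close>,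
      but it is \<open>0 / 0\<close>, which has the value \<open>0\<close>.\<close>
    then have "((\<lambda>l. \<phi> (1 * l) / \<phi> l) \<longlongrightarrow> 1 powr \<beta>) (at_right 0)"
      unfolding regularly_varying_at_0_def by (rule allE[where x = 1]) simp
    then show False by (simp add: tendsto_const_iff)
  qed
  moreover have "\<not> ((\<lambda>t. expectation (\<lambda>\<omega>. (\<phi> (1 / ln t) * A t \<omega>) ^ 1)) \<longlongrightarrow> limit_moment \<beta> 1) at_top"
  proof -
    have "0 < limit_moment \<beta> 1" using \<alpha> \<beta> by (simp add: limit_moment_def Gamma_real_pos)
    then show ?thesis by (simp add: tendsto_const_iff)
  qed
  ultimately show ?thesis by blast
next
  case True
  interpret nontrivial_lamperti_clock \<Omega> \<xi> A \<alpha> by unfold_locales (rule True)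
  define Q where "Q n \<longleftrightarrow>
    ((\<lambda>t. expectation (\<lambda>\<omega>. (\<phi> (1 / ln t) * A t \<omega>) ^ n)) \<longlongrightarrow> limit_moment \<beta> n) at_top" for n
  have "clock_moment m = (\<lambda>y. expectation (\<lambda>\<omega>. (\<phi> (1 / ln (exp y)) * A (exp y) \<omega>) ^ Suc m))" for m
    by (simp add: clock_moment_def[abs_def] \<psi>_def)
  then have "(clock_moment m \<longlongrightarrow> limit_moment \<beta> (Suc m)) at_top \<longleftrightarrow>
      ((\<lambda>t. expectation (\<lambda>\<omega>. (\<phi> (1 / ln t) * A t \<omega>) ^ Suc m)) \<longlongrightarrow> limit_moment \<beta> (Suc m)) at_top" for m
    using tendsto_at_top_exp_iff[of "\<lambda>t. expectation (\<lambda>\<omega>. (\<phi> (1 / ln t) * A t \<omega>) ^ Suc m)" "limit_moment \<beta> (Suc m)"]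
    by (simp only:)
  then have "regularly_varying_at_0 \<phi> \<beta> \<longleftrightarrow> (\<forall>m. Q (Suc m))"
    unfolding regularly_varying_iff_clock_moments[OF \<beta>] Q_def by (simp only: limit_moment_def)
  moreover have "Q 0"
    using \<alpha> by (simp add: Q_def limit_moment_def prob_space)
  ultimately have "regularly_varying_at_0 \<phi> \<beta> \<longleftrightarrow> (\<forall>n. Q n)" by (metis nat.exhaust)
  then show ?thesis by (simp only: Q_def)
qed

theorem regularly_varying_iff:
  assumes \<beta>: "0 \<le> \<beta>" "\<beta> \<le> 1"
  shows "regularly_varying_at_0 \<phi> \<beta> \<longleftrightarrow>
      (\<exists>W. mittag_leffler_law \<beta> W \<and> converges_in_distribution
        (\<lambda>t. distr \<Omega> borel (\<lambda>\<omega>. \<phi> (1 / ln t) * A t \<omega>)) (distr W borel (\<lambda>w. \<alpha> powr - \<beta> * w)) at_top)"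
  unfolding regularly_varying_iff_moments[OF \<beta>]
  using convergence_in_distribution_of_moments[OF \<beta>(1)] moments_of_convergence_in_distribution by blast

end

section \<open>The clock of a path\<close>

definition clk :: "real \<Rightarrow> (real \<Rightarrow> real) \<Rightarrow> real \<Rightarrow> real" where
  "clk \<alpha> p t = (LINT s:{0..t}|lborel. p s powr (- \<alpha>))"

lemma clock_eq_clk: "clock \<alpha> X t \<omega> = clk \<alpha> (\<lambda>s. X s \<omega>) t"
  by (simp add: clock_def clk_def)

text \<open>Versions of the clock, of its total mass and of the path at the inverse clock that only involve
  countably many times, hence are measurable functionals for the product \<open>\<sigma>\<close>-algebra.\<close>

definition sampled_clk :: "real \<Rightarrow> (real \<Rightarrow> real) \<Rightarrow> real \<Rightarrow> ennreal" where
  "sampled_clk \<alpha> p t = (SUP n. ennreal (\<Sum>k<Suc n. t / real (Suc n) * p (real (Suc k) * t / real (Suc n)) powr (- \<alpha>)))"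

definition total_clk :: "real \<Rightarrow> (real \<Rightarrow> real) \<Rightarrow> ennreal" where
  "total_clk \<alpha> p = (SUP n::nat. sampled_clk \<alpha> p (real n))"

definition clk_value :: "real \<Rightarrow> real \<Rightarrow> (real \<Rightarrow> real) \<Rightarrow> ennreal" where
  "clk_value \<alpha> r p = (INF u\<in>{u\<in>\<rat>. 0 \<le> u}. if ennreal r < sampled_clk \<alpha> p u then ennreal (p u) else \<top>)"

lemma sampled_clk_cong: "0 \<le> t \<Longrightarrow> (\<And>s. 0 \<le> s \<Longrightarrow> p s = p' s) \<Longrightarrow> sampled_clk \<alpha> p t = sampled_clk \<alpha> p' t"
  by (simp add: sampled_clk_def)

lemma total_clk_cong: "(\<And>s. 0 \<le> s \<Longrightarrow> p s = p' s) \<Longrightarrow> total_clk \<alpha> p = total_clk \<alpha> p'"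
  by (simp add: total_clk_def cong: sampled_clk_cong)

lemma clk_value_cong: "(\<And>s. 0 \<le> s \<Longrightarrow> p s = p' s) \<Longrightarrow> clk_value \<alpha> r p = clk_value \<alpha> r p'"
  unfolding clk_value_def by (intro INF_cong) (auto cong: sampled_clk_cong)

lemma measurable_sampled_clk:
  assumes [measurable]: "\<And>s. 0 \<le> s \<Longrightarrow> s \<le> t \<Longrightarrow> Y s \<in> borel_measurable N" and t: "0 \<le> t"
  shows "(\<lambda>\<omega>. sampled_clk \<alpha> (\<lambda>s. Y s \<omega>) t) \<in> borel_measurable N"
  unfolding sampled_clk_def
proof (intro borel_measurable_SUP measurable_compose[OF _ measurable_ennreal] borel_measurable_sum)
  fix n k :: nat assume "k \<in> {..<Suc n}"
  then have "real (Suc k) * t / real (Suc n) \<le> t"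
    using t by (simp add: divide_le_eq mult.commute mult_left_mono)
  then have [measurable]: "Y (real (Suc k) * t / real (Suc n)) \<in> borel_measurable N"
    using t by (intro assms(1)) auto
  show "(\<lambda>\<omega>. t / real (Suc n) * Y (real (Suc k) * t / real (Suc n)) \<omega> powr (- \<alpha>)) \<in> borel_measurable N"
    by measurable
qed simp

lemma measurable_total_clk:
  assumes "\<And>s. 0 \<le> s \<Longrightarrow> Y s \<in> borel_measurable N"
  shows "(\<lambda>\<omega>. total_clk \<alpha> (\<lambda>s. Y s \<omega>)) \<in> borel_measurable N"
  unfolding total_clk_def by (intro borel_measurable_SUP measurable_sampled_clk assms) auto

lemma measurable_clk_value:
  assumes "\<And>s. 0 \<le> s \<Longrightarrow> Y s \<in> borel_measurable N"
  shows "(\<lambda>\<omega>. clk_value \<alpha> r (\<lambda>s. Y s \<omega>)) \<in> borel_measurable N"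
  unfolding clk_value_def
proof (intro borel_measurable_INF)
  show "countable {u \<in> \<rat>. 0 \<le> (u :: real)}" by (rule countable_subset[OF _ countable_rat]) auto
  fix u :: real assume "u \<in> {u \<in> \<rat>. 0 \<le> u}"
  then have [measurable]: "Y u \<in> borel_measurable N" "(\<lambda>\<omega>. sampled_clk \<alpha> (\<lambda>s. Y s \<omega>) u) \<in> borel_measurable N"
    by (auto intro!: measurable_sampled_clk assms)
  show "(\<lambda>\<omega>. if ennreal r < sampled_clk \<alpha> (\<lambda>s. Y s \<omega>) u then ennreal (Y u \<omega>) else \<top>) \<in> borel_measurable N"
    by measurable
qed

locale increasing_path =
  fixes p :: "real \<Rightarrow> real" and \<alpha> :: real
  assumes \<alpha>: "0 < \<alpha>"
    and pos: "\<And>t. 0 \<le> t \<Longrightarrow> 0 < p t"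
    and mono: "\<And>s t. 0 \<le> s \<Longrightarrow> s \<le> t \<Longrightarrow> p s \<le> p t"
    and right_cont: "\<And>t. 0 \<le> t \<Longrightarrow> continuous (at_right t) p"
begin

lemma rate_antimono: "0 \<le> s \<Longrightarrow> s \<le> t \<Longrightarrow> p t powr (- \<alpha>) \<le> p s powr (- \<alpha>)"
  using mono[of s t] pos[of s] \<alpha> by (intro powr_mono2') auto

lemma rate_set_integrable:
  assumes "0 \<le> a"
  shows "set_integrable lborel {a..b} (\<lambda>s. p s powr (- \<alpha>))"
proof -
  define S where "S = {a..b}"
  \<comment> \<open>Freezing the path at its initial value for negative times gives a monotone,
    hence Borel, function on the whole line.\<close>
  define g where "g s = p (max 0 s) powr (- \<alpha>)" for s
  have "(\<lambda>s. p (max 0 s)) \<in> borel_measurable borel"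
    by (rule borel_measurable_mono) (auto simp: mono_def intro!: mono)
  then have [measurable]: "g \<in> borel_measurable borel" unfolding g_def by measurable
  have "set_integrable lborel S g"
    unfolding set_integrable_def
  proof (rule Bochner_Integration.integrable_bound)
    show "integrable lborel (\<lambda>s. indicator S s *\<^sub>R p 0 powr (- \<alpha>))"
      unfolding S_def
      by (intro integrable_scaleR_left integrable_real_indicator emeasure_bounded_finite bounded_closed_interval) simp
    show "AE s in lborel. norm (indicator S s *\<^sub>R g s) \<le> norm (indicator S s *\<^sub>R p 0 powr (- \<alpha>))"
      using rate_antimono[of 0 "max 0 _"] by (auto simp: indicator_def g_def)
    show "(\<lambda>s. indicator S s *\<^sub>R g s) \<in> borel_measurable lborel" unfolding S_def by simp
  qed
  also have "set_integrable lborel S g \<longleftrightarrow> set_integrable lborel S (\<lambda>s. p s powr (- \<alpha>))"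
    using assms by (intro set_integrable_cong) (auto simp: S_def g_def max_def)
  finally show ?thesis unfolding S_def .
qed

lemma clk_diff:
  assumes a: "0 \<le> a" and ab: "a \<le> b"
  shows "clk \<alpha> p b - clk \<alpha> p a = (LINT s:{a..b}|lborel. p s powr (- \<alpha>))"
proof -
  have "{0..b} = {0..a} \<union> {a..b}" using a ab by auto
  moreover have "(LINT s:{0..a} \<union> {a..b}|lborel. p s powr (- \<alpha>))
      = (LINT s:{0..a}|lborel. p s powr (- \<alpha>)) + (LINT s:{a..b}|lborel. p s powr (- \<alpha>))"
  proof (rule set_integral_Un_AE)
    show "AE s in lborel. \<not> (s \<in> {0..a} \<and> s \<in> {a..b})"
      using AE_lborel_singleton[of a] by eventually_elim auto
  qed (use a in \<open>auto intro!: rate_set_integrable\<close>)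
  ultimately show ?thesis by (simp add: clk_def)
qed

lemma clk_increment:
  assumes a: "0 \<le> a" and ab: "a \<le> b"
  shows "(b - a) * p b powr (- \<alpha>) \<le> clk \<alpha> p b - clk \<alpha> p a"
    and "clk \<alpha> p b - clk \<alpha> p a \<le> (b - a) * p a powr (- \<alpha>)"
proof -
  note i = rate_set_integrable[OF a, of b]
  have c: "set_integrable lborel {a..b} (\<lambda>s. c)" "(LINT s:{a..b}|lborel. c) = (b - a) * c" for c :: real
    using ab by (auto simp: set_lebesgue_integral_def set_integrable_def intro!: integrable_scaleR_left integrable_real_indicator)
  have "(LINT s:{a..b}|lborel. p b powr (- \<alpha>)) \<le> (LINT s:{a..b}|lborel. p s powr (- \<alpha>))"
    by (rule set_integral_mono) (use a c i rate_antimono in auto)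
  then show "(b - a) * p b powr (- \<alpha>) \<le> clk \<alpha> p b - clk \<alpha> p a"
    by (simp add: c clk_diff[OF a ab])
  have "(LINT s:{a..b}|lborel. p s powr (- \<alpha>)) \<le> (LINT s:{a..b}|lborel. p a powr (- \<alpha>))"
    by (rule set_integral_mono) (use a c i rate_antimono in auto)
  then show "clk \<alpha> p b - clk \<alpha> p a \<le> (b - a) * p a powr (- \<alpha>)"
    by (simp add: c clk_diff[OF a ab])
qed

lemma clk_0 [simp]: "clk \<alpha> p 0 = 0"
proof -
  have "AE s in lborel. indicator {0..0} s *\<^sub>R p s powr (- \<alpha>) = 0"
    using AE_lborel_singleton[of "0 :: real"] by eventually_elim auto
  then show ?thesis unfolding clk_def set_lebesgue_integral_def by (rule integral_eq_zero_AE)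
qed

lemma clk_strict_mono: "0 \<le> a \<Longrightarrow> a < b \<Longrightarrow> clk \<alpha> p a < clk \<alpha> p b"
  using clk_increment(1)[of a b] pos[of b] by (smt (verit) mult_pos_pos powr_gt_zero)

lemma clk_less_iff: "0 \<le> a \<Longrightarrow> 0 \<le> b \<Longrightarrow> clk \<alpha> p a < clk \<alpha> p b \<longleftrightarrow> a < b"
  using clk_strict_mono[of a b] clk_strict_mono[of b a] by (cases a b rule: linorder_cases) auto

lemma clk_le_iff: "0 \<le> a \<Longrightarrow> 0 \<le> b \<Longrightarrow> clk \<alpha> p a \<le> clk \<alpha> p b \<longleftrightarrow> a \<le> b"
  using clk_less_iff[of b a] by (simp flip: not_less)

lemma clk_nonneg: "0 \<le> t \<Longrightarrow> 0 \<le> clk \<alpha> p t"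
  using clk_le_iff[of 0 t] by simp

lemma clk_le: "0 \<le> t \<Longrightarrow> clk \<alpha> p t \<le> t * p 0 powr (- \<alpha>)"
  using clk_increment(2)[of 0 t] by simp

lemma clk_ge: "0 \<le> t \<Longrightarrow> t * p t powr (- \<alpha>) \<le> clk \<alpha> p t"
  using clk_increment(1)[of 0 t] by simp

lemma continuous_on_clk: "continuous_on {0..} (clk \<alpha> p)"
proof -
  have le: "\<bar>clk \<alpha> p b - clk \<alpha> p a\<bar> \<le> p 0 powr (- \<alpha>) * \<bar>b - a\<bar>" if "0 \<le> a" "a \<le> b" for a b
  proof -
    have "clk \<alpha> p b - clk \<alpha> p a \<le> (b - a) * p a powr (- \<alpha>)" using clk_increment(2)[OF that] .
    also have "\<dots> \<le> (b - a) * p 0 powr (- \<alpha>)" using that rate_antimono[of 0 a] by (intro mult_left_mono) auto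
    finally show ?thesis using that clk_le_iff[of a b] by (simp add: mult.commute)
  qed
  have "(p 0 powr (- \<alpha>))-lipschitz_on {0..} (clk \<alpha> p)"
  proof (rule lipschitz_onI)
    show "dist (clk \<alpha> p x) (clk \<alpha> p y) \<le> p 0 powr (- \<alpha>) * dist x y" if "x \<in> {0..}" "y \<in> {0..}" for x y
      using le[of x y] le[of y x] that by (cases "x \<le> y") (auto simp: dist_real_def abs_minus_commute)
  qed simp
  then show ?thesis by (rule lipschitz_on_continuous_on)
qed

lemma clk_surj:
  assumes "0 \<le> r" "0 \<le> s" "r \<le> clk \<alpha> p s"
  obtains v where "0 \<le> v" "clk \<alpha> p v = r"
  using IVT'[of "clk \<alpha> p" 0 r s] assms continuous_on_subset[OF continuous_on_clk, of "{0..s}"] by auto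

lemma Inf_clk:
  assumes "0 \<le> v"
  shows "Inf {s. 0 \<le> s \<and> clk \<alpha> p v < clk \<alpha> p s} = v"
proof -
  have "{s. 0 \<le> s \<and> clk \<alpha> p v < clk \<alpha> p s} = {v<..}"
    using assms clk_less_iff[of v] by auto
  then show ?thesis by simp
qed

text \<open>The rate is nonincreasing, so right-endpoint sums are lower sums and their supremum is
  their limit. The gap to the upper sums telescopes to at most one mesh width times the initial
  rate.\<close>

lemma sampled_clk_eq:
  assumes t: "0 \<le> t"
  shows "sampled_clk \<alpha> p t = ennreal (clk \<alpha> p t)"
proof -
  define g where "g s = p s powr (- \<alpha>)" for s
  define S where "S n = (\<Sum>k<Suc n. t / real (Suc n) * g (real (Suc k) * t / real (Suc n)))" for n
  have S: "S n \<le> clk \<alpha> p t" "clk \<alpha> p t \<le> S n + t / real (Suc n) * g 0" for n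
  proof -
    define d where "d = t / real (Suc n)"
    have d: "0 \<le> d" "real (Suc n) * d = t" using t by (auto simp: d_def)
    have S': "S n = (\<Sum>k<Suc n. d * g (real (Suc k) * d))" by (simp add: S_def d_def)
    have tele: "clk \<alpha> p t = (\<Sum>k<Suc n. clk \<alpha> p (real (Suc k) * d) - clk \<alpha> p (real k * d))"
      using sum_lessThan_telescope[of "\<lambda>k. clk \<alpha> p (real k * d)" "Suc n"] d(2) by simp
    have inc: "d * g (real (Suc k) * d) \<le> clk \<alpha> p (real (Suc k) * d) - clk \<alpha> p (real k * d)"
        "clk \<alpha> p (real (Suc k) * d) - clk \<alpha> p (real k * d) \<le> d * g (real k * d)" for k
      using clk_increment[of "real k * d" "real (Suc k) * d"] d(1) by (auto simp: g_def algebra_simps)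
    show "S n \<le> clk \<alpha> p t" unfolding S' tele by (rule sum_mono) (rule inc)
    have "clk \<alpha> p t \<le> (\<Sum>k<Suc n. d * g (real k * d))" unfolding tele by (rule sum_mono) (rule inc)
    also have "\<dots> = S n + (\<Sum>k<Suc n. d * g (real k * d) - d * g (real (Suc k) * d))"
      by (simp add: S' sum_subtractf)
    also have "(\<Sum>k<Suc n. d * g (real k * d) - d * g (real (Suc k) * d)) = d * g 0 - d * g t"
      using sum_lessThan_telescope'[of "\<lambda>k. d * g (real k * d)" "Suc n"] d(2) by simp
    also have "\<dots> \<le> d * g 0" using d by (simp add: g_def)
    finally show "clk \<alpha> p t \<le> S n + t / real (Suc n) * g 0" by (simp add: d_def)
  qed
  have "(\<lambda>n. t * g 0 * inverse (real (Suc n))) \<longlonglongrightarrow> t * g 0 * 0"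
    by (intro tendsto_intros LIMSEQ_inverse_real_of_nat)
  then have "(\<lambda>n. clk \<alpha> p t - t / real (Suc n) * g 0) \<longlonglongrightarrow> clk \<alpha> p t - 0"
    by (intro tendsto_intros) (simp add: divide_inverse mult_ac)
  then have "(\<lambda>n. clk \<alpha> p t - t / real (Suc n) * g 0) \<longlonglongrightarrow> clk \<alpha> p t" by simp
  then have "S \<longlonglongrightarrow> clk \<alpha> p t"
  proof (rule tendsto_sandwich[rotated 2])
    show "eventually (\<lambda>n. clk \<alpha> p t - t / real (Suc n) * g 0 \<le> S n) sequentially"
      using S(2) by (auto simp: diff_le_eq)
    show "eventually (\<lambda>n. S n \<le> clk \<alpha> p t) sequentially" using S(1) by simp
  qed simp
  then have lim: "(\<lambda>n. ennreal (S n)) \<longlonglongrightarrow> ennreal (clk \<alpha> p t)" by (rule tendsto_ennrealI)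
  have eq: "sampled_clk \<alpha> p t = (SUP n. ennreal (S n))" by (simp only: sampled_clk_def S_def g_def)
  show ?thesis
    unfolding eq
  proof (rule antisym)
    show "(SUP n. ennreal (S n)) \<le> ennreal (clk \<alpha> p t)" by (intro SUP_least ennreal_leI S)
    show "ennreal (clk \<alpha> p t) \<le> (SUP n. ennreal (S n))"
      by (rule LIMSEQ_le_const2[OF lim]) (intro exI[of _ 0] allI impI SUP_upper UNIV_I)
  qed
qed

text \<open>Strict growth of the clock leaves exactly the rational times after \<open>v\<close> in
  the infimum, and right-continuity brings their values down to \<open>p v\<close>. All other times
  contribute \<top>.\<close>

lemma clk_value_eq:
  assumes v: "0 \<le> v"
  shows "clk_value \<alpha> (clk \<alpha> p v) p = ennreal (p v)"
proof (rule antisym)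
  have less: "ennreal (clk \<alpha> p v) < sampled_clk \<alpha> p u \<longleftrightarrow> v < u" if "0 \<le> u" for u
    using that v by (simp add: sampled_clk_eq ennreal_less_iff clk_nonneg clk_less_iff)
  show "ennreal (p v) \<le> clk_value \<alpha> (clk \<alpha> p v) p"
    unfolding clk_value_def
  proof (rule INF_greatest)
    fix u :: real assume u: "u \<in> {u \<in> \<rat>. 0 \<le> u}"
    then show "ennreal (p v) \<le> (if ennreal (clk \<alpha> p v) < sampled_clk \<alpha> p u then ennreal (p u) else \<top>)"
      using less[of u] mono[of v u] v by (auto intro!: ennreal_leI)
  qed
  show "clk_value \<alpha> (clk \<alpha> p v) p \<le> ennreal (p v)"
  proof (rule ennreal_le_epsilon)
    fix e :: real assume e: "0 < e"
    have "(p \<longlongrightarrow> p v) (at_right v)" using right_cont[OF v] by (simp add: continuous_within)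
    then have "eventually (\<lambda>u. p u < p v + e) (at_right v)" by (rule order_tendstoD) (use e in simp)
    then obtain w where w: "v < w" "\<And>u. v < u \<Longrightarrow> u < w \<Longrightarrow> p u < p v + e"
      by (auto simp: eventually_at_right_field)
    obtain u where u: "u \<in> \<rat>" "v < u" "u < w" using Rats_dense_in_real[OF w(1)] by blast
    have "clk_value \<alpha> (clk \<alpha> p v) p \<le> (if ennreal (clk \<alpha> p v) < sampled_clk \<alpha> p u then ennreal (p u) else \<top>)"
      unfolding clk_value_def using u v by (intro INF_lower) auto
    also have "\<dots> = ennreal (p u)" using less[of u] u v by simp
    also have "\<dots> \<le> ennreal (p v + e)" using w(2)[OF u(2,3)] by (intro ennreal_leI) auto
    also have "\<dots> = ennreal (p v) + ennreal e" using pos[OF v] e by (simp add: ennreal_plus)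
    finally show "clk_value \<alpha> (clk \<alpha> p v) p \<le> ennreal (p v) + ennreal e" .
  qed
qed

lemma total_clk_eq: "total_clk \<alpha> p = (SUP t\<in>{0..}. ennreal (clk \<alpha> p t))"
proof (rule antisym)
  show "total_clk \<alpha> p \<le> (SUP t\<in>{0..}. ennreal (clk \<alpha> p t))"
    unfolding total_clk_def by (rule SUP_least) (auto simp: sampled_clk_eq intro!: SUP_upper2[of "real _"])
  show "(SUP t\<in>{0..}. ennreal (clk \<alpha> p t)) \<le> total_clk \<alpha> p"
  proof (rule SUP_least)
    fix t :: real assume t: "t \<in> {0..}"
    have "ennreal (clk \<alpha> p t) \<le> sampled_clk \<alpha> p (real (nat \<lceil>t\<rceil>))"
      using t by (subst sampled_clk_eq) (auto intro!: ennreal_leI simp: clk_le_iff)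
    also have "\<dots> \<le> total_clk \<alpha> p" unfolding total_clk_def by (rule SUP_upper) simp
    finally show "ennreal (clk \<alpha> p t) \<le> total_clk \<alpha> p" .
  qed
qed

lemma shift:
  assumes a: "0 \<le> a"
  shows "increasing_path (\<lambda>t. p (a + t)) \<alpha>"
proof
  fix t :: real assume t: "0 \<le> t"
  have "((\<lambda>s. a + s) \<longlongrightarrow> a + t) (at_right t)" by (intro tendsto_intros)
  moreover have "eventually (\<lambda>s. a + t < a + s) (at_right t)"
    using eventually_at_right_less[of t] by eventually_elim simp
  ultimately have "filterlim (\<lambda>s. a + s) (at_right (a + t)) (at_right t)"
    unfolding filterlim_at by (auto elim: eventually_mono)
  moreover have "(p \<longlongrightarrow> p (a + t)) (at_right (a + t))"
    using right_cont[of "a + t"] a t by (simp add: continuous_within)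
  ultimately have "((\<lambda>s. p (a + s)) \<longlongrightarrow> p (a + t)) (at_right t)" by (rule filterlim_compose[rotated])
  then show "continuous (at_right t) (\<lambda>t. p (a + t))" by (simp add: continuous_within)
qed (use a \<alpha> in \<open>auto intro!: pos mono\<close>)

lemma clk_shift:
  assumes a: "0 \<le> a" and t: "0 \<le> t"
  shows "clk \<alpha> (\<lambda>t. p (a + t)) t = clk \<alpha> p (a + t) - clk \<alpha> p a"
proof -
  have "clk \<alpha> p (a + t) - clk \<alpha> p a = (\<integral>u. indicator {a..a + t} u *\<^sub>R p u powr (- \<alpha>) \<partial>lborel)"
    using clk_diff[of a "a + t"] a t by (simp add: set_lebesgue_integral_def)
  also have "\<dots> = \<bar>1\<bar> *\<^sub>R (\<integral>u. indicator {a..a + t} (a + 1 * u) *\<^sub>R p (a + 1 * u) powr (- \<alpha>) \<partial>lborel)"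
    by (rule lborel_integral_real_affine) simp
  also have "\<dots> = clk \<alpha> (\<lambda>t. p (a + t)) t"
    by (auto simp: clk_def set_lebesgue_integral_def indicator_def intro!: Bochner_Integration.integral_cong)
  finally show ?thesis ..
qed

lemma dilate:
  assumes c: "0 < c"
  shows "increasing_path (\<lambda>t. c * p (t * c powr (- \<alpha>))) \<alpha>"
proof
  fix t :: real assume t: "0 \<le> t"
  define \<kappa> where "\<kappa> = c powr (- \<alpha>)"
  have \<kappa>: "0 < \<kappa>" using c by (simp add: \<kappa>_def)
  have "((\<lambda>s. s * \<kappa>) \<longlongrightarrow> t * \<kappa>) (at_right t)" by (intro tendsto_intros)
  moreover have "eventually (\<lambda>s. t * \<kappa> < s * \<kappa>) (at_right t)"
    using eventually_at_right_less[of t] by eventually_elim (use \<kappa> in simp)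
  ultimately have "filterlim (\<lambda>s. s * \<kappa>) (at_right (t * \<kappa>)) (at_right t)"
    unfolding filterlim_at by (auto elim: eventually_mono)
  moreover have "(p \<longlongrightarrow> p (t * \<kappa>)) (at_right (t * \<kappa>))"
    using right_cont[of "t * \<kappa>"] \<kappa> t by (simp add: continuous_within)
  ultimately have "((\<lambda>s. p (s * \<kappa>)) \<longlongrightarrow> p (t * \<kappa>)) (at_right t)" by (rule filterlim_compose[rotated])
  then have "((\<lambda>s. c * p (s * \<kappa>)) \<longlongrightarrow> c * p (t * \<kappa>)) (at_right t)" by (intro tendsto_intros)
  then show "continuous (at_right t) (\<lambda>t. c * p (t * c powr (- \<alpha>)))" by (simp add: continuous_within \<kappa>_def)
qed (use c \<alpha> in \<open>auto intro!: pos mono mult_left_mono mult_right_mono mult_pos_pos\<close>)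

text \<open>\<open>c powr (- \<alpha>)\<close> occurs both as the speed of time and as the factor of
  the rate, and the substitution cancels one against the other. Rescaling thus only changes the time
  argument of the clock.\<close>

lemma clk_dilate:
  assumes c: "0 < c"
  shows "clk \<alpha> (\<lambda>t. c * p (t * c powr (- \<alpha>))) t = clk \<alpha> p (t * c powr (- \<alpha>))"
proof -
  define \<kappa> where "\<kappa> = c powr (- \<alpha>)"
  have \<kappa>: "0 < \<kappa>" using c by (simp add: \<kappa>_def)
  have "clk \<alpha> p (t * \<kappa>) = (\<integral>u. indicator {0..t * \<kappa>} u *\<^sub>R p u powr (- \<alpha>) \<partial>lborel)"
    by (simp add: clk_def set_lebesgue_integral_def)
  also have "\<dots> = \<bar>\<kappa>\<bar> *\<^sub>R (\<integral>u. indicator {0..t * \<kappa>} (0 + \<kappa> * u) *\<^sub>R p (0 + \<kappa> * u) powr (- \<alpha>) \<partial>lborel)"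
    by (rule lborel_integral_real_affine) (use \<kappa> in simp)
  also have "\<dots> = (\<integral>u. \<kappa> * (indicator {0..t * \<kappa>} (0 + \<kappa> * u) *\<^sub>R p (0 + \<kappa> * u) powr (- \<alpha>)) \<partial>lborel)"
    using \<kappa> by simp
  also have "\<dots> = (\<integral>u. indicator {0..t} u *\<^sub>R (c * p (u * \<kappa>)) powr (- \<alpha>) \<partial>lborel)"
  proof (rule Bochner_Integration.integral_cong[OF refl])
    fix u :: real
    have "0 + \<kappa> * u \<in> {0..t * \<kappa>} \<longleftrightarrow> u \<in> {0..t}"
      using \<kappa> by (simp add: zero_le_mult_iff mult.commute)
    moreover have "(c * p (u * \<kappa>)) powr (- \<alpha>) = \<kappa> * p (\<kappa> * u) powr (- \<alpha>)" if "0 \<le> u"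
      using that c \<kappa> pos[of "\<kappa> * u"] by (simp add: powr_mult \<kappa>_def mult.commute)
    ultimately show "\<kappa> * (indicator {0..t * \<kappa>} (0 + \<kappa> * u) *\<^sub>R p (0 + \<kappa> * u) powr (- \<alpha>))
        = indicator {0..t} u *\<^sub>R (c * p (u * \<kappa>)) powr (- \<alpha>)"
      by (simp add: indicator_def)
  qed
  finally show ?thesis by (simp add: clk_def set_lebesgue_integral_def \<kappa>_def)
qed

lemma total_clk_shift:
  assumes a: "0 \<le> a"
  shows "total_clk \<alpha> p = ennreal (clk \<alpha> p a) + total_clk \<alpha> (\<lambda>t. p (a + t))"
proof -
  interpret s: increasing_path "\<lambda>t. p (a + t)" \<alpha> by (rule shift[OF a])
  have "ennreal (clk \<alpha> p a) + total_clk \<alpha> (\<lambda>t. p (a + t)) = (SUP t\<in>{0..}. ennreal (clk \<alpha> p a) + ennreal (clk \<alpha> (\<lambda>t. p (a + t)) t))"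
    unfolding s.total_clk_eq by (subst ennreal_SUP_add_right) auto
  also have "\<dots> = (SUP t\<in>{0..}. ennreal (clk \<alpha> p (a + t)))"
    using a by (intro SUP_cong refl) (simp add: clk_shift clk_nonneg clk_le_iff flip: ennreal_plus)
  also have "\<dots> = (SUP t\<in>{0..}. ennreal (clk \<alpha> p t))"
  proof (rule antisym)
    show "(SUP t\<in>{0..}. ennreal (clk \<alpha> p (a + t))) \<le> (SUP t\<in>{0..}. ennreal (clk \<alpha> p t))"
    proof (rule SUP_mono)
      show "\<exists>u\<in>{0..}. ennreal (clk \<alpha> p (a + t)) \<le> ennreal (clk \<alpha> p u)" if "t \<in> {0..}" for t
        using that a by (intro bexI[of _ "a + t"]) auto
    qed
    show "(SUP t\<in>{0..}. ennreal (clk \<alpha> p t)) \<le> (SUP t\<in>{0..}. ennreal (clk \<alpha> p (a + t)))"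
    proof (rule SUP_mono)
      show "\<exists>u\<in>{0..}. ennreal (clk \<alpha> p t) \<le> ennreal (clk \<alpha> p (a + u))" if "t \<in> {0..}" for t
        using that a by (intro bexI[of _ t]) (auto intro!: ennreal_leI simp: clk_le_iff)
    qed
  qed
  finally show ?thesis by (simp add: total_clk_eq)
qed

lemma total_clk_dilate:
  assumes c: "0 < c"
  shows "total_clk \<alpha> (\<lambda>t. c * p (t * c powr (- \<alpha>))) = total_clk \<alpha> p"
proof -
  interpret d: increasing_path "\<lambda>t. c * p (t * c powr (- \<alpha>))" \<alpha> by (rule dilate[OF c])
  have "(\<lambda>t. t * c powr (- \<alpha>)) ` {0..} = {0..}"
  proof (intro equalityI subsetI)
    fix t :: real assume "t \<in> {0..}"
    then show "t \<in> (\<lambda>t. t * c powr (- \<alpha>)) ` {0..}"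
      using c by (intro image_eqI[of _ _ "t / c powr (- \<alpha>)"]) auto
  qed auto
  then have "(SUP t\<in>{0..}. ennreal (clk \<alpha> p (t * c powr (- \<alpha>)))) = (SUP t\<in>{0..}. ennreal (clk \<alpha> p t))"
    by (metis (no_types) image_image)
  then show ?thesis unfolding d.total_clk_eq total_clk_eq clk_dilate[OF c] .
qed

text \<open>Read at a given value of its own clock, the rescaled path is \<open>c\<close> times the
  original: this is how self-similarity becomes multiplicativity of the walk.\<close>

lemma clk_value_dilate:
  assumes c: "0 < c" and v: "0 \<le> v"
  shows "clk_value \<alpha> (clk \<alpha> p v) (\<lambda>t. c * p (t * c powr (- \<alpha>))) = ennreal (c * p v)"
proof -
  interpret d: increasing_path "\<lambda>t. c * p (t * c powr (- \<alpha>))" \<alpha> by (rule dilate[OF c])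
  have "v / c powr (- \<alpha>) * c powr (- \<alpha>) = v" using c by simp
  then show ?thesis
    using d.clk_value_eq[of "v / c powr (- \<alpha>)"] v c by (simp add: clk_dilate[OF c])
qed

lemma clk_value_eq_top:
  assumes "\<And>s. 0 \<le> s \<Longrightarrow> clk \<alpha> p s \<le> r"
  shows "clk_value \<alpha> r p = \<top>"
proof -
  have "(if ennreal r < sampled_clk \<alpha> p u then ennreal (p u) else \<top>) = \<top>" if "u \<in> {u \<in> \<rat>. 0 \<le> u}" for u :: real
    using that assms[of u] by (simp add: sampled_clk_eq leD[OF ennreal_leI])
  then show ?thesis by (simp add: clk_value_def)
qed

text \<open>Clock increments add along the path, so the value at a later clock reading is seen from
  the shifted path. If the clock never exceeds the target, both sides are \<top>.\<close>

lemma clk_value_shift: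
  assumes a: "0 \<le> a" and r: "0 \<le> r"
  shows "clk_value \<alpha> r (\<lambda>t. p (a + t)) = clk_value \<alpha> (clk \<alpha> p a + r) p"
proof -
  interpret s: increasing_path "\<lambda>t. p (a + t)" \<alpha> by (rule shift) fact
  show ?thesis
  proof (cases "\<exists>s\<ge>0. clk \<alpha> p a + r < clk \<alpha> p s")
    case True
    then obtain v where v: "0 \<le> v" "clk \<alpha> p v = clk \<alpha> p a + r"
      using clk_surj[of "clk \<alpha> p a + r"] clk_nonneg[OF a] r by (metis add_nonneg_nonneg less_imp_le)
    then have "a \<le> v" using clk_le_iff[of a v] a r by simp
    then show ?thesis using s.clk_value_eq[of "v - a"] clk_value_eq[OF v(1)] v a by (simp add: clk_shift)
  next
    case False
    have "clk \<alpha> (\<lambda>t. p (a + t)) s \<le> r" if "0 \<le> s" for s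
      using False that a by (auto simp: clk_shift not_less dest: spec[of _ "a + s"])
    then show ?thesis using False clk_value_eq_top[of "clk \<alpha> p a + r"] s.clk_value_eq_top[of r] by (auto simp: not_less)
  qed
qed

end

section \<open>The random walk inside a self-similar process\<close>

context increasing_pssMp
begin

lemma space_P: "0 < x \<Longrightarrow> space (P x) = space M"
  using sets_P by (rule sets_eq_imp_space_eq)

lemma increasing_path_X: "\<omega> \<in> space M \<Longrightarrow> increasing_path (\<lambda>t. X t \<omega>) \<alpha>"
  using \<alpha>_pos X_pos X_mono X_cadlag
  by unfold_locales (auto simp: cadlag_def mono_on_def)

lemma X_measurable_P: "0 < x \<Longrightarrow> 0 \<le> t \<Longrightarrow> X t \<in> borel_measurable (P x)"
  using measurable_X[of t] sets_P[of x] by (simp cong: measurable_cong_sets)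

lemma path_measurable:
  assumes "\<And>t. 0 \<le> t \<Longrightarrow> Y t \<in> borel_measurable N"
  shows "path Y \<in> measurable N path_space"
  unfolding path_def using assms by (intro measurable_restrict) auto

lemma coordinate_measurable: "0 \<le> t \<Longrightarrow> (\<lambda>p. p t) \<in> borel_measurable path_space"
  by (rule measurable_component_singleton) simp

lemma functional_path:
  assumes "\<And>p p'. (\<And>s. 0 \<le> s \<Longrightarrow> p s = p' s) \<Longrightarrow> F p = F p'"
  shows "F (path Y \<omega>) = F (\<lambda>t. Y t \<omega>)"
  by (rule assms) (simp add: path_def)

text \<open>\<open>path\<close> is \<open>undefined\<close> at negative times; \<open>F_cong\<close>
  makes \<open>F\<close> insensitive to this, so events can be written with the unrestricted
  trajectory.\<close>

lemma emeasure_law: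
  fixes F :: "(real \<Rightarrow> real) \<Rightarrow> ennreal"
  assumes Y: "\<And>t. 0 \<le> t \<Longrightarrow> Y t \<in> borel_measurable N"
    and F: "F \<in> borel_measurable path_space" and B: "B \<in> sets borel"
    and F_cong: "\<And>p p'. (\<And>s. 0 \<le> s \<Longrightarrow> p s = p' s) \<Longrightarrow> F p = F p'"
  shows "emeasure (law N Y) (F -` B \<inter> space path_space) = emeasure N {\<omega> \<in> space N. F (\<lambda>t. Y t \<omega>) \<in> B}"
proof -
  have "emeasure (law N Y) (F -` B \<inter> space path_space) = emeasure N (path Y -` (F -` B \<inter> space path_space) \<inter> space N)"
    unfolding law_def by (rule emeasure_distr[OF path_measurable[OF Y] measurable_sets[OF F B]])
  also have "path Y -` (F -` B \<inter> space path_space) \<inter> space N = {\<omega> \<in> space N. F (\<lambda>t. Y t \<omega>) \<in> B}"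
    using measurable_space[OF path_measurable[OF Y]] functional_path[of F Y, OF F_cong] by auto
  finally show ?thesis .
qed

lemma emeasure_law_scale:
  assumes x: "0 < x" and F: "F \<in> borel_measurable path_space" and B: "B \<in> sets borel"
    and F_cong: "\<And>p p'. (\<And>s. 0 \<le> s \<Longrightarrow> p s = p' s) \<Longrightarrow> F p = (F p' :: ennreal)"
  shows "emeasure (law (P x) X) (F -` B \<inter> space path_space)
    = emeasure (P 1) {\<omega> \<in> space M. F (\<lambda>t. x * X (t * x powr (- \<alpha>)) \<omega>) \<in> B}"
proof -
  have m: "(\<lambda>\<omega>. x * X (t * x powr (- \<alpha>)) \<omega>) \<in> borel_measurable (P 1)" if "0 \<le> t" for t
    using X_measurable_P[of 1 "t * x powr (- \<alpha>)"] that by simp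
  show ?thesis
    using self_similar[OF x, of 1] emeasure_law[of "\<lambda>t \<omega>. x * X (t * x powr (- \<alpha>)) \<omega>" "P 1", OF m F B F_cong]
    by (simp add: space_P)
qed

text \<open>By self-similarity, the law of the path after \<open>T\<close> given the current value is that of \<open>X\<close> under \<open>P 1\<close>,
  rescaled by this value.\<close>

lemma strong_markov_scaled:
  fixes F :: "(real \<Rightarrow> real) \<Rightarrow> ennreal"
  assumes T: "stopping_time (natural_filtration (space M) X) T"
    and F: "F \<in> borel_measurable path_space" and B: "B \<in> sets borel"
    and F_cong: "\<And>p p'. (\<And>s. 0 \<le> s \<Longrightarrow> p s = p' s) \<Longrightarrow> F p = F p'"
  shows "emeasure (P 1) {\<omega> \<in> space M. T \<omega> < \<infinity> \<and> F (\<lambda>t. X (enn2real (T \<omega>) + t) \<omega>) \<in> B}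
    = (\<integral>\<^sup>+\<omega>\<in>{\<omega> \<in> space M. T \<omega> < \<infinity>}. emeasure (P 1) {\<omega>' \<in> space M.
        F (\<lambda>t. X (enn2real (T \<omega>)) \<omega> * X (t * X (enn2real (T \<omega>)) \<omega> powr (- \<alpha>)) \<omega>') \<in> B} \<partial>P 1)"
proof -
  interpret filtration "space M" "natural_filtration (space M) X" by (rule filtration_natural)
  have top: "space M \<in> sets (pre_sigma T)"
    using sets.top[of "pre_sigma T"] by (simp add: space_pre_sigma)
  have "path (\<lambda>t. X (enn2real (T \<omega>) + t)) \<omega> \<in> space path_space" for \<omega>
    by (auto simp: path_def space_PiM)
  then have "{\<omega> \<in> space M. T \<omega> < \<infinity> \<and> F (\<lambda>t. X (enn2real (T \<omega>) + t) \<omega>) \<in> B}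
      = {\<omega> \<in> space M. T \<omega> < \<infinity> \<and> path (\<lambda>t. X (enn2real (T \<omega>) + t)) \<omega> \<in> F -` B \<inter> space path_space}"
    using functional_path[of F "\<lambda>t. X (enn2real (T _) + t)", OF F_cong] by auto
  also have "emeasure (P 1) \<dots> = (\<integral>\<^sup>+\<omega>\<in>{\<omega> \<in> space M. T \<omega> < \<infinity>}.
      emeasure (law (P (X (enn2real (T \<omega>)) \<omega>)) X) (F -` B \<inter> space path_space) \<partial>P 1)"
    by (rule strong_markov[OF _ T top measurable_sets[OF F B]]) simp
  also have "\<dots> = (\<integral>\<^sup>+\<omega>\<in>{\<omega> \<in> space M. T \<omega> < \<infinity>}. emeasure (P 1) {\<omega>' \<in> space M.
        F (\<lambda>t. X (enn2real (T \<omega>)) \<omega> * X (t * X (enn2real (T \<omega>)) \<omega> powr (- \<alpha>)) \<omega>') \<in> B} \<partial>P 1)"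
    by (rule nn_integral_cong)
       (simp add: emeasure_law_scale[OF _ F B F_cong] X_pos split: split_indicator)
  finally show ?thesis .
qed

sublocale P1: prob_space "P 1"
  by (rule prob_space_P) simp

text \<open>The total clock \<open>Z\<close> satisfies \<open>Z = clk 1 + Z'\<close> with \<open>Z'\<close> distributed as \<open>Z\<close>, because it is
  invariant under scaling; as \<open>clk 1 > 0\<close>, this leaves only \<open>Z = \<infinity>\<close>.\<close>

lemma AE_total_clk: "AE \<omega> in P 1. total_clk \<alpha> (\<lambda>t. X t \<omega>) = \<top>"
proof -
  define Z where "Z \<omega> = total_clk \<alpha> (\<lambda>t. X t \<omega>)" for \<omega>
  define Z' where "Z' \<omega> = total_clk \<alpha> (\<lambda>t. X (1 + t) \<omega>)" for \<omega>
  have [measurable]: "Z \<in> borel_measurable (P 1)" "Z' \<in> borel_measurable (P 1)"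
    unfolding Z_def[abs_def] Z'_def[abs_def] by (intro measurable_total_clk X_measurable_P; simp)+
  have Z: "Z \<omega> = ennreal (clk \<alpha> (\<lambda>t. X t \<omega>) 1) + Z' \<omega>" if "\<omega> \<in> space M" for \<omega>
    using increasing_path.total_clk_shift[OF increasing_path_X[OF that], of 1] by (simp add: Z_def Z'_def)
  \<comment> \<open>Strong Markov at the constant time \<open>1\<close>: given the value there, the
    future is a rescaled copy, and the total clock ignores the scaling.\<close>
  have eq: "emeasure (P 1) {\<omega> \<in> space M. Z' \<omega> \<le> z} = emeasure (P 1) {\<omega> \<in> space M. Z \<omega> \<le> z}" for z
  proof -
    have m: "(\<lambda>p. total_clk \<alpha> p) \<in> borel_measurable path_space"
      by (rule measurable_total_clk[of "\<lambda>s p. p s"]) (rule coordinate_measurable)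
    have "emeasure (P 1) {\<omega> \<in> space M. Z' \<omega> \<le> z}
        = (\<integral>\<^sup>+\<omega>\<in>{\<omega> \<in> space M. (1::ennreal) < \<infinity>}. emeasure (P 1) {\<omega>' \<in> space M.
          total_clk \<alpha> (\<lambda>t. X (enn2real 1) \<omega> * X (t * X (enn2real 1) \<omega> powr (- \<alpha>)) \<omega>') \<in> {..z}} \<partial>P 1)"
      using strong_markov_scaled[OF stopping_time_const[of _ 1] m _ total_clk_cong, of "{..z}"]
      by (simp add: Z'_def)
    also have "\<dots> = (\<integral>\<^sup>+\<omega>. emeasure (P 1) {\<omega> \<in> space M. Z \<omega> \<le> z} \<partial>P 1)"
    proof (rule nn_integral_cong)
      fix \<omega> assume "\<omega> \<in> space (P 1)"
      then have \<omega>: "\<omega> \<in> space M" by (simp add: space_P)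
      have "{\<omega>' \<in> space M. total_clk \<alpha> (\<lambda>t. X 1 \<omega> * X (t * X 1 \<omega> powr (- \<alpha>)) \<omega>') \<in> {..z}}
          = {\<omega>' \<in> space M. Z \<omega>' \<le> z}"
        using increasing_path.total_clk_dilate[OF increasing_path_X X_pos[OF \<omega>, of 1]] by (auto simp: Z_def)
      then show "emeasure (P 1) {\<omega>' \<in> space M. total_clk \<alpha> (\<lambda>t. X (enn2real 1) \<omega> * X (t * X (enn2real 1) \<omega> powr (- \<alpha>)) \<omega>') \<in> {..z}}
            * indicator {\<omega> \<in> space M. (1::ennreal) < \<infinity>} \<omega> = emeasure (P 1) {\<omega> \<in> space M. Z \<omega> \<le> z}"
        using \<omega> by simp
    qed
    also have "\<dots> = emeasure (P 1) {\<omega> \<in> space M. Z \<omega> \<le> z}"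
      by (simp add: P1.emeasure_space_1)
    finally show ?thesis .
  qed
  \<comment> \<open>As \<open>Z' \<le> Z\<close>, the event for \<open>Z\<close> is contained in the
    one for \<open>Z'\<close>; equal probabilities leave a null set between them.\<close>
  have "AE \<omega> in P 1. Z' \<omega> \<le> z \<longrightarrow> Z \<omega> \<le> z" for z
  proof -
    have meas: "{\<omega> \<in> space M. Z' \<omega> \<le> z} \<in> sets (P 1)" "{\<omega> \<in> space M. Z \<omega> \<le> z} \<in> sets (P 1)"
      unfolding space_P[of 1, simplified, symmetric] by measurable
    define N where "N = {\<omega> \<in> space M. Z' \<omega> \<le> z} - {\<omega> \<in> space M. Z \<omega> \<le> z}"
    have "Z' \<omega> \<le> Z \<omega>" if "\<omega> \<in> space M" for \<omega> using Z[OF that] by simp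
    then have "emeasure (P 1) N = 0"
      unfolding N_def by (subst emeasure_Diff) (use meas eq[of z] in \<open>auto simp: P1.emeasure_eq_measure intro: order_trans\<close>)
    then have "N \<in> null_sets (P 1)" using meas by (simp add: N_def null_sets_def sets.Diff)
    then show ?thesis by (rule AE_I') (auto simp: N_def space_P)
  qed
  \<comment> \<open>Rational levels suffice: if \<open>Z'\<close> is finite, one of them lies
    strictly between \<open>Z'\<close> and \<open>c + Z' = Z\<close>, against the implication at
    that level.\<close>
  then have "AE \<omega> in P 1. \<forall>r. Z' \<omega> \<le> ennreal (real_of_rat r) \<longrightarrow> Z \<omega> \<le> ennreal (real_of_rat r)"
    by (subst AE_all_countable) simp
  then show ?thesis
    using AE_space
  proof eventually_elim
    case (elim \<omega>)
    then have \<omega>: "\<omega> \<in> space M" by (simp add: space_P)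
    interpret X: increasing_path "\<lambda>t. X t \<omega>" \<alpha> by (rule increasing_path_X[OF \<omega>])
    define c where "c = clk \<alpha> (\<lambda>t. X t \<omega>) 1"
    have c: "0 < c" using X.clk_strict_mono[of 0 1] by (simp add: c_def)
    have Zc: "Z \<omega> = ennreal c + Z' \<omega>" using Z[OF \<omega>] by (simp add: c_def)
    show ?case
    proof (cases "Z' \<omega>")
      case top
      then show ?thesis using Zc by (simp add: Z_def)
    next
      case (real z)
      obtain r where r: "z < real_of_rat r" "real_of_rat r < c + z" using of_rat_dense[of z "c + z"] c by auto
      then have "Z \<omega> \<le> ennreal (real_of_rat r)" using elim(1)[rule_format, of r] real by (simp add: ennreal_leI)
      moreover have "Z \<omega> = ennreal (c + z)" using Zc real c by (simp add: ennreal_plus)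
      ultimately have "ennreal (c + z) \<le> ennreal (real_of_rat r)" by simp
      moreover have "0 \<le> real_of_rat r" using r real by linarith
      ultimately have "c + z \<le> real_of_rat r" by (simp only: ennreal_le_iff)
      then show ?thesis using r by simp
    qed
  qed
qed

section \<open>The walk sampled at integer values of the clock\<close>

definition "regular \<omega> \<longleftrightarrow> \<omega> \<in> space M \<and> X 0 \<omega> = 1 \<and> total_clk \<alpha> (\<lambda>t. X t \<omega>) = \<top>"

lemma AE_regular: "AE \<omega> in P 1. regular \<omega>"
  using AE_total_clk start[of 1, simplified] AE_space
  by eventually_elim (simp add: regular_def space_P)

lemma regular_space: "regular \<omega> \<Longrightarrow> \<omega> \<in> space M" by (simp add: regular_def)

lemma regular_inverse_clock:
  assumes \<omega>: "regular \<omega>" and r: "0 \<le> r"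
  shows "0 \<le> inverse_clock \<alpha> X r \<omega>" "clk \<alpha> (\<lambda>t. X t \<omega>) (inverse_clock \<alpha> X r \<omega>) = r"
    and "\<exists>s\<ge>0. r < clk \<alpha> (\<lambda>t. X t \<omega>) s"
proof -
  interpret X: increasing_path "\<lambda>t. X t \<omega>" \<alpha> by (rule increasing_path_X[OF regular_space[OF \<omega>]])
  have "total_clk \<alpha> (\<lambda>t. X t \<omega>) = \<top>" using \<omega> by (simp add: regular_def)
  then have "ennreal r < total_clk \<alpha> (\<lambda>t. X t \<omega>)" by simp
  then have "ennreal r < (SUP t\<in>{0..}. ennreal (clk \<alpha> (\<lambda>t. X t \<omega>) t))" by (simp only: X.total_clk_eq)
  then obtain s where s: "0 \<le> s" "r < clk \<alpha> (\<lambda>t. X t \<omega>) s"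
    unfolding less_SUP_iff using r by (auto simp: ennreal_less_iff)
  then show "\<exists>s\<ge>0. r < clk \<alpha> (\<lambda>t. X t \<omega>) s" by blast
  obtain v where v: "0 \<le> v" "clk \<alpha> (\<lambda>t. X t \<omega>) v = r" using X.clk_surj[of r s] s r by auto
  have "inverse_clock \<alpha> X r \<omega> = v"
    using X.Inf_clk[OF v(1)] by (simp add: inverse_clock_def clock_eq_clk v(2))
  with v show "0 \<le> inverse_clock \<alpha> X r \<omega>" "clk \<alpha> (\<lambda>t. X t \<omega>) (inverse_clock \<alpha> X r \<omega>) = r" by auto
qed

text \<open>Through \<open>clk_value\<close> only countably many times enter, which gives
  measurability. \<open>enn2real\<close> sends \<top> to \<open>0\<close>; the maximum with
  \<open>1\<close> repairs this and makes \<open>ln (H k \<omega>)\<close> nonnegative everywhere,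
  while on regular paths it changes nothing.\<close>

definition H :: "nat \<Rightarrow> 'a \<Rightarrow> real" where
  "H k \<omega> = max 1 (enn2real (clk_value \<alpha> (real k) (\<lambda>t. X t \<omega>)))"

lemma H_ge_1: "1 \<le> H k \<omega>"
  by (simp add: H_def)

lemma H_measurable [measurable]: "H k \<in> borel_measurable (P 1)"
proof -
  have [measurable]: "(\<lambda>\<omega>. clk_value \<alpha> (real k) (\<lambda>t. X t \<omega>)) \<in> borel_measurable (P 1)"
    by (intro measurable_clk_value X_measurable_P) auto
  show ?thesis unfolding H_def[abs_def] by measurable
qed

lemma clk_value_regular:
  assumes \<omega>: "regular \<omega>"
  shows "clk_value \<alpha> (real k) (\<lambda>t. X t \<omega>) = ennreal (X (inverse_clock \<alpha> X (real k) \<omega>) \<omega>)"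
    and "H k \<omega> = X (inverse_clock \<alpha> X (real k) \<omega>) \<omega>"
proof -
  interpret X: increasing_path "\<lambda>t. X t \<omega>" \<alpha> by (rule increasing_path_X[OF regular_space[OF \<omega>]])
  note v = regular_inverse_clock[OF \<omega>, of "real k", simplified]
  show 1: "clk_value \<alpha> (real k) (\<lambda>t. X t \<omega>) = ennreal (X (inverse_clock \<alpha> X (real k) \<omega>) \<omega>)"
    using X.clk_value_eq[OF v(1)] v(2) by simp
  show "H k \<omega> = X (inverse_clock \<alpha> X (real k) \<omega>) \<omega>"
    using X.pos[OF v(1)] X.mono[of 0, OF _ v(1)] \<omega> by (simp add: H_def 1 regular_def)
qed

text \<open>Where the clock never exceeds \<open>k\<close>, \<open>inverse_clock\<close> is an
  infimum of the empty set and no time of the process; the value \<top> keeps \<open>T k\<close> a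
  stopping time there.\<close>

definition T :: "nat \<Rightarrow> 'a \<Rightarrow> ennreal" where
  "T k \<omega> = (if \<exists>s\<ge>0. real k < clk \<alpha> (\<lambda>t. X t \<omega>) s then ennreal (inverse_clock \<alpha> X (real k) \<omega>) else \<top>)"

text \<open>The clock at \<open>s\<close> depends on the path up to \<open>s\<close>, and by
  continuity and strict growth \<open>T k \<le> s\<close> holds exactly when the clock at
  \<open>s\<close> is at least \<open>k\<close>; so the event lies in the natural filtration
  itself.\<close>

lemma stopping_time_T: "stopping_time (natural_filtration (space M) X) (T k)"
proof
  fix t :: ennreal
  interpret filtration "space M" "natural_filtration (space M) X" by (rule filtration_natural)
  show "Measurable.pred (natural_filtration (space M) X t) (\<lambda>\<omega>. T k \<omega> \<le> t)"
  proof (cases t)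
    case top
    then show ?thesis by simp
  next
    case (real s)
    have X: "X u \<in> borel_measurable (natural_filtration (space M) X t)" if "0 \<le> u" "u \<le> s" for u
    proof (rule measurableI)
      fix A :: "real set" assume "A \<in> sets borel"
      then have "X u -` A \<inter> space M \<in> sets (natural_filtration (space M) X t)"
        unfolding natural_filtration_def using that real
        by (subst sets_measure_of) (auto intro!: sigma_sets.Basic exI[of _ u] ennreal_leI)
      then show "X u -` A \<inter> space (natural_filtration (space M) X t) \<in> sets (natural_filtration (space M) X t)"
        by (simp add: space_F)
    qed simp
    then have [measurable]: "(\<lambda>\<omega>. sampled_clk \<alpha> (\<lambda>u. X u \<omega>) s) \<in> borel_measurable (natural_filtration (space M) X t)"
      using real by (intro measurable_sampled_clk) auto
    have "T k \<omega> \<le> t \<longleftrightarrow> ennreal (real k) \<le> sampled_clk \<alpha> (\<lambda>u. X u \<omega>) s" if \<omega>: "\<omega> \<in> space M" for \<omega>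
    proof -
      interpret X: increasing_path "\<lambda>t. X t \<omega>" \<alpha> by (rule increasing_path_X[OF \<omega>])
      show ?thesis
      proof (cases "\<exists>s\<ge>0. real k < clk \<alpha> (\<lambda>t. X t \<omega>) s")
        case True
        then obtain w where "0 \<le> w" "real k < clk \<alpha> (\<lambda>t. X t \<omega>) w" by blast
        then obtain v where v: "0 \<le> v" "clk \<alpha> (\<lambda>t. X t \<omega>) v = real k" using X.clk_surj[of "real k" w] by auto
        have "inverse_clock \<alpha> X (real k) \<omega> = v"
          using X.Inf_clk[OF v(1)] by (simp add: inverse_clock_def clock_eq_clk v(2))
        then have "T k \<omega> \<le> t \<longleftrightarrow> v \<le> s" using True real v by (simp add: T_def ennreal_le_iff)
        also have "\<dots> \<longleftrightarrow> real k \<le> clk \<alpha> (\<lambda>t. X t \<omega>) s" using X.clk_le_iff[OF v(1), of s] real v by simp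
        finally show ?thesis using real by (simp add: X.sampled_clk_eq ennreal_le_iff X.clk_nonneg)
      next
        case False
        \<comment> \<open>Strict growth after \<open>s\<close> excludes equality: a clock that never
          exceeds \<open>k\<close> never attains \<open>k\<close>.\<close>
        then have "\<not> real k < clk \<alpha> (\<lambda>t. X t \<omega>) (s + 1)" using real by auto
        then have lt: "clk \<alpha> (\<lambda>t. X t \<omega>) s < real k" using X.clk_strict_mono[of s "s + 1"] real by simp
        have "0 \<le> clk \<alpha> (\<lambda>t. X t \<omega>) s" by (rule X.clk_nonneg) (use real in simp)
        then have "\<not> ennreal (real k) \<le> sampled_clk \<alpha> (\<lambda>u. X u \<omega>) s"
          using lt real by (simp only: X.sampled_clk_eq ennreal_le_iff not_le)
        moreover have "\<not> T k \<omega> \<le> t" using False real by (auto simp: T_def top_unique)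
        ultimately show ?thesis by simp
      qed
    qed
    then have "Measurable.pred (natural_filtration (space M) X t) (\<lambda>\<omega>. T k \<omega> \<le> t) \<longleftrightarrow>
        Measurable.pred (natural_filtration (space M) X t) (\<lambda>\<omega>. ennreal (real k) \<le> sampled_clk \<alpha> (\<lambda>u. X u \<omega>) s)"
      by (intro measurable_cong) (simp add: space_F)
    then show ?thesis by simp
  qed
qed

lemma T_regular:
  assumes "regular \<omega>"
  shows "T k \<omega> = ennreal (inverse_clock \<alpha> X (real k) \<omega>)" "enn2real (T k \<omega>) = inverse_clock \<alpha> X (real k) \<omega>"
  using regular_inverse_clock[OF assms, of "real k"] by (auto simp: T_def)

lemma T_finite_iff:
  assumes "\<omega> \<in> space M"
  shows "T k \<omega> < \<infinity> \<longleftrightarrow> ennreal (real k) < total_clk \<alpha> (\<lambda>t. X t \<omega>)"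
proof -
  interpret X: increasing_path "\<lambda>t. X t \<omega>" \<alpha> by (rule increasing_path_X[OF assms])
  show ?thesis
    unfolding X.total_clk_eq less_SUP_iff by (auto simp: T_def ennreal_less_iff)
qed

lemma clk_value_T_shift:
  assumes \<omega>: "\<omega> \<in> space M" and T: "T k \<omega> < \<infinity>"
  shows "clk_value \<alpha> 1 (\<lambda>t. X (enn2real (T k \<omega>) + t) \<omega>) = clk_value \<alpha> (real (Suc k)) (\<lambda>t. X t \<omega>)"
proof -
  interpret X: increasing_path "\<lambda>t. X t \<omega>" \<alpha> by (rule increasing_path_X[OF \<omega>])
  obtain s where s: "0 \<le> s" "real k < clk \<alpha> (\<lambda>t. X t \<omega>) s"
    using T by (auto simp: T_def split: if_splits)
  then obtain v where v: "0 \<le> v" "clk \<alpha> (\<lambda>t. X t \<omega>) v = real k" using X.clk_surj[of "real k" s] by auto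
  have "inverse_clock \<alpha> X (real k) \<omega> = v"
    using X.Inf_clk[OF v(1)] by (simp add: inverse_clock_def clock_eq_clk v(2))
  then have "enn2real (T k \<omega>) = v" using s v by (auto simp: T_def)
  then show ?thesis using X.clk_value_shift[OF v(1), of 1] v(2) by (simp add: add.commute)
qed

text \<open>Strong Markov at \<open>T k\<close>: clock value \<open>1\<close> of the shifted path is
  clock value \<open>k + 1\<close> of the original, and the shifted path is a copy rescaled by
  \<open>H k\<close>. The next factor is thus an independent copy of \<open>H 1\<close>.\<close>

lemma distr_H_Suc:
  "distr (P 1) borel (H (Suc k)) = distr (P 1 \<Otimes>\<^sub>M P 1) borel (\<lambda>(\<omega>, \<omega>'). H k \<omega> * H 1 \<omega>')"
proof (rule measure_eqI)
  interpret pair_prob_space "P 1" "P 1" ..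
  fix B assume "B \<in> sets (distr (P 1) borel (H (Suc k)))"
  then have B [measurable]: "B \<in> sets borel" by simp
  \<comment> \<open>\<open>clk_value\<close> is extended real, so the event is pulled back along
    \<open>enn2real\<close>; on finite values, the ones met on regular paths, it agrees with
    \<open>B\<close>.\<close>
  define B' where "B' = enn2real -` B"
  have B': "B' \<in> sets borel"
  proof -
    have "enn2real \<in> borel_measurable borel" by measurable
    from measurable_sets[OF this B] show ?thesis by (simp add: B'_def)
  qed
  have B'_iff: "ennreal y \<in> B' \<longleftrightarrow> y \<in> B" if "0 \<le> y" for y
    using that by (simp add: B'_def)
  have m: "clk_value \<alpha> 1 \<in> borel_measurable path_space"
    by (rule measurable_clk_value[of "\<lambda>s p. p s"]) (rule coordinate_measurable)
  have "emeasure (distr (P 1) borel (H (Suc k))) B = emeasure (P 1) {\<omega> \<in> space M. H (Suc k) \<omega> \<in> B}"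
    by (subst emeasure_distr) (auto simp: space_P intro!: arg_cong[where f = "emeasure (P 1)"])
  also have "\<dots> = emeasure (P 1) {\<omega> \<in> space M. T k \<omega> < \<infinity> \<and> clk_value \<alpha> 1 (\<lambda>t. X (enn2real (T k \<omega>) + t) \<omega>) \<in> B'}"
  proof (rule emeasure_eq_AE)
    show "AE \<omega> in P 1. \<omega> \<in> {\<omega> \<in> space M. H (Suc k) \<omega> \<in> B} \<longleftrightarrow>
        \<omega> \<in> {\<omega> \<in> space M. T k \<omega> < \<infinity> \<and> clk_value \<alpha> 1 (\<lambda>t. X (enn2real (T k \<omega>) + t) \<omega>) \<in> B'}"
      using AE_regular
    proof eventually_elim
      case (elim \<omega>)
      have "T k \<omega> < \<infinity>" by (simp add: T_regular[OF elim])
      from clk_value_T_shift[OF regular_space[OF elim] this]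
      have "clk_value \<alpha> 1 (\<lambda>t. X (enn2real (T k \<omega>) + t) \<omega>) = ennreal (H (Suc k) \<omega>)"
        using clk_value_regular[OF elim, of "Suc k"] by simp
      then show ?case
        using elim B'_iff[of "H (Suc k) \<omega>"] order_trans[OF zero_le_one H_ge_1, of "Suc k" \<omega>]
        by (simp add: regular_space T_regular)
    qed
    show "{\<omega> \<in> space M. H (Suc k) \<omega> \<in> B} \<in> sets (P 1)"
      unfolding space_P[of 1, simplified, symmetric] by measurable
    have [measurable]: "(\<lambda>\<omega>. clk_value \<alpha> (real (Suc k)) (\<lambda>t. X t \<omega>)) \<in> borel_measurable (P 1)"
        "(\<lambda>\<omega>. total_clk \<alpha> (\<lambda>t. X t \<omega>)) \<in> borel_measurable (P 1)"
      by (intro measurable_clk_value measurable_total_clk X_measurable_P; simp)+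
    \<comment> \<open>The random shift hides measurability; the total clock and the unshifted path
      describe the same event by measurable functionals.\<close>
    have "{\<omega> \<in> space M. T k \<omega> < \<infinity> \<and> clk_value \<alpha> 1 (\<lambda>t. X (enn2real (T k \<omega>) + t) \<omega>) \<in> B'}
        = {\<omega> \<in> space M. ennreal (real k) < total_clk \<alpha> (\<lambda>t. X t \<omega>) \<and> clk_value \<alpha> (real (Suc k)) (\<lambda>t. X t \<omega>) \<in> B'}"
      using clk_value_T_shift T_finite_iff by auto
    also have "\<dots> \<in> sets (P 1)"
      unfolding space_P[of 1, simplified, symmetric] using B' by measurable
    finally show "{\<omega> \<in> space M. T k \<omega> < \<infinity> \<and> clk_value \<alpha> 1 (\<lambda>t. X (enn2real (T k \<omega>) + t) \<omega>) \<in> B'} \<in> sets (P 1)" .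
  qed
  also have "\<dots> = (\<integral>\<^sup>+\<omega>\<in>{\<omega> \<in> space M. T k \<omega> < \<infinity>}. emeasure (P 1) {\<omega>' \<in> space M.
        clk_value \<alpha> 1 (\<lambda>t. X (enn2real (T k \<omega>)) \<omega> * X (t * X (enn2real (T k \<omega>)) \<omega> powr (- \<alpha>)) \<omega>') \<in> B'} \<partial>P 1)"
    by (rule strong_markov_scaled[OF stopping_time_T m B' clk_value_cong])
  also have "\<dots> = (\<integral>\<^sup>+\<omega>. (\<integral>\<^sup>+\<omega>'. indicator B (H k \<omega> * H 1 \<omega>') \<partial>P 1) \<partial>P 1)"
  proof (rule nn_integral_cong_AE)
    show "AE \<omega> in P 1. emeasure (P 1) {\<omega>' \<in> space M.
        clk_value \<alpha> 1 (\<lambda>t. X (enn2real (T k \<omega>)) \<omega> * X (t * X (enn2real (T k \<omega>)) \<omega> powr (- \<alpha>)) \<omega>') \<in> B'}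
          * indicator {\<omega> \<in> space M. T k \<omega> < \<infinity>} \<omega> = (\<integral>\<^sup>+\<omega>'. indicator B (H k \<omega> * H 1 \<omega>') \<partial>P 1)"
      using AE_regular
    proof eventually_elim
      case (elim \<omega>)
      have Hk: "X (enn2real (T k \<omega>)) \<omega> = H k \<omega>" "1 \<le> H k \<omega>"
        using clk_value_regular(2)[OF elim, of k] H_ge_1[of k \<omega>] by (simp_all only: T_regular(2)[OF elim])
      have "T k \<omega> < \<infinity>" by (simp add: T_regular[OF elim])
      have m': "(\<lambda>\<omega>'. clk_value \<alpha> 1 (\<lambda>t. H k \<omega> * X (t * H k \<omega> powr (- \<alpha>)) \<omega>')) \<in> borel_measurable (P 1)"
        by (intro measurable_clk_value borel_measurable_times X_measurable_P) auto
      have "emeasure (P 1) {\<omega>' \<in> space M. clk_value \<alpha> 1 (\<lambda>t. H k \<omega> * X (t * H k \<omega> powr (- \<alpha>)) \<omega>') \<in> B'}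
          = (\<integral>\<^sup>+\<omega>'. indicator {\<omega>' \<in> space M. clk_value \<alpha> 1 (\<lambda>t. H k \<omega> * X (t * H k \<omega> powr (- \<alpha>)) \<omega>') \<in> B'} \<omega>' \<partial>P 1)"
        using measurable_sets[OF m' B'] by (subst nn_integral_indicator) (auto simp: space_P vimage_def Int_def conj_commute)
      also have "\<dots> = (\<integral>\<^sup>+\<omega>'. indicator B (H k \<omega> * H 1 \<omega>') \<partial>P 1)"
      proof (rule nn_integral_cong_AE)
        show "AE \<omega>' in P 1. indicator {\<omega>' \<in> space M. clk_value \<alpha> 1 (\<lambda>t. H k \<omega> * X (t * H k \<omega> powr (- \<alpha>)) \<omega>') \<in> B'} \<omega>'
            = (indicator B (H k \<omega> * H 1 \<omega>') :: ennreal)"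
          using AE_regular
        proof eventually_elim
          case (elim \<omega>')
          interpret X: increasing_path "\<lambda>t. X t \<omega>'" \<alpha> by (rule increasing_path_X[OF regular_space[OF elim]])
          note v = regular_inverse_clock[OF elim, of 1, simplified]
          have "clk_value \<alpha> 1 (\<lambda>t. H k \<omega> * X (t * H k \<omega> powr (- \<alpha>)) \<omega>') = ennreal (H k \<omega> * H 1 \<omega>')"
            using X.clk_value_dilate[OF _ v(1), of "H k \<omega>"] v(2) Hk(2) clk_value_regular(2)[OF elim, of 1] by simp
          then show ?case
            using B'_iff[of "H k \<omega> * H 1 \<omega>'"] order_trans[OF zero_le_one H_ge_1, of 1 \<omega>'] Hk(2) regular_space[OF elim]
            by (simp add: indicator_def)
        qed
      qed
      finally show ?case
        using elim \<open>T k \<omega> < \<infinity>\<close> by (simp add: Hk(1) regular_space)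
    qed
  qed
  also have "\<dots> = emeasure (distr (P 1 \<Otimes>\<^sub>M P 1) borel (\<lambda>(\<omega>, \<omega>'). H k \<omega> * H 1 \<omega>')) B"
    by (subst nn_integral_indicator[symmetric], simp, subst nn_integral_distr) (auto simp: P1.nn_integral_fst[symmetric])
  finally show "emeasure (distr (P 1) borel (H (Suc k))) B
      = emeasure (distr (P 1 \<Otimes>\<^sub>M P 1) borel (\<lambda>(\<omega>, \<omega>'). H k \<omega> * H 1 \<omega>')) B" .
qed simp

lemma H_Laplace:
  assumes l: "0 \<le> l"
  shows "P1.expectation (\<lambda>\<omega>. exp (- (l * ln (H k \<omega>)))) = P1.expectation (\<lambda>\<omega>. exp (- (l * ln (H 1 \<omega>)))) ^ k"
proof (induction k)
  case 0
  have "AE \<omega> in P 1. exp (- (l * ln (H 0 \<omega>))) = 1"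
    using AE_regular
  proof eventually_elim
    case (elim \<omega>)
    interpret X: increasing_path "\<lambda>t. X t \<omega>" \<alpha> by (rule increasing_path_X[OF regular_space[OF elim]])
    note v = regular_inverse_clock[OF elim, of 0, simplified]
    have "inverse_clock \<alpha> X 0 \<omega> = 0" using X.clk_less_iff[of 0, OF _ v(1)] v by simp
    then have "H 0 \<omega> = 1" using clk_value_regular(2)[OF elim, of 0] elim by (simp add: regular_def)
    then show ?case by simp
  qed
  then have "P1.expectation (\<lambda>\<omega>. exp (- (l * ln (H 0 \<omega>)))) = P1.expectation (\<lambda>\<omega>. 1)"
    by (intro integral_cong_AE) auto
  then show ?case by (simp add: P1.prob_space)
next
  case (Suc k)
  interpret pair_prob_space "P 1" "P 1" ..
  have g_le: "exp (- (l * ln (H k \<omega>))) \<le> 1" for k \<omega>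
    using H_ge_1[of k \<omega>] l by simp
  have prod: "exp (- (l * ln (H k \<omega> * H 1 \<omega>'))) = exp (- (l * ln (H k \<omega>))) * exp (- (l * ln (H 1 \<omega>')))" for \<omega> \<omega>'
    using H_ge_1[of k \<omega>] H_ge_1[of 1 \<omega>'] by (simp add: ln_mult ring_distribs flip: exp_add)
  have int2: "integrable (P 1 \<Otimes>\<^sub>M P 1) (\<lambda>(\<omega>, \<omega>'). exp (- (l * ln (H k \<omega>))) * exp (- (l * ln (H 1 \<omega>'))))"
  proof (rule integrable_const_bound[where B = 1])
    show "AE z in P 1 \<Otimes>\<^sub>M P 1. norm (case z of (\<omega>, \<omega>') \<Rightarrow> exp (- (l * ln (H k \<omega>))) * exp (- (l * ln (H 1 \<omega>')))) \<le> 1"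
    proof (rule AE_I2)
      fix z
      have "exp (- (l * ln (H k (fst z)))) * exp (- (l * ln (H 1 (snd z)))) \<le> 1"
        by (intro mult_le_one g_le) simp
      then show "norm (case z of (\<omega>, \<omega>') \<Rightarrow> exp (- (l * ln (H k \<omega>))) * exp (- (l * ln (H 1 \<omega>')))) \<le> 1"
        by (simp add: split_beta' abs_mult)
    qed
  qed measurable
  have "P1.expectation (\<lambda>\<omega>. exp (- (l * ln (H (Suc k) \<omega>)))) = (\<integral>y. exp (- (l * ln y)) \<partial>distr (P 1) borel (H (Suc k)))"
    by (subst integral_distr) auto
  also have "\<dots> = (\<integral>z. (case z of (\<omega>, \<omega>') \<Rightarrow> exp (- (l * ln (H k \<omega>))) * exp (- (l * ln (H 1 \<omega>')))) \<partial>(P 1 \<Otimes>\<^sub>M P 1))"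
    unfolding distr_H_Suc
    by (subst integral_distr) (auto simp: prod[unfolded One_nat_def] split_beta' intro!: Bochner_Integration.integral_cong)
  also have "\<dots> = (\<integral>\<omega>. (\<integral>\<omega>'. exp (- (l * ln (H k \<omega>))) * exp (- (l * ln (H 1 \<omega>'))) \<partial>P 1) \<partial>P 1)"
    using integral_fst'[OF int2] by simp
  also have "\<dots> = P1.expectation (\<lambda>\<omega>. exp (- (l * ln (H k \<omega>)))) * P1.expectation (\<lambda>\<omega>. exp (- (l * ln (H 1 \<omega>))))"
    by simp
  finally show ?case by (simp add: Suc.IH mult.commute)
qed

text \<open>Measurable as a countable supremum. Clamping covers negative \<open>t\<close>, where the
  integral over an empty interval is \<open>0\<close> as well.\<close>

definition clock' :: "real \<Rightarrow> 'a \<Rightarrow> real" where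
  "clock' t \<omega> = enn2real (sampled_clk \<alpha> (\<lambda>s. X s \<omega>) (max 0 t))"

lemma clock'_eq:
  assumes "\<omega> \<in> space M"
  shows "clock' t \<omega> = clk \<alpha> (\<lambda>t. X t \<omega>) (max 0 t)" "clock' t \<omega> = clock \<alpha> X t \<omega>"
proof -
  interpret X: increasing_path "\<lambda>t. X t \<omega>" \<alpha> by (rule increasing_path_X[OF assms])
  show 1: "clock' t \<omega> = clk \<alpha> (\<lambda>t. X t \<omega>) (max 0 t)"
    by (simp add: clock'_def X.sampled_clk_eq X.clk_nonneg)
  show "clock' t \<omega> = clock \<alpha> X t \<omega>"
  proof (cases "0 \<le> t")
    case True
    then show ?thesis by (simp add: 1 clock_eq_clk max_def)
  next
    case False
    then show ?thesis by (simp add: 1 clock_eq_clk max_def) (simp add: clk_def set_lebesgue_integral_def)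
  qed
qed

sublocale LC: lamperti_clock "P 1" "\<lambda>k \<omega>. ln (H k \<omega>)" clock' \<alpha>
proof
  show "clock' t \<in> borel_measurable (P 1)" for t
  proof -
    have [measurable]: "(\<lambda>\<omega>. sampled_clk \<alpha> (\<lambda>s. X s \<omega>) (max 0 t)) \<in> borel_measurable (P 1)"
      by (intro measurable_sampled_clk X_measurable_P) auto
    show ?thesis unfolding clock'_def[abs_def] by measurable
  qed
  show "AE \<omega> in P 1. 0 \<le> ln (H k \<omega>)" for k
    using H_ge_1 by simp
  show "AE \<omega> in P 1. mono (\<lambda>k. ln (H k \<omega>))"
    using AE_regular
  proof eventually_elim
    case (elim \<omega>)
    interpret X: increasing_path "\<lambda>t. X t \<omega>" \<alpha> by (rule increasing_path_X[OF regular_space[OF elim]])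
    have v: "0 \<le> inverse_clock \<alpha> X (real k) \<omega>" "clk \<alpha> (\<lambda>t. X t \<omega>) (inverse_clock \<alpha> X (real k) \<omega>) = real k" for k
      using regular_inverse_clock[OF elim, of "real k"] by auto
    show ?case
    proof (rule monoI)
      fix j k :: nat assume "j \<le> k"
      then have "inverse_clock \<alpha> X (real j) \<omega> \<le> inverse_clock \<alpha> X (real k) \<omega>"
        using X.clk_le_iff[OF v(1)[of j] v(1)[of k]] by (simp add: v(2))
      then have "H j \<omega> \<le> H k \<omega>" using X.mono[OF v(1)] by (simp add: clk_value_regular(2)[OF elim])
      then show "ln (H j \<omega>) \<le> ln (H k \<omega>)" using H_ge_1[of j \<omega>] H_ge_1[of k \<omega>] by (subst ln_le_cancel_iff) auto
    qed
  qed
  show "P1.expectation (\<lambda>\<omega>. exp (- (l * ln (H k \<omega>)))) = P1.expectation (\<lambda>\<omega>. exp (- (l * ln (H 1 \<omega>)))) ^ k"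
    if "0 \<le> l" for l k using that by (rule H_Laplace)
  show "AE \<omega> in P 1. 0 \<le> clock' t \<omega>" for t by (simp add: clock'_def)
  show "AE \<omega> in P 1. clock' t \<omega> \<le> max 0 t" for t
    using AE_regular
  proof eventually_elim
    case (elim \<omega>)
    interpret X: increasing_path "\<lambda>t. X t \<omega>" \<alpha> by (rule increasing_path_X[OF regular_space[OF elim]])
    show ?case using X.clk_le[of "max 0 t"] elim by (simp add: clock'_eq(1)[OF regular_space] regular_def)
  qed
  fix t x :: real assume t: "0 \<le> t"
  have rate: "y powr (- \<alpha>) = exp (- (\<alpha> * ln y))" if "1 \<le> y" for y :: real
    using that by (simp add: powr_def)
  show "AE \<omega> in P 1. \<forall>k. ln (H k \<omega>) \<le> x \<longrightarrow> min (real k) (t * exp (- (\<alpha> * x))) \<le> clock' t \<omega>"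
    using AE_regular
  proof eventually_elim
    case (elim \<omega>)
    interpret X: increasing_path "\<lambda>t. X t \<omega>" \<alpha> by (rule increasing_path_X[OF regular_space[OF elim]])
    have A: "clock' t \<omega> = clk \<alpha> (\<lambda>t. X t \<omega>) t" using clock'_eq(1)[OF regular_space[OF elim], of t] t by simp
    show ?case
    proof (intro allI impI)
      fix k assume x: "ln (H k \<omega>) \<le> x"
      define v where "v = inverse_clock \<alpha> X (real k) \<omega>"
      have v: "0 \<le> v" "clk \<alpha> (\<lambda>t. X t \<omega>) v = real k" "X v \<omega> = H k \<omega>"
        using regular_inverse_clock[OF elim, of "real k"] clk_value_regular(2)[OF elim, of k] by (auto simp: v_def)
      show "min (real k) (t * exp (- (\<alpha> * x))) \<le> clock' t \<omega>"
      \<comment> \<open>Either the clock has reached \<open>k\<close> by time \<open>t\<close>, or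
        the path stays at or below \<open>H k\<close> up to \<open>t\<close>, so that the rate is at
        least \<open>exp (- (\<alpha> * x))\<close> throughout.\<close>
      proof (cases "v \<le> t")
        case True
        then show ?thesis using X.clk_le_iff[OF v(1) t] v(2) A by simp
      next
        case False
        have "t * exp (- (\<alpha> * x)) \<le> t * exp (- (\<alpha> * ln (H k \<omega>)))"
          using x t \<alpha>_pos by (intro mult_left_mono) auto
        also have "\<dots> = t * X v \<omega> powr (- \<alpha>)" using H_ge_1[of k \<omega>] by (simp add: rate v(3))
        also have "\<dots> \<le> t * X t \<omega> powr (- \<alpha>)"
          using False t X.rate_antimono[of t v] by (intro mult_left_mono) auto
        also have "\<dots> \<le> clock' t \<omega>" using X.clk_ge[OF t] by (simp add: A)
        finally show ?thesis by simp
      qed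
    qed
  qed
  show "AE \<omega> in P 1. \<forall>k. x < ln (H k \<omega>) \<longrightarrow> clock' t \<omega> \<le> real k + t * exp (- (\<alpha> * x))"
    using AE_regular
  proof eventually_elim
    case (elim \<omega>)
    interpret X: increasing_path "\<lambda>t. X t \<omega>" \<alpha> by (rule increasing_path_X[OF regular_space[OF elim]])
    have A: "clock' t \<omega> = clk \<alpha> (\<lambda>t. X t \<omega>) t" using clock'_eq(1)[OF regular_space[OF elim], of t] t by simp
    show ?case
    proof (intro allI impI)
      fix k assume x: "x < ln (H k \<omega>)"
      define v where "v = inverse_clock \<alpha> X (real k) \<omega>"
      have v: "0 \<le> v" "clk \<alpha> (\<lambda>t. X t \<omega>) v = real k" "X v \<omega> = H k \<omega>"
        using regular_inverse_clock[OF elim, of "real k"] clk_value_regular(2)[OF elim, of k] by (auto simp: v_def)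
      have e: "0 \<le> t * exp (- (\<alpha> * x))" using t by simp
      show "clock' t \<omega> \<le> real k + t * exp (- (\<alpha> * x))"
      \<comment> \<open>At \<open>v\<close> the clock has run exactly \<open>k\<close> units; after
        \<open>v\<close> the rate is at most \<open>exp (- (\<alpha> * x))\<close>.\<close>
      proof (cases "t \<le> v")
        case True
        then have "clk \<alpha> (\<lambda>t. X t \<omega>) t \<le> real k" using X.clk_le_iff[OF t v(1)] v(2) by simp
        then show ?thesis using A e by simp
      next
        case False
        have "clock' t \<omega> - real k \<le> (t - v) * X v \<omega> powr (- \<alpha>)"
          using X.clk_increment(2)[of v t] False v A by simp
        also have "\<dots> = (t - v) * exp (- (\<alpha> * ln (H k \<omega>)))" using H_ge_1[of k \<omega>] by (simp add: rate v(3))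
        also have "\<dots> \<le> t * exp (- (\<alpha> * x))"
          using x t v \<alpha>_pos False by (intro mult_mono) auto
        finally show ?thesis by simp
      qed
    qed
  qed
qed (use \<alpha>_pos in auto)

text \<open>\<open>lamperti\<close> and \<open>ln (H 1 \<omega>)\<close> are compared on regular
  paths, that is almost surely; passing to integrals then uses measurability of both sides.\<close>

lemma laplace_exponent_eq:
  assumes l: "0 \<le> l" and meas: "lamperti \<alpha> X 1 \<in> borel_measurable (P 1)"
  shows "laplace_exponent (P 1) (lamperti \<alpha> X) l = LC.\<phi> l"
proof -
  have "P1.expectation (\<lambda>\<omega>. exp (- l * lamperti \<alpha> X 1 \<omega>)) = P1.expectation (\<lambda>\<omega>. exp (- (max 0 l * ln (H 1 \<omega>))))"
  proof (rule integral_cong_AE)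
    show "AE \<omega> in P 1. exp (- l * lamperti \<alpha> X 1 \<omega>) = exp (- (max 0 l * ln (H 1 \<omega>)))"
      using AE_regular
      by eventually_elim (use l clk_value_regular(2)[of _ 1] in \<open>simp add: lamperti_def regular_def\<close>)
  qed (use meas in measurable)
  then show ?thesis by (simp add: laplace_exponent_def LC.\<phi>_def LC.q_def)
qed

text \<open>Where the clock stays bounded, \<^const>\<open>inverse_clock\<close> is the unspecified real \<open>Inf {}\<close>. It might be negative,
  a time at which \<open>X\<close> need not be measurable; then the integral is \<open>0\<close>, and so is the exponent because \<open>ln 0 = 0\<close>.\<close>

lemma laplace_exponent_not_measurable:
  assumes "lamperti \<alpha> X 1 \<notin> borel_measurable (P 1)"
  shows "laplace_exponent (P 1) (lamperti \<alpha> X) l = 0"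
proof (cases "l = 0")
  case True
  then show ?thesis by (simp add: laplace_exponent_def P1.prob_space)
next
  case False
  have "\<not> integrable (P 1) (\<lambda>\<omega>. exp (- l * lamperti \<alpha> X 1 \<omega>))"
  proof
    assume "integrable (P 1) (\<lambda>\<omega>. exp (- l * lamperti \<alpha> X 1 \<omega>))"
    then have [measurable]: "(\<lambda>\<omega>. exp (- l * lamperti \<alpha> X 1 \<omega>)) \<in> borel_measurable (P 1)"
      by (rule borel_measurable_integrable)
    have "(\<lambda>\<omega>. ln (exp (- l * lamperti \<alpha> X 1 \<omega>)) / (- l)) \<in> borel_measurable (P 1)" by measurable
    then show False using assms False by simp
  qed
  then show ?thesis by (simp add: laplace_exponent_def not_integrable_integral_eq)
qed

end

section \<open>The theorem\<close>

lemma converges_in_distribution_cong: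
  assumes "eventually (\<lambda>t. \<mu> t = \<mu>' t) F"
  shows "converges_in_distribution \<mu> \<nu> F \<longleftrightarrow> converges_in_distribution \<mu>' \<nu> F"
  unfolding converges_in_distribution_def
  by (intro all_cong1 imp_cong refl tendsto_cong) (use assms in \<open>auto elim: eventually_mono\<close>)

lemma regularly_varying_at_0_cong:
  assumes "\<And>l. 0 < l \<Longrightarrow> f l = g l"
  shows "regularly_varying_at_0 f \<beta> \<longleftrightarrow> regularly_varying_at_0 g \<beta>"
  unfolding regularly_varying_at_0_def
proof (intro all_cong1 imp_cong refl tendsto_cong)
  fix c :: real assume "0 < c"
  then show "eventually (\<lambda>l. f (c * l) / f l = g (c * l) / g l) (at_right 0)"
    using eventually_at_right_less[of 0] by (auto elim!: eventually_mono simp: assms)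
qed

lemma not_regularly_varying_at_0_zero: "\<not> regularly_varying_at_0 (\<lambda>_. 0) \<beta>"
proof
  assume "regularly_varying_at_0 (\<lambda>_. 0) \<beta>"
  then have "((\<lambda>l::real. 0 / 0) \<longlongrightarrow> 1 powr \<beta>) (at_right 0)"
    unfolding regularly_varying_at_0_def by (rule allE[where x = 1]) simp
  then show False by (simp add: tendsto_const_iff)
qed

text \<open>Convergence in distribution of the constant \<open>0\<close> would carry over to first
  moments, but the limit has first moment \<open>s / Gamma (1 + \<beta>)\<close>, which is
  positive.\<close>

lemma (in prob_space) not_converges_to_mittag_leffler_zero:
  assumes \<beta>: "0 \<le> \<beta>" and s: "0 < s" and W: "mittag_leffler_law \<beta> W"
  shows "\<not> converges_in_distribution (\<lambda>t::real. distr M borel (\<lambda>\<omega>. 0)) (distr W borel (\<lambda>w. s * w)) at_top"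
proof
  interpret W: prob_space W using W by (simp add: mittag_leffler_law_def)
  have [measurable_cong]: "sets W = sets borel" using W by (simp add: mittag_leffler_law_def)
  have int: "has_bochner_integral W (\<lambda>w. w ^ 1) (fact 1 / Gamma (1 + real 1 * \<beta>))"
    using W unfolding mittag_leffler_law_def by blast
  have "(\<integral>x. x ^ 1 \<partial>distr W borel (\<lambda>w. s * w)) = s / Gamma (1 + \<beta>)"
    using int by (subst integral_distr) (auto simp: has_bochner_integral_iff)
  moreover assume "converges_in_distribution (\<lambda>t::real. distr M borel (\<lambda>\<omega>. 0)) (distr W borel (\<lambda>w. s * w)) at_top"
  then have "((\<lambda>t::real. \<integral>x. 0 ^ 1 \<partial>M) \<longlongrightarrow> (\<integral>x. x ^ 1 \<partial>distr W borel (\<lambda>w. s * w))) at_top"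
    by (intro moments_tendsto_of_converges_in_distribution prob_space_axioms W.real_distribution_distr) auto
  ultimately have "s / Gamma (1 + \<beta>) = 0" by (simp add: tendsto_const_iff)
  moreover have "0 < Gamma (1 + \<beta>)" using \<beta> by (simp add: Gamma_real_pos)
  ultimately show False using s by simp
qed

theorem proposition2:
  fixes M :: "'a measure"
    and P :: "real \<Rightarrow> 'a measure"
    and X :: "real \<Rightarrow> 'a \<Rightarrow> real"
    and \<alpha> \<beta> :: real
    and \<phi> :: "real \<Rightarrow> real"
  assumes X: "increasing_pssMp M P X \<alpha>"
    and \<phi>: "\<phi> = laplace_exponent (P 1) (lamperti \<alpha> X)"
    and \<beta>: "0 \<le> \<beta>" "\<beta> \<le> 1"
  shows "(regularly_varying_at_0 \<phi> \<beta> \<longleftrightarrow>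
           (\<exists>W. mittag_leffler_law \<beta> W \<and>
              converges_in_distribution
                (\<lambda>t. distr (P 1) borel
                   (\<lambda>\<omega>. \<phi> (1 / ln t) * (LINT s:{0..t}|lborel. X s \<omega> powr (-\<alpha>))))
                (distr W borel (\<lambda>w. \<alpha> powr (-\<beta>) * w)) at_top))
       \<and> (regularly_varying_at_0 \<phi> \<beta> \<longleftrightarrow>
           (\<forall>n::nat.
              ((\<lambda>t. \<integral>\<omega>. (\<phi> (1 / ln t) * (LINT s:{0..t}|lborel. X s \<omega> powr (-\<alpha>))) ^ n \<partial>P 1)
                \<longlongrightarrow> \<alpha> powr (-\<beta> * real n) * fact n / Gamma (1 + real n * \<beta>)) at_top))"
proof -
  interpret increasing_pssMp M P X \<alpha> by (rule X)
  have clock: "(LINT s:{0..t}|lborel. X s \<omega> powr (-\<alpha>)) = clock' t \<omega>" if "\<omega> \<in> space (P 1)" for t \<omega>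
    using clock'_eq(2)[of \<omega> t] that by (simp add: space_P clock_def)
  have laws: "distr (P 1) borel (\<lambda>\<omega>. c * (LINT s:{0..t}|lborel. X s \<omega> powr (-\<alpha>)))
      = distr (P 1) borel (\<lambda>\<omega>. c * clock' t \<omega>)" for c t
    by (rule distr_cong) (simp_all add: clock)
  have moments: "(\<integral>\<omega>. (c * (LINT s:{0..t}|lborel. X s \<omega> powr (-\<alpha>))) ^ n \<partial>P 1)
      = (\<integral>\<omega>. (c * clock' t \<omega>) ^ n \<partial>P 1)" for c t n
    by (rule Bochner_Integration.integral_cong) (simp_all add: clock)
  show ?thesis
  proof (cases "lamperti \<alpha> X 1 \<in> borel_measurable (P 1)")
    case True
    have \<phi>_eq: "\<phi> l = LC.\<phi> l" if "0 \<le> l" for l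
      using laplace_exponent_eq[OF that True] by (simp add: \<phi>)
    have rv: "regularly_varying_at_0 \<phi> \<beta> \<longleftrightarrow> regularly_varying_at_0 LC.\<phi> \<beta>"
      by (rule regularly_varying_at_0_cong) (simp add: \<phi>_eq)
    have ev: "eventually (\<lambda>t. \<phi> (1 / ln t) = LC.\<phi> (1 / ln t)) at_top"
      using eventually_gt_at_top[of 1] by eventually_elim (simp add: \<phi>_eq)
    have "converges_in_distribution (\<lambda>t. distr (P 1) borel (\<lambda>\<omega>. \<phi> (1 / ln t) * clock' t \<omega>)) \<nu> at_top \<longleftrightarrow>
        converges_in_distribution (\<lambda>t. distr (P 1) borel (\<lambda>\<omega>. LC.\<phi> (1 / ln t) * clock' t \<omega>)) \<nu> at_top" for \<nu>
      by (rule converges_in_distribution_cong) (use ev in \<open>auto elim!: eventually_mono\<close>)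
    moreover have "((\<lambda>t. \<integral>\<omega>. (\<phi> (1 / ln t) * clock' t \<omega>) ^ n \<partial>P 1) \<longlongrightarrow> L) at_top \<longleftrightarrow>
        ((\<lambda>t. \<integral>\<omega>. (LC.\<phi> (1 / ln t) * clock' t \<omega>) ^ n \<partial>P 1) \<longlongrightarrow> L) at_top" for n L
      by (rule tendsto_cong) (use ev in \<open>auto elim!: eventually_mono\<close>)
    ultimately show ?thesis
      unfolding laws moments rv
      using LC.regularly_varying_iff[OF \<beta>] LC.regularly_varying_iff_moments[OF \<beta>]
      by (simp only: LC.limit_moment_def)
  next
    \<comment> \<open>Here \<phi> is \<open>0\<close> by default values, and the equivalences hold
      because each condition fails, as in the degenerate case of a vanishing walk.\<close>
    case False
    have \<phi>_0: "\<phi> = (\<lambda>_. 0)"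
      by (rule ext) (simp add: \<phi> laplace_exponent_not_measurable[OF False])
    have s: "0 < \<alpha> powr (-\<beta>)" using \<alpha>_pos by simp
    have "\<not> ((\<lambda>t. \<integral>\<omega>. (\<phi> (1 / ln t) * clock' t \<omega>) ^ 1 \<partial>P 1)
        \<longlongrightarrow> \<alpha> powr (-\<beta> * real 1) * fact 1 / Gamma (1 + real 1 * \<beta>)) at_top"
    proof -
      have "0 < Gamma (1 + \<beta>)" using \<beta> by (simp add: Gamma_real_pos)
      then show ?thesis using \<alpha>_pos by (simp add: \<phi>_0 tendsto_const_iff)
    qed
    moreover have "\<not> (\<exists>W. mittag_leffler_law \<beta> W \<and> converges_in_distribution
        (\<lambda>t. distr (P 1) borel (\<lambda>\<omega>. \<phi> (1 / ln t) * clock' t \<omega>)) (distr W borel (\<lambda>w. \<alpha> powr (-\<beta>) * w)) at_top)"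
      using P1.not_converges_to_mittag_leffler_zero[OF \<beta>(1) s] by (auto simp: \<phi>_0)
    moreover have "\<not> regularly_varying_at_0 \<phi> \<beta>"
      using not_regularly_varying_at_0_zero by (simp add: \<phi>_0)
    ultimately show ?thesis unfolding laws moments by blast
  qed
qed

end
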